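(* Let $(M,g)=(M_+,g_+)\times (M_-,g_-)$ be a product of two connected semi-Riemannian manifolds such that $(M_+,g_+)$ is real analytic, simply connected, and does not admit a nonzero parallel vector field. Then the Lie algebra of Killing vector fields decomposes as $$\mathfrak{kill}(M,g)=\mathfrak{kill}(M_+,g_+)\oplus\mathfrak{kill}(M_-,g_-).$$ In particular, if $(M,g)=(M_1,g_1)\times\ldots\times(M_k,g_k)$ is the de Rham--Wu decomposition of a complete simply connected semi-Riemannian manifold such that all $(M_i,g_i)$ are real analytic and at most one of the factors $(M_i,g_i)$ admits a nonzero parallel vector field, then the Lie algebra of Killing vector fields decomposes as $$\mathfrak{kill}(M,g)=\mathfrak{kill}(M_1,g_1)\oplus\ldots\oplus\mathfrak{kill}(M_k,g_k).$$
   Context: A semi-Riemannian manifold $(M,g)$ is a smooth manifold $M$ with a smooth nondegenerate symmetric bilinear form $g$ on $TM$ of arbitrary (possibly definite, possibly indefinite) signature. Manifolds are connected. Let $\nabla$ be the Levi-Civita connection of $g$. "Complete" means geodesically complete. $(M,g)$ is called real analytic if $M$ is a real analytic manifold and $g$ is a real analytic metric. A vector field $\xi$ is parallel if $\nabla\xi=0$. A Killing vector field of $(M,g)$ is a smooth (globally defined) vector field $\xi$ with $\mathcal{L}_\xi g=0$, i.e. $g(\nabla_X\xi,Y)+g(X,\nabla_Y\xi)=0$ for all vector fields $X,Y$. With the Lie bracket of vector fields, the Killing vector fields of $(M,g)$ form a real Lie algebra, denoted $\mathfrak{kill}(M,g)$. The product $(M_+,g_+)\times(M_-,g_-)$ is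 the manifold $M_+\times M_-$ with the metric $\pi_+^*g_++\pi_-^*g_-$, where $\pi_\pm$ are the natural projections (similarly for more factors). A vector field on a factor is pulled back to the product by regarding it as a vector field tangent to that factor and independent of the points in the other factors. The pull-back of a Killing vector field of a factor is a Killing vector field of the product, so the direct sum of the Lie algebras $\mathfrak{kill}$ of the factors injects into $\mathfrak{kill}(M,g)$ as a Lie subalgebra. The equalities in the claim mean that this injection is onto, i.e. that every Killing vector field of the product is a sum of pull-backs of Killing vector fields of the factors. A semi-Riemannian manifold is indecomposable if it is not isometric to a semi-Riemannian product (of factors of positive dimension). The de Rham--Wu decomposition of a geodesically complete, simply connected semi-Riemannian manifold $(M,g)$ is its decomposition, up to isometry, as a semi-Riemannian product of simply connected, complete semi-Riemannian manifolds in which at most one factor is flat and all remaining factors are indecomposable (the flat factor may be absent); in the claim, all factors, including the flat one if it is present, are listed among the $(M_i,g_i)$, $i=1,\ldots,k$. *)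

theory Defs
  imports "HOL-Analysis.Analysis"
begin

section \<open>Smooth and analytic maps on open subsets of a vector space\<close>

text \<open>
  Manifolds are modelled on a linear subspace \<open>V\<close> of a Euclidean space, so that a family of manifolds
  of different dimensions can share one type. Accordingly, \<open>U\<close> below stands for a subset of \<open>V\<close>
  that is open relative to \<open>V\<close>, and only derivatives in directions of \<open>V\<close> are taken.
\<close>

definition dir_deriv :: "('e::real_normed_vector \<Rightarrow> 'f::real_normed_vector) \<Rightarrow> 'e \<Rightarrow> 'e \<Rightarrow> 'f" where
  "dir_deriv f u x = vector_derivative (\<lambda>t. f (x + t *\<^sub>R u)) (at 0)"

primrec iter_dir_deriv ::
    "('e::real_normed_vector \<Rightarrow> 'f::real_normed_vector) \<Rightarrow> 'e list \<Rightarrow> 'e \<Rightarrow> 'f" where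
  "iter_dir_deriv f [] = f"
| "iter_dir_deriv f (u # us) = dir_deriv (iter_dir_deriv f us) u"

text \<open>\<open>C\<^sup>\<infinity>\<close>: all iterated directional derivatives exist and are continuous.\<close>

definition smooth_on ::
    "'e::real_normed_vector set \<Rightarrow> 'e set \<Rightarrow> ('e \<Rightarrow> 'f::real_normed_vector) \<Rightarrow> bool" where
  "smooth_on V U f \<longleftrightarrow>
     (\<forall>us. set us \<subseteq> V \<longrightarrow>
        continuous_on U (iter_dir_deriv f us) \<and>
        (\<forall>x\<in>U. \<forall>u\<in>V. (\<lambda>t. iter_dir_deriv f us (x + t *\<^sub>R u)) differentiable (at 0)))"

text \<open>
  Local expansion into an (unconditionally, hence absolutely) convergent power series in the
  ambient coordinates; the sum ranges over all multi-indices \<open>m\<close>.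
\<close>

definition real_analytic_on ::
    "'e::euclidean_space set \<Rightarrow> 'e set \<Rightarrow> ('e \<Rightarrow> 'f::real_normed_vector) \<Rightarrow> bool" where
  "real_analytic_on V U f \<longleftrightarrow>
     (\<forall>x\<in>U. \<exists>r>0. \<exists>a :: ('e \<Rightarrow> nat) \<Rightarrow> 'f. \<forall>h\<in>V. norm h < r \<longrightarrow>
        ((\<lambda>m. (\<Prod>b\<in>Basis. (h \<bullet> b) ^ m b) *\<^sub>R a m) has_sum f (x + h)) (Basis \<rightarrow>\<^sub>E UNIV))"

section \<open>Smooth manifolds\<close>

text \<open>
  A manifold is given by an indexed atlas: \<open>labels\<close> is the index set, and the chart with label \<open>\<alpha>\<close> is
  the homeomorphism \<open>chart M \<alpha>\<close> from \<open>chart_dom M \<alpha>\<close> onto an open subset of \<open>model M\<close>.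
  The atlas need not be maximal. The topology of the manifold is the subspace topology of \<open>points\<close>.
\<close>

record ('a, 'l, 'e) atlas =
  points :: "'a set"
  model :: "'e set"
  labels :: "'l set"
  chart_dom :: "'l \<Rightarrow> 'a set"
  chart :: "'l \<Rightarrow> 'a \<Rightarrow> 'e"

definition chart_inv :: "('a, 'l, 'e, 'z) atlas_scheme \<Rightarrow> 'l \<Rightarrow> 'e \<Rightarrow> 'a" where
  "chart_inv M \<alpha> = inv_into (chart_dom M \<alpha>) (chart M \<alpha>)"

definition smooth_manifold ::
    "('a::topological_space, 'l, 'e::euclidean_space, 'z) atlas_scheme \<Rightarrow> bool" where
  "smooth_manifold M \<longleftrightarrow>
     points M \<noteq> {} \<and>
     Hausdorff_space (top_of_set (points M)) \<and>
     second_countable (top_of_set (points M)) \<and>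
     subspace (model M) \<and>
     (\<Union>\<alpha>\<in>labels M. chart_dom M \<alpha>) = points M \<and>
     (\<forall>\<alpha>\<in>labels M.
        openin (top_of_set (points M)) (chart_dom M \<alpha>) \<and>
        openin (top_of_set (model M)) (chart M \<alpha> ` chart_dom M \<alpha>) \<and>
        homeomorphism (chart_dom M \<alpha>) (chart M \<alpha> ` chart_dom M \<alpha>) (chart M \<alpha>) (chart_inv M \<alpha>)) \<and>
     (\<forall>\<alpha>\<in>labels M. \<forall>\<beta>\<in>labels M.
        smooth_on (model M) (chart M \<alpha> ` (chart_dom M \<alpha> \<inter> chart_dom M \<beta>))
          (\<lambda>x. chart M \<beta> (chart_inv M \<alpha> x)))"

text \<open>
  Derivative at the point \<open>p\<close> of a vector-valued function \<open>h\<close> on the manifold, in the direction which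
  has coordinates \<open>u\<close> in the chart \<open>\<alpha>\<close>.
\<close>

definition chart_deriv ::
    "('a, 'l, 'e::real_normed_vector, 'z) atlas_scheme \<Rightarrow> 'l \<Rightarrow>
     ('a \<Rightarrow> 'f::real_normed_vector) \<Rightarrow> 'a \<Rightarrow> 'e \<Rightarrow> 'f" where
  "chart_deriv M \<alpha> h p u = dir_deriv (\<lambda>x. h (chart_inv M \<alpha> x)) u (chart M \<alpha> p)"

text \<open>
  The differential of \<open>F\<close> at \<open>p\<close> in the charts \<open>\<alpha>\<close> and \<open>\<beta>\<close>. For \<open>F = id\<close> and \<open>N = M\<close> this is the
  change of coordinates on tangent vectors.
\<close>

definition tangent_map ::
    "('a, 'l, 'e::real_normed_vector, 'z) atlas_scheme \<Rightarrow>
     ('b, 'm, 'f::real_normed_vector, 'y) atlas_scheme \<Rightarrow>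
     ('a \<Rightarrow> 'b) \<Rightarrow> 'l \<Rightarrow> 'm \<Rightarrow> 'a \<Rightarrow> 'e \<Rightarrow> 'f" where
  "tangent_map M N F \<alpha> \<beta> p u = chart_deriv M \<alpha> (\<lambda>q. chart N \<beta> (F q)) p u"

definition smooth_map ::
    "('a::topological_space, 'l, 'e::real_normed_vector, 'z) atlas_scheme \<Rightarrow>
     ('b::topological_space, 'm, 'f::real_normed_vector, 'y) atlas_scheme \<Rightarrow> ('a \<Rightarrow> 'b) \<Rightarrow> bool" where
  "smooth_map M N F \<longleftrightarrow>
     F ` points M \<subseteq> points N \<and> continuous_on (points M) F \<and>
     (\<forall>\<alpha>\<in>labels M. \<forall>\<beta>\<in>labels N.
        smooth_on (model M) (chart M \<alpha> ` {p \<in> chart_dom M \<alpha>. F p \<in> chart_dom N \<beta>})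
          (\<lambda>x. chart N \<beta> (F (chart_inv M \<alpha> x))))"

definition diffeomorphism ::
    "('a::topological_space, 'l, 'e::real_normed_vector, 'z) atlas_scheme \<Rightarrow>
     ('b::topological_space, 'm, 'f::real_normed_vector, 'y) atlas_scheme \<Rightarrow> ('a \<Rightarrow> 'b) \<Rightarrow> bool" where
  "diffeomorphism M N F \<longleftrightarrow>
     bij_betw F (points M) (points N) \<and> smooth_map M N F \<and> smooth_map N M (inv_into (points M) F)"

section \<open>Vector fields\<close>

text \<open>
  A vector field \<open>X\<close> is given by its components: \<open>X \<alpha> p\<close> is the coordinate vector of the value at \<open>p\<close>
  in the chart \<open>\<alpha>\<close>. Components are normalised to \<open>0\<close> where they are meaningless, so that
  equality of vector fields is equality of functions.
\<close>

type_synonym ('a, 'l, 'e) field = "'l \<Rightarrow> 'a \<Rightarrow> 'e"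

definition vector_field ::
    "('a, 'l, 'e::real_normed_vector, 'z) atlas_scheme \<Rightarrow> ('a, 'l, 'e) field \<Rightarrow> bool" where
  "vector_field M X \<longleftrightarrow>
     (\<forall>\<alpha> p. \<not> (\<alpha> \<in> labels M \<and> p \<in> chart_dom M \<alpha>) \<longrightarrow> X \<alpha> p = 0) \<and>
     (\<forall>\<alpha>\<in>labels M. \<forall>p\<in>chart_dom M \<alpha>. X \<alpha> p \<in> model M) \<and>
     (\<forall>\<alpha>\<in>labels M. \<forall>\<beta>\<in>labels M. \<forall>p\<in>chart_dom M \<alpha> \<inter> chart_dom M \<beta>.
        X \<beta> p = tangent_map M M id \<alpha> \<beta> p (X \<alpha> p)) \<and>
     (\<forall>\<alpha>\<in>labels M. smooth_on (model M) (chart M \<alpha> ` chart_dom M \<alpha>) (\<lambda>x. X \<alpha> (chart_inv M \<alpha> x)))"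

definition field_add :: "('a, 'l, 'e::real_vector) field \<Rightarrow> ('a, 'l, 'e) field \<Rightarrow> ('a, 'l, 'e) field" where
  "field_add X Y = (\<lambda>\<alpha> p. X \<alpha> p + Y \<alpha> p)"

definition field_scale :: "real \<Rightarrow> ('a, 'l, 'e::real_vector) field \<Rightarrow> ('a, 'l, 'e) field" where
  "field_scale c X = (\<lambda>\<alpha> p. c *\<^sub>R X \<alpha> p)"

definition field_bracket ::
    "('a, 'l, 'e::real_normed_vector, 'z) atlas_scheme \<Rightarrow>
     ('a, 'l, 'e) field \<Rightarrow> ('a, 'l, 'e) field \<Rightarrow> ('a, 'l, 'e) field" where
  "field_bracket M X Y = (\<lambda>\<alpha> p.
     if \<alpha> \<in> labels M \<and> p \<in> chart_dom M \<alpha>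
     then chart_deriv M \<alpha> (Y \<alpha>) p (X \<alpha> p) - chart_deriv M \<alpha> (X \<alpha>) p (Y \<alpha> p)
     else 0)"

section \<open>Semi-Riemannian manifolds\<close>

text \<open>\<open>metric M \<alpha> p u v\<close> is \<open>g\<^sub>p\<close> applied to the tangent vectors with coordinates \<open>u\<close> and \<open>v\<close> in the chart \<open>\<alpha>\<close>.\<close>

record ('a, 'l, 'e) metric_atlas = "('a, 'l, 'e) atlas" +
  metric :: "'l \<Rightarrow> 'a \<Rightarrow> 'e \<Rightarrow> 'e \<Rightarrow> real"

text \<open>Semi-Riemannian manifolds are connected by convention; the signature is arbitrary.\<close>

definition semi_riemannian ::
    "('a::topological_space, 'l, 'e::euclidean_space) metric_atlas \<Rightarrow> bool" where
  "semi_riemannian M \<longleftrightarrow>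
     smooth_manifold M \<and> connected (points M) \<and>
     (\<forall>\<alpha>\<in>labels M. \<forall>p\<in>chart_dom M \<alpha>.
        (\<forall>u\<in>model M. \<forall>v\<in>model M. metric M \<alpha> p u v = metric M \<alpha> p v u) \<and>
        (\<forall>u\<in>model M. \<forall>v\<in>model M. \<forall>w\<in>model M.
           metric M \<alpha> p (u + v) w = metric M \<alpha> p u w + metric M \<alpha> p v w) \<and>
        (\<forall>c. \<forall>u\<in>model M. \<forall>w\<in>model M. metric M \<alpha> p (c *\<^sub>R u) w = c * metric M \<alpha> p u w) \<and>
        (\<forall>u\<in>model M. (\<forall>v\<in>model M. metric M \<alpha> p u v = 0) \<longrightarrow> u = 0)) \<and>
     (\<forall>\<alpha>\<in>labels M. \<forall>\<beta>\<in>labels M. \<forall>p\<in>chart_dom M \<alpha> \<inter> chart_dom M \<beta>.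
        \<forall>u\<in>model M. \<forall>v\<in>model M.
          metric M \<beta> p (tangent_map M M id \<alpha> \<beta> p u) (tangent_map M M id \<alpha> \<beta> p v) = metric M \<alpha> p u v) \<and>
     (\<forall>\<alpha>\<in>labels M. \<forall>u\<in>model M. \<forall>v\<in>model M.
        smooth_on (model M) (chart M \<alpha> ` chart_dom M \<alpha>) (\<lambda>x. metric M \<alpha> (chart_inv M \<alpha> x) u v))"

definition isometry ::
    "('a::topological_space, 'l, 'e::real_normed_vector) metric_atlas \<Rightarrow>
     ('b::topological_space, 'm, 'f::real_normed_vector) metric_atlas \<Rightarrow> ('a \<Rightarrow> 'b) \<Rightarrow> bool" where
  "isometry M N F \<longleftrightarrow>
     diffeomorphism M N F \<and>
     (\<forall>\<alpha>\<in>labels M. \<forall>\<beta>\<in>labels N. \<forall>p\<in>chart_dom M \<alpha>. F p \<in> chart_dom N \<beta> \<longrightarrow>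
        (\<forall>u\<in>model M. \<forall>v\<in>model M.
           metric N \<beta> (F p) (tangent_map M N F \<alpha> \<beta> p u) (tangent_map M N F \<alpha> \<beta> p v) = metric M \<alpha> p u v))"

text \<open>
  The given atlas is only smooth, so the analytic structure consists of a further, analytic atlas
  that is smoothly compatible with it and in which \<open>g\<close> is analytic. Labelling charts by their
  domain and coordinate map is general enough to list every atlas.
\<close>

definition real_analytic :: "('a::topological_space, 'l, 'e::euclidean_space) metric_atlas \<Rightarrow> bool" where
  "real_analytic M \<longleftrightarrow>
     (\<exists>N :: ('a, 'a set \<times> ('a \<Rightarrow> 'e), 'e) metric_atlas.
        semi_riemannian N \<and> points N = points M \<and> isometry M N id \<and>
        (\<forall>\<alpha>\<in>labels N. \<forall>\<beta>\<in>labels N.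
           real_analytic_on (model N) (chart N \<alpha> ` (chart_dom N \<alpha> \<inter> chart_dom N \<beta>))
             (\<lambda>x. chart N \<beta> (chart_inv N \<alpha> x))) \<and>
        (\<forall>\<alpha>\<in>labels N. \<forall>u\<in>model N. \<forall>v\<in>model N.
           real_analytic_on (model N) (chart N \<alpha> ` chart_dom N \<alpha>)
             (\<lambda>x. metric N \<alpha> (chart_inv N \<alpha> x) u v)))"

section \<open>The Levi-Civita connection\<close>

text \<open>
  \<open>christoffel M \<alpha> p u v\<close> is the vector \<open>\<Sum>\<^sub>i\<^sub>j u\<^sup>i v\<^sup>j \<Gamma>\<^sub>i\<^sub>j\<close>, i.e. \<open>\<nabla>\<^sub>U V\<close> at \<open>p\<close> for the vector fields
  \<open>U\<close> and \<open>V\<close> with constant components \<open>u\<close> and \<open>v\<close> in the chart \<open>\<alpha>\<close>. The equation is the Koszul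
  formula, whose bracket terms vanish for such fields.
\<close>

definition christoffel ::
    "('a, 'l, 'e::real_normed_vector) metric_atlas \<Rightarrow> 'l \<Rightarrow> 'a \<Rightarrow> 'e \<Rightarrow> 'e \<Rightarrow> 'e" where
  "christoffel M \<alpha> p u v =
     (THE w. w \<in> model M \<and>
        (\<forall>z\<in>model M. 2 * metric M \<alpha> p w z =
           chart_deriv M \<alpha> (\<lambda>q. metric M \<alpha> q v z) p u
           + chart_deriv M \<alpha> (\<lambda>q. metric M \<alpha> q u z) p v
           - chart_deriv M \<alpha> (\<lambda>q. metric M \<alpha> q u v) p z))"

text \<open>Components in the chart \<open>\<alpha>\<close> of \<open>\<nabla>\<^sub>u X\<close> at \<open>p\<close>.\<close>

definition covariant_deriv ::
    "('a, 'l, 'e::real_normed_vector) metric_atlas \<Rightarrow> ('a, 'l, 'e) field \<Rightarrow> 'l \<Rightarrow> 'a \<Rightarrow> 'e \<Rightarrow> 'e" where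
  "covariant_deriv M X \<alpha> p u = chart_deriv M \<alpha> (X \<alpha>) p u + christoffel M \<alpha> p u (X \<alpha> p)"

definition parallel_field ::
    "('a, 'l, 'e::real_normed_vector) metric_atlas \<Rightarrow> ('a, 'l, 'e) field \<Rightarrow> bool" where
  "parallel_field M X \<longleftrightarrow>
     vector_field M X \<and>
     (\<forall>\<alpha>\<in>labels M. \<forall>p\<in>chart_dom M \<alpha>. \<forall>u\<in>model M. covariant_deriv M X \<alpha> p u = 0)"

definition admits_nonzero_parallel_field :: "('a, 'l, 'e::real_normed_vector) metric_atlas \<Rightarrow> bool" where
  "admits_nonzero_parallel_field M \<longleftrightarrow> (\<exists>X. parallel_field M X \<and> X \<noteq> (\<lambda>_ _. 0))"

definition killing_field ::
    "('a, 'l, 'e::real_normed_vector) metric_atlas \<Rightarrow> ('a, 'l, 'e) field \<Rightarrow> bool" where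
  "killing_field M X \<longleftrightarrow>
     vector_field M X \<and>
     (\<forall>\<alpha>\<in>labels M. \<forall>p\<in>chart_dom M \<alpha>. \<forall>u\<in>model M. \<forall>v\<in>model M.
        metric M \<alpha> p (covariant_deriv M X \<alpha> p u) v + metric M \<alpha> p u (covariant_deriv M X \<alpha> p v) = 0)"

definition curvature ::
    "('a, 'l, 'e::real_normed_vector) metric_atlas \<Rightarrow> 'l \<Rightarrow> 'a \<Rightarrow> 'e \<Rightarrow> 'e \<Rightarrow> 'e \<Rightarrow> 'e" where
  "curvature M \<alpha> p u v w =
     chart_deriv M \<alpha> (\<lambda>q. christoffel M \<alpha> q v w) p u
     - chart_deriv M \<alpha> (\<lambda>q. christoffel M \<alpha> q u w) p v
     + christoffel M \<alpha> p u (christoffel M \<alpha> p v w)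
     - christoffel M \<alpha> p v (christoffel M \<alpha> p u w)"

definition flat :: "('a, 'l, 'e::real_normed_vector) metric_atlas \<Rightarrow> bool" where
  "flat M \<longleftrightarrow>
     (\<forall>\<alpha>\<in>labels M. \<forall>p\<in>chart_dom M \<alpha>. \<forall>u\<in>model M. \<forall>v\<in>model M. \<forall>w\<in>model M.
        curvature M \<alpha> p u v w = 0)"

definition geodesic_on ::
    "('a::topological_space, 'l, 'e::real_normed_vector) metric_atlas \<Rightarrow> real set \<Rightarrow> (real \<Rightarrow> 'a) \<Rightarrow> bool" where
  "geodesic_on M I \<gamma> \<longleftrightarrow>
     open I \<and> is_interval I \<and> I \<noteq> {} \<and> continuous_on I \<gamma> \<and> \<gamma> ` I \<subseteq> points M \<and>
     (\<forall>\<alpha>\<in>labels M. \<forall>t\<in>I. \<gamma> t \<in> chart_dom M \<alpha> \<longrightarrow>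
        (let c = (\<lambda>s. chart M \<alpha> (\<gamma> s)); c' = (\<lambda>s. vector_derivative c (at s)) in
           c differentiable (at t) \<and>
           (c' has_vector_derivative - christoffel M \<alpha> (\<gamma> t) (c' t) (c' t)) (at t)))"

definition geodesically_complete ::
    "('a::topological_space, 'l, 'e::real_normed_vector) metric_atlas \<Rightarrow> bool" where
  "geodesically_complete M \<longleftrightarrow>
     (\<forall>I \<gamma>. geodesic_on M I \<gamma> \<longrightarrow> (\<exists>\<delta>. geodesic_on M UNIV \<delta> \<and> (\<forall>t\<in>I. \<delta> t = \<gamma> t)))"

section \<open>Products\<close>

definition riem_prod ::
    "('a, 'l, 'e) metric_atlas \<Rightarrow> ('b, 'm, 'f) metric_atlas \<Rightarrow> ('a \<times> 'b, 'l \<times> 'm, 'e \<times> 'f) metric_atlas" where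
  "riem_prod M N =
     \<lparr> points = points M \<times> points N,
       model = model M \<times> model N,
       labels = labels M \<times> labels N,
       chart_dom = (\<lambda>(\<alpha>, \<beta>). chart_dom M \<alpha> \<times> chart_dom N \<beta>),
       chart = (\<lambda>(\<alpha>, \<beta>) (p, q). (chart M \<alpha> p, chart N \<beta> q)),
       metric = (\<lambda>(\<alpha>, \<beta>) (p, q) u v. metric M \<alpha> p (fst u) (fst v) + metric N \<beta> q (snd u) (snd v)) \<rparr>"

definition pull_back_fst ::
    "('a, 'l, 'e::zero) metric_atlas \<Rightarrow> ('b, 'm, 'f::zero) metric_atlas \<Rightarrow>
     ('a, 'l, 'e) field \<Rightarrow> ('a \<times> 'b, 'l \<times> 'm, 'e \<times> 'f) field" where
  "pull_back_fst M N X = (\<lambda>(\<alpha>, \<beta>) (p, q).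
     if \<alpha> \<in> labels M \<and> \<beta> \<in> labels N \<and> p \<in> chart_dom M \<alpha> \<and> q \<in> chart_dom N \<beta> then (X \<alpha> p, 0) else (0, 0))"

definition pull_back_snd ::
    "('a, 'l, 'e::zero) metric_atlas \<Rightarrow> ('b, 'm, 'f::zero) metric_atlas \<Rightarrow>
     ('b, 'm, 'f) field \<Rightarrow> ('a \<times> 'b, 'l \<times> 'm, 'e \<times> 'f) field" where
  "pull_back_snd M N Y = (\<lambda>(\<alpha>, \<beta>) (p, q).
     if \<alpha> \<in> labels M \<and> \<beta> \<in> labels N \<and> p \<in> chart_dom M \<alpha> \<and> q \<in> chart_dom N \<beta> then (0, Y \<beta> q) else (0, 0))"

text \<open>
  Product of the family \<open>(M i)\<close> indexed by a finite type. The members share the type of points and the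
  model type, but their point sets, topologies and dimensions are unrelated.
\<close>

definition riem_prod_family ::
    "('k::finite \<Rightarrow> ('a, 'l, 'e::real_vector) metric_atlas) \<Rightarrow> ('a ^ 'k, 'k \<Rightarrow> 'l, 'e ^ 'k) metric_atlas" where
  "riem_prod_family M =
     \<lparr> points = {x. \<forall>i. x $ i \<in> points (M i)},
       model = {v. \<forall>i. v $ i \<in> model (M i)},
       labels = {\<alpha>. \<forall>i. \<alpha> i \<in> labels (M i)},
       chart_dom = (\<lambda>\<alpha>. {x. \<forall>i. x $ i \<in> chart_dom (M i) (\<alpha> i)}),
       chart = (\<lambda>\<alpha> x. \<chi> i. chart (M i) (\<alpha> i) (x $ i)),
       metric = (\<lambda>\<alpha> x u v. \<Sum>i\<in>UNIV. metric (M i) (\<alpha> i) (x $ i) (u $ i) (v $ i)) \<rparr>"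

definition pull_back_factor ::
    "('k::finite \<Rightarrow> ('a, 'l, 'e::real_vector) metric_atlas) \<Rightarrow> 'k \<Rightarrow>
     ('a, 'l, 'e) field \<Rightarrow> ('a ^ 'k, 'k \<Rightarrow> 'l, 'e ^ 'k) field" where
  "pull_back_factor M i X = (\<lambda>\<alpha> x.
     if \<alpha> \<in> labels (riem_prod_family M) \<and> x \<in> chart_dom (riem_prod_family M) \<alpha>
     then (\<chi> j. if j = i then X (\<alpha> i) (x $ i) else 0) else 0)"

section \<open>The de Rham--Wu decomposition\<close>

text \<open>
  A factor of \<open>M\<close> is diffeomorphic to a slice of \<open>M\<close>, so it can be realised with points in the type of
  points of \<open>M\<close> and with the same model type. Hence the types of the factors below are no restriction.
\<close>

definition indecomposable :: "('a::topological_space, 'l, 'e::euclidean_space) metric_atlas \<Rightarrow> bool" where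
  "indecomposable M \<longleftrightarrow>
     \<not> (\<exists>(N1 :: ('a, 'a set \<times> ('a \<Rightarrow> 'e), 'e) metric_atlas)
          (N2 :: ('a, 'a set \<times> ('a \<Rightarrow> 'e), 'e) metric_atlas) F.
          semi_riemannian N1 \<and> semi_riemannian N2 \<and> dim (model N1) > 0 \<and> dim (model N2) > 0 \<and>
          isometry M (riem_prod N1 N2) F)"

definition de_rham_wu_decomposition ::
    "('b::topological_space, 'm, 'f::euclidean_space) metric_atlas \<Rightarrow>
     ('k::finite \<Rightarrow> ('a::topological_space, 'l, 'e::euclidean_space) metric_atlas) \<Rightarrow> bool" where
  "de_rham_wu_decomposition N M \<longleftrightarrow>
     (\<exists>F. isometry N (riem_prod_family M) F) \<and>
     (\<forall>i. semi_riemannian (M i) \<and> simply_connected (points (M i)) \<and> geodesically_complete (M i)) \<and>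
     (\<forall>i j. flat (M i) \<longrightarrow> flat (M j) \<longrightarrow> i = j) \<and>
     (\<forall>i. \<not> flat (M i) \<longrightarrow> indecomposable (M i))"

section \<open>Lie algebras of Killing vector fields\<close>

record 'v lie_structure =
  lie_carrier :: "'v set"
  lie_add :: "'v \<Rightarrow> 'v \<Rightarrow> 'v"
  lie_scale :: "real \<Rightarrow> 'v \<Rightarrow> 'v"
  lie_bracket :: "'v \<Rightarrow> 'v \<Rightarrow> 'v"

definition lie_isomorphism :: "'v lie_structure \<Rightarrow> 'w lie_structure \<Rightarrow> ('v \<Rightarrow> 'w) \<Rightarrow> bool" where
  "lie_isomorphism L K \<Phi> \<longleftrightarrow>
     bij_betw \<Phi> (lie_carrier L) (lie_carrier K) \<and>
     (\<forall>x\<in>lie_carrier L. \<forall>y\<in>lie_carrier L. \<Phi> (lie_add L x y) = lie_add K (\<Phi> x) (\<Phi> y)) \<and>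
     (\<forall>c. \<forall>x\<in>lie_carrier L. \<Phi> (lie_scale L c x) = lie_scale K c (\<Phi> x)) \<and>
     (\<forall>x\<in>lie_carrier L. \<forall>y\<in>lie_carrier L. \<Phi> (lie_bracket L x y) = lie_bracket K (\<Phi> x) (\<Phi> y))"

definition lie_direct_sum :: "'v lie_structure \<Rightarrow> 'w lie_structure \<Rightarrow> ('v \<times> 'w) lie_structure" where
  "lie_direct_sum L K =
     \<lparr> lie_carrier = lie_carrier L \<times> lie_carrier K,
       lie_add = (\<lambda>(x, y) (x', y'). (lie_add L x x', lie_add K y y')),
       lie_scale = (\<lambda>c (x, y). (lie_scale L c x, lie_scale K c y)),
       lie_bracket = (\<lambda>(x, y) (x', y'). (lie_bracket L x x', lie_bracket K y y')) \<rparr>"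

definition lie_direct_sum_family :: "('k::finite \<Rightarrow> 'v lie_structure) \<Rightarrow> ('k \<Rightarrow> 'v) lie_structure" where
  "lie_direct_sum_family L =
     \<lparr> lie_carrier = {x. \<forall>i. x i \<in> lie_carrier (L i)},
       lie_add = (\<lambda>x y i. lie_add (L i) (x i) (y i)),
       lie_scale = (\<lambda>c x i. lie_scale (L i) c (x i)),
       lie_bracket = (\<lambda>x y i. lie_bracket (L i) (x i) (y i)) \<rparr>"

definition killing_algebra ::
    "('a, 'l, 'e::real_normed_vector) metric_atlas \<Rightarrow> ('a, 'l, 'e) field lie_structure" where
  "killing_algebra M =
     \<lparr> lie_carrier = {X. killing_field M X},
       lie_add = field_add,
       lie_scale = field_scale,
       lie_bracket = field_bracket M \<rparr>"

definition sum_of_pull_backs ::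
    "('a, 'l, 'e::real_vector) metric_atlas \<Rightarrow> ('b, 'm, 'f::real_vector) metric_atlas \<Rightarrow>
     ('a, 'l, 'e) field \<times> ('b, 'm, 'f) field \<Rightarrow> ('a \<times> 'b, 'l \<times> 'm, 'e \<times> 'f) field" where
  "sum_of_pull_backs M N = (\<lambda>(X, Y). field_add (pull_back_fst M N X) (pull_back_snd M N Y))"

definition sum_of_pull_backs_family ::
    "('k::finite \<Rightarrow> ('a, 'l, 'e::real_vector) metric_atlas) \<Rightarrow>
     ('k \<Rightarrow> ('a, 'l, 'e) field) \<Rightarrow> ('a ^ 'k, 'k \<Rightarrow> 'l, 'e ^ 'k) field" where
  "sum_of_pull_backs_family M X = (\<lambda>\<alpha> x. \<Sum>i\<in>UNIV. pull_back_factor M i (X i) \<alpha> x)"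

end

theory Submission
  imports Defs
begin

text \<open>
  Let \<open>X\<close> be a Killing field on a product and let \<open>N\<close> be one of the factors. Write \<open>A\<close> for the component
  of \<open>X\<close> tangent to \<open>N\<close>, and let \<open>w\<close> be tangent to the remaining factors. For a fixed point of these
  factors, the transverse derivative \<open>K = \<partial>\<^sub>w A\<close> is a vector field on all of \<open>N\<close>, and it is parallel:

  \<^item> It is Killing. On each slice, \<open>A\<close> satisfies the Killing equation of \<open>N\<close>, which is linear in \<open>A\<close> and
    whose coefficients do not depend on the transverse variables, so it can be differentiated along \<open>w\<close>.

  \<^item> It is a gradient. The mixed part of the Killing equation of the product says
    \<open>g\<^sub>N(u, \<partial>\<^sub>w A) + g(\<partial>\<^sub>u X, w) = 0\<close> for \<open>u\<close> tangent to \<open>N\<close>, and \<open>g(_, w)\<close> is constant along \<open>N\<close>, so \<open>K\<close>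
    is minus the gradient of \<open>g(X, w)\<close>.

  Hence \<open>\<nabla>K\<close> is both skew and symmetric with respect to \<open>g\<^sub>N\<close>, and \<open>\<nabla>K = 0\<close>
  (\<open>killing_gradient_parallel\<close>, \<open>transverse_parallel\<close>). If \<open>N\<close> has no nonzero parallel field, then
  \<open>\<partial>\<^sub>w A = 0\<close>, and the mixed equation gives in return that the components of \<open>X\<close> tangent to the other
  factors do not vary along \<open>N\<close> (\<open>cross_derivatives_zero\<close>). Of any two distinct factors at least one
  has no nonzero parallel field, so no component of \<open>X\<close> varies along another factor. As the factors are
  connected, each component depends on the point of its own factor only
  (\<open>component_constant_along_factor\<close>), and it is Killing there (\<open>slice_killing\<close>). Thus \<open>X\<close> is the sum of
  the pull-backs of its slices.

  The locale \<open>product_factor\<close> records what it means that \<open>N\<close> is a factor of \<open>P\<close> without mentioning the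
  other factors. It covers both factors of a binary product, whose types are unrelated, and every
  factor of a finite family.
\<close>

section \<open>Calculus with directional derivatives along a subspace\<close>

lemma has_vector_derivative_eventually_eq:
  assumes "(f has_vector_derivative D) (at x)" "eventually (\<lambda>t. f t = g t) (nhds x)"
  shows "(g has_vector_derivative D) (at x)"
  using assms(1) unfolding has_vector_derivative_def
proof (rule has_derivative_transform_eventually)
  show "eventually (\<lambda>t. f t = g t) (at x)"
    using assms(2) by (simp add: eventually_at_filter eventually_mono)
  show "f x = g x" using assms(2) by (rule eventually_nhds_x_imp_x)
qed simp

text \<open>
  The ball is taken in the ambient space, so that openness of \<open>U\<close> in \<open>V\<close> and continuity of \<open>g\<close> on \<open>U\<close>
  are available through one radius.
\<close>

lemma openin_subspace_nhd:
  fixes V :: "'a::real_normed_vector set" and g :: "'a \<Rightarrow> 'b::real_normed_vector"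
  assumes U: "openin (top_of_set V) U" and x: "x \<in> U" and g: "continuous_on U g" and e: "0 < (e::real)"
  obtains d where "d > 0" "\<And>y. y \<in> V \<Longrightarrow> dist y x < d \<Longrightarrow> y \<in> U \<and> norm (g y - g x) < e"
proof -
  obtain d1 where d1: "d1 > 0" "ball x d1 \<inter> V \<subseteq> U"
    using U x by (auto simp: openin_contains_ball)
  obtain d2 where d2: "d2 > 0" "\<And>y. y \<in> U \<Longrightarrow> dist y x < d2 \<Longrightarrow> dist (g y) (g x) < e"
    using g x e unfolding continuous_on_iff by blast
  show ?thesis
  proof (rule that[of "min d1 d2"])
    show "min d1 d2 > 0" using d1 d2 by simp
    fix y assume "y \<in> V" "dist y x < min d1 d2"
    then have "y \<in> U" using d1 by (auto simp: dist_commute)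
    then show "y \<in> U \<and> norm (g y - g x) < e"
      using d2 \<open>dist y x < min d1 d2\<close> by (auto simp: dist_norm)
  qed
qed

lemma openin_subspace_line:
  fixes V :: "'a::real_normed_vector set"
  assumes U: "openin (top_of_set V) U" and V: "subspace V" and x: "x \<in> U" and u: "u \<in> V"
  shows "eventually (\<lambda>t::real. x + t *\<^sub>R u \<in> U) (nhds 0)"
proof -
  obtain d where d: "d > 0" "\<And>y. y \<in> V \<Longrightarrow> dist y x < d \<Longrightarrow> y \<in> U"
    using openin_subspace_nhd[OF U x continuous_on_id zero_less_one] by metis
  have xV: "x \<in> V" using U x openin_imp_subset by fastforce
  have "((\<lambda>t::real. x + t *\<^sub>R u) \<longlongrightarrow> x + 0 *\<^sub>R u) (nhds 0)"
    by (intro tendsto_intros filterlim_ident)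
  then have "eventually (\<lambda>t::real. dist (x + t *\<^sub>R u) x < d) (nhds 0)"
    using tendstoD[OF _ d(1)] by fastforce
  then show ?thesis
    by eventually_elim (use d xV u V in \<open>auto simp: subspace_add subspace_scale\<close>)
qed

text \<open>
  Only germs matter: in directions of \<open>V\<close> a short line through a point of \<open>U\<close> stays in \<open>U\<close>. The lemma
  discards the arbitrary values that coordinate expressions take outside the image of a chart.
\<close>

lemma dir_deriv_cong_on:
  assumes U: "openin (top_of_set V) U" and V: "subspace V" and x: "x \<in> U" and u: "u \<in> V"
    and fg: "\<And>y. y \<in> U \<Longrightarrow> f y = g y"
  shows "dir_deriv f u x = dir_deriv g u x"
  unfolding dir_deriv_def
proof (rule vector_derivative_cong_eq)
  show "eventually (\<lambda>t. t \<in> UNIV \<longrightarrow> f (x + t *\<^sub>R u) = g (x + t *\<^sub>R u)) (nhds 0)"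
    using openin_subspace_line[OF U V x u] by eventually_elim (simp add: fg)
qed (use fg[OF x] in auto)

lemma differentiable_cong_line:
  fixes f g :: "'a::real_normed_vector \<Rightarrow> 'b::real_normed_vector"
  assumes U: "openin (top_of_set V) U" and V: "subspace V" and x: "x \<in> U" and u: "u \<in> V"
    and fg: "\<And>y. y \<in> U \<Longrightarrow> f y = g y"
    and d: "(\<lambda>t. f (x + t *\<^sub>R u)) differentiable (at (0::real))"
  shows "(\<lambda>t. g (x + t *\<^sub>R u)) differentiable (at (0::real))"
proof -
  obtain D where D: "((\<lambda>t. f (x + t *\<^sub>R u)) has_derivative D) (at 0)"
    using d by (auto simp: differentiable_def)
  have ev: "eventually (\<lambda>t. f (x + t *\<^sub>R u) = g (x + t *\<^sub>R u)) (nhds 0)"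
    using openin_subspace_line[OF U V x u] by eventually_elim (simp add: fg)
  have "((\<lambda>t. g (x + t *\<^sub>R u)) has_derivative D) (at 0)"
    by (rule has_derivative_transform_eventually[OF D])
       (use ev fg[OF x] in \<open>auto simp: eventually_at_filter elim: eventually_mono\<close>)
  then show ?thesis by (auto simp: differentiable_def)
qed

lemma iter_dir_deriv_cong_on:
  assumes U: "openin (top_of_set V) U" and V: "subspace V"
    and fg: "\<And>y. y \<in> U \<Longrightarrow> f y = g y" and us: "set us \<subseteq> V" and x: "x \<in> U"
  shows "iter_dir_deriv f us x = iter_dir_deriv g us x"
  using us x
proof (induction us arbitrary: x)
  case (Cons u us)
  then show ?case
    by (simp, intro dir_deriv_cong_on[OF U V]) auto
qed (simp add: fg)

lemma smooth_on_cong: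
  assumes U: "openin (top_of_set V) U" and V: "subspace V"
    and fg: "\<And>y. y \<in> U \<Longrightarrow> f y = g y" and f: "smooth_on V U f"
  shows "smooth_on V U g"
  unfolding smooth_on_def
proof (intro allI impI conjI ballI)
  fix us assume us: "set us \<subseteq> V"
  note eq = iter_dir_deriv_cong_on[OF U V fg us]
  show "continuous_on U (iter_dir_deriv g us)"
    using f us eq by (auto simp: smooth_on_def cong: continuous_on_cong)
  fix x u assume x: "x \<in> U" and u: "u \<in> V"
  show "(\<lambda>t. iter_dir_deriv g us (x + t *\<^sub>R u)) differentiable (at 0)"
    by (rule differentiable_cong_line[OF U V x u eq]) (use f us x u in \<open>auto simp: smooth_on_def\<close>)
qed

lemma iter_dir_deriv_dir_deriv:
  "iter_dir_deriv (dir_deriv f u) us = iter_dir_deriv f (us @ [u])"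
  by (induction us) auto

lemma smooth_on_dir_deriv:
  assumes "smooth_on V U f" "u \<in> V"
  shows "smooth_on V U (dir_deriv f u)"
  using assms by (simp add: smooth_on_def iter_dir_deriv_dir_deriv)

lemma smooth_on_iter_continuous:
  "smooth_on V U f \<Longrightarrow> set us \<subseteq> V \<Longrightarrow> continuous_on U (iter_dir_deriv f us)"
  by (simp add: smooth_on_def)

lemma smooth_on_iter_differentiable:
  "smooth_on V U f \<Longrightarrow> set us \<subseteq> V \<Longrightarrow> x \<in> U \<Longrightarrow> u \<in> V \<Longrightarrow>
     (\<lambda>t. iter_dir_deriv f us (x + t *\<^sub>R u)) differentiable (at 0)"
  by (simp add: smooth_on_def)

lemma smooth_on_continuous: "smooth_on V U f \<Longrightarrow> continuous_on U f"
  unfolding smooth_on_def by (metis empty_subsetI iter_dir_deriv.simps(1) list.set(1))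

lemma smooth_on_has_dir_deriv:
  assumes "smooth_on V U f" "x \<in> U" "u \<in> V"
  shows "((\<lambda>t. f (x + t *\<^sub>R u)) has_vector_derivative dir_deriv f u x) (at 0)"
proof -
  have "(\<lambda>t. iter_dir_deriv f [] (x + t *\<^sub>R u)) differentiable (at 0)"
    using assms unfolding smooth_on_def by (metis empty_subsetI list.set(1))
  then show ?thesis unfolding dir_deriv_def by (simp add: vector_derivative_works)
qed

lemma smooth_on_has_dir_deriv_along:
  assumes "smooth_on V U f" "x + s *\<^sub>R u \<in> U" "u \<in> V"
  shows "((\<lambda>t. f (x + t *\<^sub>R u)) has_vector_derivative dir_deriv f u (x + s *\<^sub>R u)) (at s)"
proof -
  have "((\<lambda>r. f (x + s *\<^sub>R u + r *\<^sub>R u)) has_vector_derivative dir_deriv f u (x + s *\<^sub>R u)) (at (s - s))"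
    using smooth_on_has_dir_deriv[OF assms] by simp
  moreover have "((\<lambda>t. t - s) has_vector_derivative 1) (at s)"
    by (auto intro!: derivative_eq_intros)
  ultimately have "((\<lambda>r. f (x + s *\<^sub>R u + r *\<^sub>R u)) \<circ> (\<lambda>t. t - s) has_vector_derivative
      1 *\<^sub>R dir_deriv f u (x + s *\<^sub>R u)) (at s)"
    by (intro vector_diff_chain_at) auto
  then show ?thesis by (simp add: o_def algebra_simps)
qed

lemma dir_deriv_eqI:
  "((\<lambda>t. f (x + t *\<^sub>R u)) has_vector_derivative D) (at 0) \<Longrightarrow> dir_deriv f u x = D"
  unfolding dir_deriv_def by (rule vector_derivative_at)

lemma onorm_scaleR_left_le:
  assumes "norm w \<le> e"
  shows "onorm (\<lambda>h::real. h *\<^sub>R w) \<le> e"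
proof (rule onorm_le)
  show "norm (h *\<^sub>R w) \<le> e * norm h" for h
    using mult_right_mono[OF assms, of "\<bar>h\<bar>"] by (simp add: mult.commute)
qed

text \<open>
  The mean value inequality for \<open>f - t D\<close>, along a segment in a ball on which the derivative stays
  \<open>e\<close>-close to \<open>D\<close>.
\<close>

lemma increment_bound:
  assumes f: "smooth_on V U f" and V: "subspace V" and v: "v \<in> V"
    and B: "\<And>z. z \<in> V \<Longrightarrow> dist z x < d \<Longrightarrow> z \<in> U \<and> norm (dir_deriv f v z - D) \<le> e"
    and y: "y \<in> V" "dist y x < d" "dist (y + t *\<^sub>R v) x < d"
  shows "norm (f (y + t *\<^sub>R v) - f y - t *\<^sub>R D) \<le> e * \<bar>t\<bar>"
proof -
  define S where "S = closed_segment 0 t"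
  define g where "g s = f (y + s *\<^sub>R v) - s *\<^sub>R D" for s
  have inb: "y + s *\<^sub>R v \<in> V \<and> dist (y + s *\<^sub>R v) x < d" if s: "s \<in> S" for s
  proof -
    obtain r where r: "0 \<le> r" "r \<le> 1" "s = r * t"
      using s by (auto simp: S_def in_segment)
    have "(1 - r) *\<^sub>R y + r *\<^sub>R (y + t *\<^sub>R v) \<in> ball x d"
      by (rule convexD[OF convex_ball]) (use y r in \<open>auto simp: dist_commute\<close>)
    moreover have "(1 - r) *\<^sub>R y + r *\<^sub>R (y + t *\<^sub>R v) = y + s *\<^sub>R v"
      using r by (simp add: algebra_simps)
    ultimately show ?thesis
      using V v y by (auto simp: dist_commute subspace_add subspace_scale)
  qed
  have der: "(g has_derivative (\<lambda>h. h *\<^sub>R (dir_deriv f v (y + s *\<^sub>R v) - D))) (at s within S)" if "s \<in> S" for s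
  proof -
    have "(g has_vector_derivative (dir_deriv f v (y + s *\<^sub>R v) - 1 *\<^sub>R D)) (at s)"
      unfolding g_def
      by (intro has_vector_derivative_diff smooth_on_has_dir_deriv_along[OF f _ v] has_vector_derivative_scaleR
            derivative_eq_intros refl) (use B inb that in auto)
    then show ?thesis
      by (simp add: has_vector_derivative_def has_derivative_at_withinI)
  qed
  have "norm (g t - g 0) \<le> e * norm (t - 0)"
  proof (rule differentiable_bound[OF _ der])
    show "convex S" by (simp add: S_def)
    show "onorm (\<lambda>h. h *\<^sub>R (dir_deriv f v (y + s *\<^sub>R v) - D)) \<le> e" if "s \<in> S" for s
      by (rule onorm_scaleR_left_le) (use B inb[OF that] in blast)
  qed (auto simp: S_def)
  then show ?thesis by (simp add: g_def algebra_simps)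
qed

text \<open>
  Continuity of the directional derivatives makes them additive in the direction: the increment along
  \<open>t (u + v)\<close> is an increment along \<open>t u\<close> followed by one along \<open>t v\<close> from a nearby point.
\<close>

lemma dir_deriv_add_dir:
  assumes f: "smooth_on V U f" and U: "openin (top_of_set V) U" and V: "subspace V"
    and x: "x \<in> U" and u: "u \<in> V" and v: "v \<in> V"
  shows "dir_deriv f (u + v) x = dir_deriv f u x + dir_deriv f v x"
proof -
  have xV: "x \<in> V" using U x openin_imp_subset by fastforce
  let ?D = "dir_deriv f v x"
  have "((\<lambda>t. f (x + t *\<^sub>R u + t *\<^sub>R v) - f (x + t *\<^sub>R u)) has_vector_derivative ?D) (at 0)"
    unfolding has_vector_derivative_def has_derivative_at_alt
  proof (intro conjI allI impI)
    show "bounded_linear (\<lambda>h. h *\<^sub>R ?D)" by (rule bounded_linear_scaleR_left)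
    fix e :: real assume e: "0 < e"
    obtain d where d: "d > 0" "\<And>z. z \<in> V \<Longrightarrow> dist z x < d \<Longrightarrow> z \<in> U \<and> norm (dir_deriv f v z - ?D) < e"
      using openin_subspace_nhd[OF U x smooth_on_continuous[OF smooth_on_dir_deriv[OF f v]] e] by blast
    define c where "c = d / (norm u + norm v + 1)"
    have den: "norm u + norm v + 1 > 0" by (smt (verit) norm_ge_zero)
    have c: "c > 0" unfolding c_def using d(1) den by simp
    show "\<exists>c>0. \<forall>t. norm (t - 0) < c \<longrightarrow>
       norm (f (x + t *\<^sub>R u + t *\<^sub>R v) - f (x + t *\<^sub>R u) - (f (x + 0 *\<^sub>R u + 0 *\<^sub>R v) - f (x + 0 *\<^sub>R u)) -
         (t - 0) *\<^sub>R ?D) \<le> e * norm (t - 0)"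
    proof (intro exI conjI allI impI)
      fix t :: real assume "norm (t - 0) < c"
      then have "\<bar>t\<bar> * (norm u + norm v + 1) < d"
        using den by (simp add: c_def pos_less_divide_eq)
      then have b: "\<bar>t\<bar> * norm u + \<bar>t\<bar> * norm v < d" by (simp add: algebra_simps)
      have b1: "norm (t *\<^sub>R u) < d" using b
        by (smt (verit, best) mult_nonneg_nonneg norm_ge_zero norm_scaleR)
      have b2: "norm (t *\<^sub>R u + t *\<^sub>R v) < d" using b norm_triangle_ineq[of "t *\<^sub>R u" "t *\<^sub>R v"] by simp
      have "norm (f (x + t *\<^sub>R u + t *\<^sub>R v) - f (x + t *\<^sub>R u) - t *\<^sub>R ?D) \<le> e * \<bar>t\<bar>"
      proof (rule increment_bound[OF f V v, where d = d and x = x])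
        show "dist (x + t *\<^sub>R u) x < d" using b1 by (simp add: dist_norm)
        show "dist (x + t *\<^sub>R u + t *\<^sub>R v) x < d" using b2 by (simp add: dist_norm add.assoc)
      qed (use d V xV u less_imp_le in \<open>auto simp: subspace_add subspace_scale\<close>)
      then show "norm (f (x + t *\<^sub>R u + t *\<^sub>R v) - f (x + t *\<^sub>R u) - (f (x + 0 *\<^sub>R u + 0 *\<^sub>R v) - f (x + 0 *\<^sub>R u)) -
         (t - 0) *\<^sub>R ?D) \<le> e * norm (t - 0)" by simp
    qed (fact c)
  qed
  from has_vector_derivative_add[OF smooth_on_has_dir_deriv[OF f x u] this]
  have "((\<lambda>t. f (x + t *\<^sub>R (u + v))) has_vector_derivative dir_deriv f u x + ?D) (at 0)"
    by (simp add: algebra_simps)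
  then show ?thesis by (rule dir_deriv_eqI)
qed

lemma dir_deriv_scale_dir:
  assumes f: "smooth_on V U f" and x: "x \<in> U" and u: "u \<in> V"
  shows "dir_deriv f (c *\<^sub>R u) x = c *\<^sub>R dir_deriv f u x"
proof (rule dir_deriv_eqI)
  have "((\<lambda>t. f (x + t *\<^sub>R u)) has_vector_derivative dir_deriv f u x) (at (c * 0))"
    using smooth_on_has_dir_deriv[OF assms] by simp
  moreover have "((\<lambda>t. c * t) has_vector_derivative c) (at 0)"
    by (auto intro!: derivative_eq_intros simp: has_real_derivative_iff_has_vector_derivative[symmetric])
  ultimately have "((\<lambda>t. f (x + t *\<^sub>R u)) \<circ> (\<lambda>t. c * t) has_vector_derivative c *\<^sub>R dir_deriv f u x) (at 0)"
    by (intro vector_diff_chain_at) auto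
  then show "((\<lambda>t. f (x + t *\<^sub>R c *\<^sub>R u)) has_vector_derivative c *\<^sub>R dir_deriv f u x) (at 0)"
    by (simp add: o_def mult.commute)
qed

text \<open>
  The second difference of \<open>f\<close> is an increment in direction \<open>u\<close> of an increment in direction \<open>v\<close>, and two
  applications of the mean value inequality compare it with \<open>t\<^sup>2 \<partial>\<^sub>v \<partial>\<^sub>u f\<close>.
\<close>

lemma second_difference_bound:
  assumes f: "smooth_on V U f" and U: "openin (top_of_set V) U" and V: "subspace V"
    and x: "x \<in> U" and u: "u \<in> V" and v: "v \<in> V" and e: "0 < e"
  obtains c where "c > 0" "\<And>t. \<bar>t\<bar> < c \<Longrightarrow>
    norm (f (x + t *\<^sub>R u + t *\<^sub>R v) - f (x + t *\<^sub>R u) - f (x + t *\<^sub>R v) + f x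
       - (t * t) *\<^sub>R dir_deriv (dir_deriv f u) v x) \<le> e * (t * t)"
proof -
  have xV: "x \<in> V" using U x openin_imp_subset by fastforce
  let ?fu = "dir_deriv f u" and ?D = "dir_deriv (dir_deriv f u) v x"
  have fu: "smooth_on V U ?fu" by (rule smooth_on_dir_deriv[OF f u])
  have fv: "continuous_on U (dir_deriv ?fu v)"
    by (rule smooth_on_continuous[OF smooth_on_dir_deriv[OF fu v]])
  obtain d where d: "d > 0" "\<And>z. z \<in> V \<Longrightarrow> dist z x < d \<Longrightarrow> z \<in> U \<and> norm (dir_deriv ?fu v z - ?D) < e"
    using openin_subspace_nhd[OF U x fv e] by blast
  define c where "c = d / (norm u + norm v + 1)"
  have den: "norm u + norm v + 1 > 0" by (smt (verit) norm_ge_zero)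
  have c: "c > 0" unfolding c_def using d(1) den by simp
  show ?thesis
  proof (rule that[OF c])
    fix t :: real assume t: "\<bar>t\<bar> < c"
    then have "\<bar>t\<bar> * (norm u + norm v + 1) < d"
      using den by (simp add: c_def pos_less_divide_eq)
    then have b: "\<bar>t\<bar> * norm u + \<bar>t\<bar> * norm v < d" by (simp add: algebra_simps)
    have near: "x + s *\<^sub>R u \<in> V \<and> dist (x + s *\<^sub>R u) x < d \<and>
        x + s *\<^sub>R u + t *\<^sub>R v \<in> V \<and> dist (x + s *\<^sub>R u + t *\<^sub>R v) x < d" if "\<bar>s\<bar> \<le> \<bar>t\<bar>" for s
    proof -
      have "\<bar>s\<bar> * norm u \<le> \<bar>t\<bar> * norm u" using that by (simp add: mult_right_mono)
      then have b1: "\<bar>s\<bar> * norm u + \<bar>t\<bar> * norm v < d" using b by linarith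
      have "norm (s *\<^sub>R u) < d" using b1
        by (smt (verit, best) mult_nonneg_nonneg norm_ge_zero norm_scaleR)
      moreover have "norm (s *\<^sub>R u + t *\<^sub>R v) < d" using b1 norm_triangle_ineq[of "s *\<^sub>R u" "t *\<^sub>R v"] by simp
      ultimately show ?thesis using xV u v V
        by (auto simp: dist_norm add.assoc subspace_add subspace_scale)
    qed
    \<comment> \<open>For each \<open>s\<close> between \<open>0\<close> and \<open>t\<close>, the function \<open>g\<close> below has derivative at most \<open>e \<bar>t\<bar>\<close>.\<close>
    define g where "g s = f (x + s *\<^sub>R u + t *\<^sub>R v) - f (x + s *\<^sub>R u) - s *\<^sub>R t *\<^sub>R ?D" for s
    have g_eq: "g = (\<lambda>s. f (x + t *\<^sub>R v + s *\<^sub>R u) - f (x + s *\<^sub>R u) - s *\<^sub>R t *\<^sub>R ?D)"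
      unfolding g_def by (intro ext) (simp add: add.assoc add.commute[of "t *\<^sub>R v"])
    define S where "S = closed_segment 0 t"
    have S: "\<bar>s\<bar> \<le> \<bar>t\<bar>" if "s \<in> S" for s
      using that by (auto simp: S_def closed_segment_eq_real_ivl split: if_splits)
    define g' where "g' s = ?fu (x + s *\<^sub>R u + t *\<^sub>R v) - ?fu (x + s *\<^sub>R u) - t *\<^sub>R ?D" for s
    have der: "(g has_derivative (\<lambda>h. h *\<^sub>R g' s)) (at s within S)" if "s \<in> S" for s
    proof -
      have inU: "x + s *\<^sub>R u \<in> U" "x + t *\<^sub>R v + s *\<^sub>R u \<in> U"
        using near[OF S[OF that]] d(2) by (metis, metis add.commute add.left_commute)
      have "(g has_vector_derivative ?fu (x + t *\<^sub>R v + s *\<^sub>R u) - ?fu (x + s *\<^sub>R u) - 1 *\<^sub>R t *\<^sub>R ?D) (at s)"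
        unfolding g_eq
        by (intro has_vector_derivative_diff smooth_on_has_dir_deriv_along[OF f _ u] inU
            has_vector_derivative_scaleR derivative_eq_intros refl) auto
      then show ?thesis
        by (simp add: has_vector_derivative_def has_derivative_at_withinI g'_def algebra_simps)
    qed
    have g': "norm (g' s) \<le> e * \<bar>t\<bar>" if "s \<in> S" for s
      unfolding g'_def
      by (rule increment_bound[OF fu V v, where d = d and x = x])
         (use near[OF S[OF that]] d less_imp_le in auto)
    have "norm (g t - g 0) \<le> (e * \<bar>t\<bar>) * norm (t - 0)"
    proof (rule differentiable_bound[OF _ der])
      show "convex S" by (simp add: S_def)
      show "onorm (\<lambda>h. h *\<^sub>R g' s) \<le> e * \<bar>t\<bar>" if "s \<in> S" for s
        by (rule onorm_scaleR_left_le[OF g'[OF that]])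
    qed (auto simp: S_def)
    moreover have "(e * \<bar>t\<bar>) * norm (t - 0) = e * (t * t)" by (simp add: abs_mult_self_eq)
    moreover have "g t - g 0 = f (x + t *\<^sub>R u + t *\<^sub>R v) - f (x + t *\<^sub>R u) - f (x + t *\<^sub>R v) + f x
       - (t * t) *\<^sub>R ?D" by (simp add: g_def algebra_simps)
    ultimately show "norm (f (x + t *\<^sub>R u + t *\<^sub>R v) - f (x + t *\<^sub>R u) - f (x + t *\<^sub>R v) + f x
       - (t * t) *\<^sub>R ?D) \<le> e * (t * t)" by simp
  qed
qed

text \<open>
  Second derivatives commute because the second difference is symmetric in \<open>u\<close> and \<open>v\<close> and, divided by
  \<open>t\<^sup>2\<close>, is close to both of them.
\<close>

lemma dir_deriv_commute:
  assumes f: "smooth_on V U f" and U: "openin (top_of_set V) U" and V: "subspace V"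
    and x: "x \<in> U" and u: "u \<in> V" and v: "v \<in> V"
  shows "dir_deriv (dir_deriv f u) v x = dir_deriv (dir_deriv f v) u x" (is "?A = ?B")
proof -
  have "norm (?A - ?B) \<le> 2 * e" if e: "e > 0" for e
  proof -
    obtain c where c: "c > 0" "\<And>t. \<bar>t\<bar> < c \<Longrightarrow>
      norm (f (x + t *\<^sub>R u + t *\<^sub>R v) - f (x + t *\<^sub>R u) - f (x + t *\<^sub>R v) + f x - (t * t) *\<^sub>R ?A) \<le> e * (t * t)"
      using second_difference_bound[OF f U V x u v e] by metis
    obtain c' where c': "c' > 0" "\<And>t. \<bar>t\<bar> < c' \<Longrightarrow>
      norm (f (x + t *\<^sub>R v + t *\<^sub>R u) - f (x + t *\<^sub>R v) - f (x + t *\<^sub>R u) + f x - (t * t) *\<^sub>R ?B) \<le> e * (t * t)"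
      using second_difference_bound[OF f U V x v u e] by metis
    define t where "t = min c c' / 2"
    have t: "t > 0" "\<bar>t\<bar> < c" "\<bar>t\<bar> < c'" using c(1) c'(1) by (auto simp: t_def)
    define W where "W = f (x + t *\<^sub>R u + t *\<^sub>R v) - f (x + t *\<^sub>R u) - f (x + t *\<^sub>R v) + f x"
    have 1: "norm (W - (t * t) *\<^sub>R ?A) \<le> e * (t * t)" using c(2)[OF t(2)] by (simp add: W_def)
    have "f (x + t *\<^sub>R v + t *\<^sub>R u) - f (x + t *\<^sub>R v) - f (x + t *\<^sub>R u) + f x = W"
      by (simp add: W_def algebra_simps)
    then have 2: "norm (W - (t * t) *\<^sub>R ?B) \<le> e * (t * t)" using c'(2)[OF t(3)] by simp
    have eq: "(t * t) *\<^sub>R (?A - ?B) = (W - (t * t) *\<^sub>R ?B) - (W - (t * t) *\<^sub>R ?A)"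
      by (simp add: algebra_simps)
    have le: "norm ((t * t) *\<^sub>R (?A - ?B)) \<le> e * (t * t) + e * (t * t)"
      unfolding eq using 1 2 norm_triangle_ineq4[of "W - (t * t) *\<^sub>R ?B" "W - (t * t) *\<^sub>R ?A"] by linarith
    have "norm ((t * t) *\<^sub>R (?A - ?B)) = (t * t) * norm (?A - ?B)"
      by (simp only: norm_scaleR abs_mult abs_mult_self_eq)
    moreover have "e * (t * t) + e * (t * t) = (t * t) * (2 * e)" by (simp add: algebra_simps)
    ultimately have "(t * t) * norm (?A - ?B) \<le> (t * t) * (2 * e)" using le by (simp only:)
    then show ?thesis by (rule mult_left_le_imp_le) (use t(1) in simp)
  qed
  then have "norm (?A - ?B) \<le> 0 + d" if "d > 0" for d
    using half_gt_zero[OF that] by fastforce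
  then have "norm (?A - ?B) \<le> 0" by (rule field_le_epsilon)
  then show ?thesis by simp
qed

lemma has_dir_deriv_linear:
  assumes T: "bounded_linear T" and f: "smooth_on V U f" and x: "x \<in> U" and u: "u \<in> V"
  shows "dir_deriv (\<lambda>y. T (f y)) u x = T (dir_deriv f u x)"
  by (rule dir_deriv_eqI)
     (rule bounded_linear.has_vector_derivative[OF T smooth_on_has_dir_deriv[OF f x u]])

lemma iter_dir_deriv_linear:
  assumes T: "bounded_linear T" and f: "smooth_on V U f" and U: "openin (top_of_set V) U" and V: "subspace V"
    and us: "set us \<subseteq> V" and x: "x \<in> U"
  shows "iter_dir_deriv (\<lambda>y. T (f y)) us x = T (iter_dir_deriv f us x)"
  using us x
proof (induction us arbitrary: x)
  case (Cons u us)
  have "iter_dir_deriv (\<lambda>y. T (f y)) (u # us) x = dir_deriv (\<lambda>y. T (iter_dir_deriv f us y)) u x"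
    using Cons by (simp, intro dir_deriv_cong_on[OF U V]) auto
  also have "\<dots> = T (dir_deriv (iter_dir_deriv f us) u x)"
  proof (rule dir_deriv_eqI, rule bounded_linear.has_vector_derivative[OF T])
    show "((\<lambda>t. iter_dir_deriv f us (x + t *\<^sub>R u)) has_vector_derivative
            dir_deriv (iter_dir_deriv f us) u x) (at 0)"
      using f Cons.prems unfolding smooth_on_def dir_deriv_def
      by (simp add: vector_derivative_works)
  qed
  finally show ?case by simp
qed simp

lemma smooth_on_linear:
  assumes T: "bounded_linear T" and f: "smooth_on V U f" and U: "openin (top_of_set V) U" and V: "subspace V"
  shows "smooth_on V U (\<lambda>y. T (f y))"
  unfolding smooth_on_def
proof (intro allI impI conjI ballI)
  fix us assume us: "set us \<subseteq> V"
  note eq = iter_dir_deriv_linear[OF T f U V us]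
  have "continuous_on U (iter_dir_deriv f us)" using f us by (simp add: smooth_on_def)
  then have "continuous_on U (\<lambda>x. T (iter_dir_deriv f us x))"
    by (rule bounded_linear.continuous_on[OF T])
  then show "continuous_on U (iter_dir_deriv (\<lambda>y. T (f y)) us)"
    by (simp add: eq cong: continuous_on_cong)
  fix x u assume x: "x \<in> U" and u: "u \<in> V"
  show "(\<lambda>t. iter_dir_deriv (\<lambda>y. T (f y)) us (x + t *\<^sub>R u)) differentiable (at 0)"
  proof (rule differentiable_cong_line[OF U V x u eq[symmetric]])
    have "(\<lambda>t. iter_dir_deriv f us (x + t *\<^sub>R u)) differentiable (at 0)"
      using f us x u by (simp add: smooth_on_def)
    then show "(\<lambda>t. T (iter_dir_deriv f us (x + t *\<^sub>R u))) differentiable (at 0)"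
      unfolding differentiable_def using bounded_linear.has_derivative[OF T] by blast
  qed
qed

lemma iter_dir_deriv_add:
  assumes f: "smooth_on V U f" and g: "smooth_on V U g"
    and U: "openin (top_of_set V) U" and V: "subspace V"
    and us: "set us \<subseteq> V" and x: "x \<in> U"
  shows "iter_dir_deriv (\<lambda>y. f y + g y) us x = iter_dir_deriv f us x + iter_dir_deriv g us x"
  using us x
proof (induction us arbitrary: x)
  case (Cons u us)
  have "iter_dir_deriv (\<lambda>y. f y + g y) (u # us) x =
      dir_deriv (\<lambda>y. iter_dir_deriv f us y + iter_dir_deriv g us y) u x"
    using Cons by (simp, intro dir_deriv_cong_on[OF U V]) auto
  also have "\<dots> = dir_deriv (iter_dir_deriv f us) u x + dir_deriv (iter_dir_deriv g us) u x"
    by (rule dir_deriv_eqI, rule has_vector_derivative_add)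
       (use f g Cons.prems in \<open>simp_all add: smooth_on_def dir_deriv_def vector_derivative_works[symmetric]\<close>)
  finally show ?case by simp
qed simp

lemma smooth_on_add:
  assumes f: "smooth_on V U f" and g: "smooth_on V U g"
    and U: "openin (top_of_set V) U" and V: "subspace V"
  shows "smooth_on V U (\<lambda>y. f y + g y)"
  unfolding smooth_on_def
proof (intro allI impI conjI ballI)
  fix us assume us: "set us \<subseteq> V"
  note eq = iter_dir_deriv_add[OF f g U V us]
  have "continuous_on U (\<lambda>x. iter_dir_deriv f us x + iter_dir_deriv g us x)"
    using f g us by (intro continuous_on_add) (simp_all add: smooth_on_def)
  then show "continuous_on U (iter_dir_deriv (\<lambda>y. f y + g y) us)"
    by (simp add: eq cong: continuous_on_cong)
  fix x u assume x: "x \<in> U" and u: "u \<in> V"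
  show "(\<lambda>t. iter_dir_deriv (\<lambda>y. f y + g y) us (x + t *\<^sub>R u)) differentiable (at 0)"
    by (rule differentiable_cong_line[OF U V x u eq[symmetric]])
       (use f g us x u in \<open>simp_all add: smooth_on_def differentiable_add\<close>)
qed

lemma iter_dir_deriv_zero: "iter_dir_deriv (\<lambda>_. 0) us = (\<lambda>_. 0)"
proof (induction us)
  case (Cons u us)
  then show ?case by (auto simp: dir_deriv_def)
qed simp

lemma smooth_on_zero: "smooth_on V U (\<lambda>_. 0)"
  by (simp add: smooth_on_def iter_dir_deriv_zero)

text \<open>
  Projections to a factor and inclusions of a slice are affine in product charts; for affine maps the
  chain rule holds by definition of the directional derivative.
\<close>

lemma dir_deriv_affine:
  assumes "linear J"
  shows "dir_deriv (\<lambda>y. f (c + J y)) u = (\<lambda>y. dir_deriv f (J u) (c + J y))"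
proof
  fix y
  have "c + J (y + t *\<^sub>R u) = c + J y + t *\<^sub>R J u" for t
    by (simp only: linear_add[OF assms] linear_scale[OF assms] add.assoc)
  then show "dir_deriv (\<lambda>y. f (c + J y)) u y = dir_deriv f (J u) (c + J y)"
    by (simp only: dir_deriv_def)
qed

lemma iter_dir_deriv_affine:
  assumes "linear J"
  shows "iter_dir_deriv (\<lambda>y. f (c + J y)) us = (\<lambda>y. iter_dir_deriv f (map J us) (c + J y))"
proof (induction us)
  case (Cons u us)
  show ?case
    by (simp only: iter_dir_deriv.simps list.map Cons.IH
        dir_deriv_affine[OF assms, of "iter_dir_deriv f (map J us)" c u])
qed simp

lemma smooth_on_affine:
  fixes J :: "'a::euclidean_space \<Rightarrow> 'b::real_normed_vector"
  assumes J: "linear J" "\<And>u. u \<in> V' \<Longrightarrow> J u \<in> V" and f: "smooth_on V U f"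
    and U: "\<And>y. y \<in> U' \<Longrightarrow> c + J y \<in> U"
  shows "smooth_on V' U' (\<lambda>y. f (c + J y))"
  unfolding smooth_on_def iter_dir_deriv_affine[OF J(1), of f c]
proof (intro allI impI conjI ballI)
  fix us assume us: "set us \<subseteq> V'"
  then have us': "set (map J us) \<subseteq> V" using J(2) by auto
  have "continuous_on U (iter_dir_deriv f (map J us))" by (rule smooth_on_iter_continuous[OF f us'])
  moreover have "continuous_on U' (\<lambda>y. c + J y)"
    using J(1) by (intro continuous_intros linear_continuous_on) (simp add: linear_conv_bounded_linear)
  ultimately show "continuous_on U' (\<lambda>y. iter_dir_deriv f (map J us) (c + J y))"
    by (rule continuous_on_compose2) (use U in blast)
  fix x u assume "x \<in> U'" "u \<in> V'"
  then have "(\<lambda>t. iter_dir_deriv f (map J us) (c + J x + t *\<^sub>R J u)) differentiable (at 0)"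
    by (intro smooth_on_iter_differentiable[OF f us'] U J(2))
  then show "(\<lambda>t. iter_dir_deriv f (map J us) (c + J (x + t *\<^sub>R u))) differentiable (at 0)"
    by (simp add: linear_add[OF J(1)] linear_scale[OF J(1)] add.assoc)
qed

section \<open>Linear maps and bilinear forms on a subspace\<close>

text \<open>
  Metrics are bilinear only on the model subspace. A projection onto that subspace turns functionals
  on it into functionals on the ambient space, where bases and bounded linear maps are at hand.
\<close>

lemma subspace_projection:
  fixes V :: "'a::euclidean_space set"
  assumes "subspace V"
  obtains \<pi> where "linear \<pi>" "\<And>x. \<pi> x \<in> V" "\<And>v. v \<in> V \<Longrightarrow> \<pi> v = v"
proof -
  obtain g where g: "g ` UNIV \<subseteq> V" "linear g" "\<And>v. v \<in> V \<Longrightarrow> g (id v) = v"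
    using linear_exists_left_inverse_on[OF linear_id assms] by auto
  show ?thesis by (rule that[OF g(2)]) (use g in auto)
qed

text \<open>
  A projection onto \<open>W\<close> fixes \<open>f\<close>, hence also its derivatives.
\<close>

lemma dir_deriv_in_subspace:
  fixes f :: "'a::euclidean_space \<Rightarrow> 'b::euclidean_space"
  assumes f: "smooth_on V U f" and U: "openin (top_of_set V) U" and V: "subspace V"
    and x: "x \<in> U" and u: "u \<in> V" and W: "subspace W" and fW: "\<And>y. y \<in> U \<Longrightarrow> f y \<in> W"
  shows "dir_deriv f u x \<in> W"
proof -
  obtain \<pi> where \<pi>: "linear \<pi>" "\<And>y. \<pi> y \<in> W" "\<And>w. w \<in> W \<Longrightarrow> \<pi> w = w"
    using subspace_projection[OF W] by metis
  have "dir_deriv f u x = dir_deriv (\<lambda>y. \<pi> (f y)) u x"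
    by (rule dir_deriv_cong_on[OF U V x u]) (simp add: \<pi>(3) fW)
  also have "\<dots> = \<pi> (dir_deriv f u x)"
    by (rule has_dir_deriv_linear[OF _ f x u]) (use \<pi>(1) in \<open>simp add: linear_conv_bounded_linear\<close>)
  finally show ?thesis using \<pi>(2) by metis
qed

definition linear_on_sub :: "'a::real_vector set \<Rightarrow> ('a \<Rightarrow> 'b::real_vector) \<Rightarrow> bool" where
  "linear_on_sub V T \<longleftrightarrow> (\<forall>u\<in>V. \<forall>v\<in>V. T (u + v) = T u + T v) \<and> (\<forall>c. \<forall>u\<in>V. T (c *\<^sub>R u) = c *\<^sub>R T u)"

lemma linear_on_sub_extends:
  fixes V :: "'a::euclidean_space set" and T :: "'a \<Rightarrow> 'b::real_normed_vector"
  assumes V: "subspace V" and T: "linear_on_sub V T"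
  obtains T' where "bounded_linear T'" "\<And>v. v \<in> V \<Longrightarrow> T' v = T v"
proof -
  obtain \<pi> where \<pi>: "linear \<pi>" "\<And>x. \<pi> x \<in> V" "\<And>v. v \<in> V \<Longrightarrow> \<pi> v = v"
    using subspace_projection[OF V] by metis
  have "linear (\<lambda>v. T (\<pi> v))"
    using T \<pi> by (intro linearI) (auto simp: linear_on_sub_def linear_add linear_scale)
  then show ?thesis
    using \<pi> by (intro that[of "\<lambda>v. T (\<pi> v)"]) (auto simp: linear_conv_bounded_linear)
qed

lemma linear_on_sub_sum_expand:
  fixes V :: "'a::euclidean_space set" and T :: "'a \<Rightarrow> 'b::real_normed_vector"
  assumes \<pi>: "linear \<pi>" "\<And>x. \<pi> x \<in> V" and T: "linear_on_sub V T" and w: "\<pi> w = w"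
  shows "T w = (\<Sum>b\<in>Basis. (w \<bullet> b) *\<^sub>R T (\<pi> b))"
proof -
  have "linear (\<lambda>v. T (\<pi> v))"
    using T \<pi> by (intro linearI) (auto simp: linear_on_sub_def linear_add linear_scale)
  note this = linear_sum[OF this, of "\<lambda>b. (w \<bullet> b) *\<^sub>R b" Basis] linear_scale[OF this]
  then have "T (\<pi> (\<Sum>b\<in>Basis. (w \<bullet> b) *\<^sub>R b)) = (\<Sum>b\<in>Basis. (w \<bullet> b) *\<^sub>R T (\<pi> b))"
    by simp
  then show ?thesis by (simp add: euclidean_representation w)
qed

lemma linear_on_sub_has_vector_derivative:
  fixes V :: "'a::euclidean_space set" and T :: "'a \<Rightarrow> 'b::real_normed_vector"
  assumes V: "subspace V" and T: "linear_on_sub V T"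
    and c: "(c has_vector_derivative D) (at 0)" and D: "D \<in> V" and cV: "eventually (\<lambda>t. c t \<in> V) (nhds (0::real))"
  shows "((\<lambda>t. T (c t)) has_vector_derivative T D) (at 0)"
proof -
  obtain T' where T': "bounded_linear T'" "\<And>v. v \<in> V \<Longrightarrow> T' v = T v"
    using linear_on_sub_extends[OF V T] by metis
  have ev: "eventually (\<lambda>t. T' (c t) = T (c t)) (nhds 0)"
    using cV by eventually_elim (simp add: T')
  have "((\<lambda>t. T' (c t)) has_vector_derivative T' D) (at 0)"
    by (rule bounded_linear.has_vector_derivative[OF T'(1) c])
  then have "((\<lambda>t. T (c t)) has_vector_derivative T' D) (at 0)"
    by (rule has_vector_derivative_eventually_eq[OF _ ev])
  then show ?thesis by (simp add: T'(2)[OF D])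
qed

text \<open>
  A nondegenerate form on a subspace represents every functional: in an orthonormal basis the form
  becomes an injective endomorphism of the subspace, which is onto for reasons of dimension.
\<close>

lemma nondegenerate_represents:
  fixes V :: "'a::euclidean_space set" and B :: "'a \<Rightarrow> 'a \<Rightarrow> real"
  assumes V: "subspace V"
    and B1: "\<And>v. v \<in> V \<Longrightarrow> linear_on_sub V (\<lambda>u. B u v)" and B2: "\<And>u. u \<in> V \<Longrightarrow> linear_on_sub V (B u)"
    and nondeg: "\<And>u. u \<in> V \<Longrightarrow> (\<And>v. v \<in> V \<Longrightarrow> B u v = 0) \<Longrightarrow> u = 0"
    and T: "linear_on_sub V T"
  shows "\<exists>!w. w \<in> V \<and> (\<forall>z\<in>V. B w z = T z)"
proof -
  obtain D where D: "D \<subseteq> V" "pairwise orthogonal D" "\<And>x. x \<in> D \<Longrightarrow> norm x = 1"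
      "independent D" "card D = dim V" "span D = V"
    using orthonormal_basis_subspace[OF V] by metis
  have fin: "finite D" by (rule independent_imp_finite[OF D(4)])
  obtain \<pi> where \<pi>: "linear \<pi>" "\<And>x. \<pi> x \<in> V" "\<And>v. v \<in> V \<Longrightarrow> \<pi> v = v"
    using subspace_projection[OF V] by metis
  have D_inner: "(\<Sum>d\<in>D. c d *\<^sub>R d) \<bullet> b = c b" if "b \<in> D" for c b
  proof -
    have "(\<Sum>d\<in>D. c d *\<^sub>R d) \<bullet> b = (\<Sum>d\<in>D. if d = b then c b else 0)"
      unfolding inner_sum_left
      by (rule sum.cong) (use D(2,3) that in \<open>auto simp: pairwise_def orthogonal_def dot_square_norm\<close>)
    then show ?thesis using fin that by simp
  qed
  have ext: "f v = g v" if f: "linear_on_sub V f" and g: "linear_on_sub V g" and "\<And>b. b \<in> D \<Longrightarrow> f b = g b" "v \<in> V"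
    for f g :: "'a \<Rightarrow> real" and v
  proof -
    have "linear (\<lambda>v. f (\<pi> v))" "linear (\<lambda>v. g (\<pi> v))"
      using f g \<pi> by (auto intro!: linearI simp: linear_on_sub_def linear_add linear_scale)
    then have "f (\<pi> v) = g (\<pi> v)"
      by (rule linear_eq_on_span[where B = D]) (use that \<pi> D in auto)
    then show ?thesis using \<pi> that by simp
  qed
  define \<psi> where "\<psi> w = (\<Sum>b\<in>D. B (\<pi> w) b *\<^sub>R b)" for w
  have lin: "linear \<psi>"
    unfolding \<psi>_def using B1 \<pi> D(1)
    by (intro linearI)
       (auto simp: linear_add linear_scale linear_on_sub_def subset_iff sum.distrib[symmetric] scaleR_sum_right
         scaleR_add_left intro!: sum.cong)
  have \<psi>_in: "\<psi> w \<in> V" for w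
    unfolding \<psi>_def using D(1) V by (auto intro!: subspace_sum subspace_scale)
  have \<psi>b: "\<psi> w \<bullet> b = B w b" if "w \<in> V" "b \<in> D" for w b
    using that \<pi> by (simp add: \<psi>_def D_inner)
  have inner_lin: "linear_on_sub V (\<lambda>v. x \<bullet> v)" for x
    by (simp add: linear_on_sub_def inner_add_right)
  have \<psi>v: "\<psi> w \<bullet> v = B w v" if "w \<in> V" "v \<in> V" for w v
    using ext[OF inner_lin B2[OF that(1)] \<psi>b[OF that(1)] that(2)] by simp
  have inj: "inj_on \<psi> V"
  proof (rule inj_onI)
    fix x y assume xy: "x \<in> V" "y \<in> V" "\<psi> x = \<psi> y"
    then have d: "x - y \<in> V" using V by (simp add: subspace_diff)
    have "\<psi> (x - y) = 0" using lin xy by (simp add: linear_diff)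
    then have "x - y = 0" using nondeg[OF d] \<psi>v[OF d] by (metis inner_zero_left)
    then show "x = y" by simp
  qed
  have "\<psi> ` V = V"
  proof (rule subspace_dim_equal)
    show "subspace (\<psi> ` V)" using lin V by (rule linear_subspace_image)
    have "dim (\<psi> ` V) = dim V"
      by (rule dim_image_eq[OF lin]) (simp only: span_eq_iff[THEN iffD2, OF V] inj)
    then show "dim V \<le> dim (\<psi> ` V)" by simp
  qed (use \<psi>_in V in auto)
  moreover have "(\<Sum>b\<in>D. T b *\<^sub>R b) \<in> V" using D(1) V by (auto intro!: subspace_sum subspace_scale)
  ultimately obtain w where w: "w \<in> V" "\<psi> w = (\<Sum>b\<in>D. T b *\<^sub>R b)" by (metis imageE)
  have "B w z = T z" if "z \<in> V" for z
    by (rule ext[OF B2[OF w(1)] T _ that]) (use \<psi>b[OF w(1)] w(2) D_inner in metis)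
  moreover have "w' = w" if "w' \<in> V" "\<forall>z\<in>V. B w' z = T z" for w'
  proof -
    have "\<psi> w' = \<psi> w"
      unfolding \<psi>_def using that w D(1) \<pi> calculation by (intro sum.cong) auto
    then show ?thesis using inj that w by (simp add: inj_on_def)
  qed
  ultimately show ?thesis using w(1) by blast
qed

section \<open>Local geometry in charts\<close>

text \<open>
  The pointwise and chartwise part of \<open>semi_riemannian\<close>. It makes no reference to the topology of the
  points, so that it passes to products directly, and it suffices for computations in charts.
\<close>

locale metric_charts =
  fixes M :: "('a, 'l, 'e::euclidean_space) metric_atlas"
  assumes subspace_model: "subspace (model M)"
    and inj_chart: "\<alpha> \<in> labels M \<Longrightarrow> inj_on (chart M \<alpha>) (chart_dom M \<alpha>)"
    and open_chart: "\<alpha> \<in> labels M \<Longrightarrow> openin (top_of_set (model M)) (chart M \<alpha> ` chart_dom M \<alpha>)"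
    and open_overlap: "\<alpha> \<in> labels M \<Longrightarrow> \<beta> \<in> labels M \<Longrightarrow>
      openin (top_of_set (model M)) (chart M \<alpha> ` (chart_dom M \<alpha> \<inter> chart_dom M \<beta>))"
    and smooth_transition: "\<alpha> \<in> labels M \<Longrightarrow> \<beta> \<in> labels M \<Longrightarrow>
      smooth_on (model M) (chart M \<alpha> ` (chart_dom M \<alpha> \<inter> chart_dom M \<beta>)) (\<lambda>x. chart M \<beta> (chart_inv M \<alpha> x))"
    and metric_sym: "\<alpha> \<in> labels M \<Longrightarrow> p \<in> chart_dom M \<alpha> \<Longrightarrow> u \<in> model M \<Longrightarrow> v \<in> model M \<Longrightarrow>
      metric M \<alpha> p u v = metric M \<alpha> p v u"
    and metric_add: "\<alpha> \<in> labels M \<Longrightarrow> p \<in> chart_dom M \<alpha> \<Longrightarrow> u \<in> model M \<Longrightarrow> v \<in> model M \<Longrightarrow> w \<in> model M \<Longrightarrow>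
      metric M \<alpha> p (u + v) w = metric M \<alpha> p u w + metric M \<alpha> p v w"
    and metric_scale: "\<alpha> \<in> labels M \<Longrightarrow> p \<in> chart_dom M \<alpha> \<Longrightarrow> u \<in> model M \<Longrightarrow> w \<in> model M \<Longrightarrow>
      metric M \<alpha> p (c *\<^sub>R u) w = c * metric M \<alpha> p u w"
    and metric_nondegenerate: "\<alpha> \<in> labels M \<Longrightarrow> p \<in> chart_dom M \<alpha> \<Longrightarrow> u \<in> model M \<Longrightarrow>
      (\<And>v. v \<in> model M \<Longrightarrow> metric M \<alpha> p u v = 0) \<Longrightarrow> u = 0"
    and metric_smooth: "\<alpha> \<in> labels M \<Longrightarrow> u \<in> model M \<Longrightarrow> v \<in> model M \<Longrightarrow>
      smooth_on (model M) (chart M \<alpha> ` chart_dom M \<alpha>) (\<lambda>x. metric M \<alpha> (chart_inv M \<alpha> x) u v)"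

lemma semi_riemannian_metric_charts:
  fixes M :: "('a::topological_space, 'l, 'e::euclidean_space) metric_atlas"
  assumes "semi_riemannian M"
  shows "metric_charts M"
proof
  note S = assms[unfolded semi_riemannian_def smooth_manifold_def]
  have charts: "\<forall>\<alpha>\<in>labels M. openin (top_of_set (points M)) (chart_dom M \<alpha>) \<and>
        openin (top_of_set (model M)) (chart M \<alpha> ` chart_dom M \<alpha>) \<and>
        homeomorphism (chart_dom M \<alpha>) (chart M \<alpha> ` chart_dom M \<alpha>) (chart M \<alpha>) (chart_inv M \<alpha>)"
    using S by (elim conjE)
  have metric: "\<forall>\<alpha>\<in>labels M. \<forall>p\<in>chart_dom M \<alpha>.
        (\<forall>u\<in>model M. \<forall>v\<in>model M. metric M \<alpha> p u v = metric M \<alpha> p v u) \<and>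
        (\<forall>u\<in>model M. \<forall>v\<in>model M. \<forall>w\<in>model M.
           metric M \<alpha> p (u + v) w = metric M \<alpha> p u w + metric M \<alpha> p v w) \<and>
        (\<forall>c. \<forall>u\<in>model M. \<forall>w\<in>model M. metric M \<alpha> p (c *\<^sub>R u) w = c * metric M \<alpha> p u w) \<and>
        (\<forall>u\<in>model M. (\<forall>v\<in>model M. metric M \<alpha> p u v = 0) \<longrightarrow> u = 0)"
    using S by (elim conjE)
  have transition: "\<forall>\<alpha>\<in>labels M. \<forall>\<beta>\<in>labels M.
        smooth_on (model M) (chart M \<alpha> ` (chart_dom M \<alpha> \<inter> chart_dom M \<beta>)) (\<lambda>x. chart M \<beta> (chart_inv M \<alpha> x))"
    using S by (elim conjE)
  have metric_smooth: "\<forall>\<alpha>\<in>labels M. \<forall>u\<in>model M. \<forall>v\<in>model M.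
        smooth_on (model M) (chart M \<alpha> ` chart_dom M \<alpha>) (\<lambda>x. metric M \<alpha> (chart_inv M \<alpha> x) u v)"
    using S by (elim conjE)
  show "subspace (model M)" using S by (elim conjE)
  fix \<alpha> assume \<alpha>: "\<alpha> \<in> labels M"
  note at = charts[THEN bspec, OF \<alpha>]
  have hom: "homeomorphism (chart_dom M \<alpha>) (chart M \<alpha> ` chart_dom M \<alpha>) (chart M \<alpha>) (chart_inv M \<alpha>)"
    and op: "openin (top_of_set (model M)) (chart M \<alpha> ` chart_dom M \<alpha>)"
    and dom: "openin (top_of_set (points M)) (chart_dom M \<alpha>)"
    using at by simp_all
  show "openin (top_of_set (model M)) (chart M \<alpha> ` chart_dom M \<alpha>)" by (fact op)
  show "inj_on (chart M \<alpha>) (chart_dom M \<alpha>)"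
    by (rule inj_on_inverseI[of _ "chart_inv M \<alpha>"]) (rule homeomorphism_apply1[OF hom])
  note mt = metric[THEN bspec, OF \<alpha>, THEN bspec]
  show "metric M \<alpha> p u v = metric M \<alpha> p v u" if "p \<in> chart_dom M \<alpha>" "u \<in> model M" "v \<in> model M" for p u v
    using mt[OF that(1)] that(2,3) by simp
  show "metric M \<alpha> p (u + v) w = metric M \<alpha> p u w + metric M \<alpha> p v w"
    if "p \<in> chart_dom M \<alpha>" "u \<in> model M" "v \<in> model M" "w \<in> model M" for p u v w
    using mt[OF that(1)] that(2-) by simp
  show "metric M \<alpha> p (c *\<^sub>R u) w = c * metric M \<alpha> p u w"
    if "p \<in> chart_dom M \<alpha>" "u \<in> model M" "w \<in> model M" for p u w c
    using mt[OF that(1)] that(2-) by simp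
  show "u = 0" if "p \<in> chart_dom M \<alpha>" "u \<in> model M" "\<And>v. v \<in> model M \<Longrightarrow> metric M \<alpha> p u v = 0" for p u
    using mt[OF that(1)] that(2-) by simp
  show "smooth_on (model M) (chart M \<alpha> ` chart_dom M \<alpha>) (\<lambda>x. metric M \<alpha> (chart_inv M \<alpha> x) u v)"
    if "u \<in> model M" "v \<in> model M" for u v
    using metric_smooth \<alpha> that by simp
  fix \<beta> assume \<beta>: "\<beta> \<in> labels M"
  show "smooth_on (model M) (chart M \<alpha> ` (chart_dom M \<alpha> \<inter> chart_dom M \<beta>)) (\<lambda>x. chart M \<beta> (chart_inv M \<alpha> x))"
    using transition \<alpha> \<beta> by simp
  have "openin (top_of_set (points M)) (chart_dom M \<beta>)" using charts \<beta> by simp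
  then have "openin (top_of_set (points M)) (chart_dom M \<alpha> \<inter> chart_dom M \<beta>)"
    using dom by (rule openin_Int[rotated])
  then have "openin (top_of_set (chart_dom M \<alpha>)) (chart_dom M \<alpha> \<inter> chart_dom M \<beta>)"
    by (rule openin_subset_trans) (use openin_imp_subset[OF dom] in auto)
  then have "openin (top_of_set (chart M \<alpha> ` chart_dom M \<alpha>)) (chart M \<alpha> ` (chart_dom M \<alpha> \<inter> chart_dom M \<beta>))"
    by (rule homeomorphism_imp_open_map[OF hom])
  then show "openin (top_of_set (model M)) (chart M \<alpha> ` (chart_dom M \<alpha> \<inter> chart_dom M \<beta>))"
    using op by (rule openin_trans)
qed

definition chart_smooth ::
    "('a, 'l, 'e::real_normed_vector, 'z) atlas_scheme \<Rightarrow> 'l \<Rightarrow> ('a \<Rightarrow> 'f::real_normed_vector) \<Rightarrow> bool" where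
  "chart_smooth M \<alpha> h \<longleftrightarrow> smooth_on (model M) (chart M \<alpha> ` chart_dom M \<alpha>) (\<lambda>x. h (chart_inv M \<alpha> x))"

context metric_charts
begin

lemma chart_inv_chart [simp]:
  "\<alpha> \<in> labels M \<Longrightarrow> p \<in> chart_dom M \<alpha> \<Longrightarrow> chart_inv M \<alpha> (chart M \<alpha> p) = p"
  by (simp add: chart_inv_def inv_into_f_f inj_chart)

lemma chart_in_model: "\<alpha> \<in> labels M \<Longrightarrow> p \<in> chart_dom M \<alpha> \<Longrightarrow> chart M \<alpha> p \<in> model M"
  using openin_imp_subset[OF open_chart] by blast

lemma chart_line:
  assumes "\<alpha> \<in> labels M" "p \<in> chart_dom M \<alpha>" "u \<in> model M"
  shows "eventually (\<lambda>t::real. chart M \<alpha> p + t *\<^sub>R u \<in> chart M \<alpha> ` chart_dom M \<alpha>) (nhds 0)"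
  using openin_subspace_line[OF open_chart[OF assms(1)] subspace_model] assms by blast

lemma chart_has_deriv:
  assumes "chart_smooth M \<alpha> h" "p \<in> chart_dom M \<alpha>" "u \<in> model M"
  shows "((\<lambda>t. h (chart_inv M \<alpha> (chart M \<alpha> p + t *\<^sub>R u))) has_vector_derivative chart_deriv M \<alpha> h p u) (at 0)"
  unfolding chart_deriv_def
  by (rule smooth_on_has_dir_deriv[OF assms(1)[unfolded chart_smooth_def]]) (use assms in auto)

lemma chart_deriv_cong:
  assumes "\<alpha> \<in> labels M" "p \<in> chart_dom M \<alpha>" "u \<in> model M" "\<And>q. q \<in> chart_dom M \<alpha> \<Longrightarrow> h q = k q"
  shows "chart_deriv M \<alpha> h p u = chart_deriv M \<alpha> k p u"
  unfolding chart_deriv_def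
  by (rule dir_deriv_cong_on[OF open_chart[OF assms(1)] subspace_model])
     (use assms in auto)

lemma chart_smooth_cong:
  assumes "\<alpha> \<in> labels M" "\<And>q. q \<in> chart_dom M \<alpha> \<Longrightarrow> h q = k q" "chart_smooth M \<alpha> h"
  shows "chart_smooth M \<alpha> k"
  using assms(3) unfolding chart_smooth_def
  by (rule smooth_on_cong[OF open_chart[OF assms(1)] subspace_model, rotated])
     (use assms in auto)

lemma chart_deriv_eqI:
  assumes "\<alpha> \<in> labels M" "p \<in> chart_dom M \<alpha>"
    and "((\<lambda>t. h (chart_inv M \<alpha> (chart M \<alpha> p + t *\<^sub>R u))) has_vector_derivative D) (at 0)"
  shows "chart_deriv M \<alpha> h p u = D"
  unfolding chart_deriv_def by (rule dir_deriv_eqI) (use assms in simp)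

lemma chart_deriv_linear_dir:
  assumes "\<alpha> \<in> labels M" "chart_smooth M \<alpha> h" "p \<in> chart_dom M \<alpha>"
  shows "linear_on_sub (model M) (chart_deriv M \<alpha> h p)"
  unfolding linear_on_sub_def chart_deriv_def
  using dir_deriv_add_dir[OF assms(2)[unfolded chart_smooth_def] open_chart[OF assms(1)] subspace_model]
    dir_deriv_scale_dir[OF assms(2)[unfolded chart_smooth_def]] assms(3) by blast

lemma chart_deriv_in_subspace:
  fixes h :: "'a \<Rightarrow> 'f::euclidean_space"
  assumes "\<alpha> \<in> labels M" "chart_smooth M \<alpha> h" "p \<in> chart_dom M \<alpha>" "u \<in> model M"
    and "subspace W" "\<And>q. q \<in> chart_dom M \<alpha> \<Longrightarrow> h q \<in> W"
  shows "chart_deriv M \<alpha> h p u \<in> W"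
  unfolding chart_deriv_def
  by (rule dir_deriv_in_subspace[OF assms(2)[unfolded chart_smooth_def] open_chart[OF assms(1)] subspace_model _
        assms(4,5)])
     (use assms in auto)

lemma chart_deriv_at:
  assumes "\<alpha> \<in> labels M" "y \<in> chart M \<alpha> ` chart_dom M \<alpha>"
  shows "chart_deriv M \<alpha> h (chart_inv M \<alpha> y) u = dir_deriv (\<lambda>x. h (chart_inv M \<alpha> x)) u y"
  using assms by (auto simp: chart_deriv_def)

lemma chart_smooth_deriv:
  assumes \<alpha>: "\<alpha> \<in> labels M" and h: "chart_smooth M \<alpha> h" and u: "u \<in> model M"
  shows "chart_smooth M \<alpha> (\<lambda>q. chart_deriv M \<alpha> h q u)"
  unfolding chart_smooth_def
  by (rule smooth_on_cong[OF open_chart[OF \<alpha>] subspace_model chart_deriv_at[OF \<alpha>, symmetric]])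
     (use smooth_on_dir_deriv[OF h[unfolded chart_smooth_def] u] in auto)

lemma chart_deriv_deriv:
  assumes \<alpha>: "\<alpha> \<in> labels M" and p: "p \<in> chart_dom M \<alpha>" and v: "v \<in> model M"
  shows "chart_deriv M \<alpha> (\<lambda>q. chart_deriv M \<alpha> h q u) p v
    = dir_deriv (dir_deriv (\<lambda>x. h (chart_inv M \<alpha> x)) u) v (chart M \<alpha> p)"
  unfolding chart_deriv_def[where p = p]
  by (rule dir_deriv_cong_on[OF open_chart[OF \<alpha>] subspace_model _ v chart_deriv_at[OF \<alpha>]])
     (use p in auto)

lemma chart_deriv_commute:
  assumes \<alpha>: "\<alpha> \<in> labels M" and h: "chart_smooth M \<alpha> h" and p: "p \<in> chart_dom M \<alpha>"
    and u: "u \<in> model M" and v: "v \<in> model M"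
  shows "chart_deriv M \<alpha> (\<lambda>q. chart_deriv M \<alpha> h q u) p v = chart_deriv M \<alpha> (\<lambda>q. chart_deriv M \<alpha> h q v) p u"
  unfolding chart_deriv_deriv[OF \<alpha> p u] chart_deriv_deriv[OF \<alpha> p v]
  by (rule dir_deriv_commute[OF h[unfolded chart_smooth_def] open_chart[OF \<alpha>] subspace_model _ u v])
     (use p in auto)

lemma chart_smooth_linear:
  assumes "bounded_linear T" "\<alpha> \<in> labels M" "chart_smooth M \<alpha> h"
  shows "chart_smooth M \<alpha> (\<lambda>q. T (h q))"
  unfolding chart_smooth_def
  by (rule smooth_on_linear[OF assms(1) assms(3)[unfolded chart_smooth_def] open_chart[OF assms(2)] subspace_model])

lemma chart_deriv_linear:
  assumes "bounded_linear T" "\<alpha> \<in> labels M" "chart_smooth M \<alpha> h" "p \<in> chart_dom M \<alpha>" "u \<in> model M"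
  shows "chart_deriv M \<alpha> (\<lambda>q. T (h q)) p u = T (chart_deriv M \<alpha> h p u)"
  by (rule chart_deriv_eqI[OF assms(2,4)])
     (rule bounded_linear.has_vector_derivative[OF assms(1) chart_has_deriv[OF assms(3-5)]])

lemma zero_of_linear:
  assumes "linear_on_sub (model M) T"
  shows "T 0 = 0"
proof -
  have "T (0 *\<^sub>R 0) = 0 *\<^sub>R T 0"
    using assms subspace_0[OF subspace_model] unfolding linear_on_sub_def by blast
  then show ?thesis by simp
qed

lemma metric_chart_smooth:
  "\<alpha> \<in> labels M \<Longrightarrow> u \<in> model M \<Longrightarrow> v \<in> model M \<Longrightarrow> chart_smooth M \<alpha> (\<lambda>q. metric M \<alpha> q u v)"
  by (simp add: chart_smooth_def metric_smooth)

lemma metric_linear_left: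
  "\<alpha> \<in> labels M \<Longrightarrow> p \<in> chart_dom M \<alpha> \<Longrightarrow> v \<in> model M \<Longrightarrow> linear_on_sub (model M) (\<lambda>u. metric M \<alpha> p u v)"
  by (simp add: linear_on_sub_def metric_add metric_scale)

lemma metric_linear_right:
  assumes "\<alpha> \<in> labels M" "p \<in> chart_dom M \<alpha>" "u \<in> model M"
  shows "linear_on_sub (model M) (metric M \<alpha> p u)"
proof -
  have "metric M \<alpha> p u v = metric M \<alpha> p v u" if "v \<in> model M" for v
    by (rule metric_sym[OF assms that])
  then show ?thesis
    using metric_linear_left[OF assms] subspace_model
    by (simp add: linear_on_sub_def subspace_add subspace_scale)
qed

definition metric_deriv :: "'l \<Rightarrow> 'a \<Rightarrow> 'e \<Rightarrow> 'e \<Rightarrow> 'e \<Rightarrow> real" where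
  "metric_deriv \<alpha> p w u v = chart_deriv M \<alpha> (\<lambda>q. metric M \<alpha> q u v) p w"

lemma metric_deriv_sym:
  assumes "\<alpha> \<in> labels M" "p \<in> chart_dom M \<alpha>" "w \<in> model M" "u \<in> model M" "v \<in> model M"
  shows "metric_deriv \<alpha> p w u v = metric_deriv \<alpha> p w v u"
  unfolding metric_deriv_def by (rule chart_deriv_cong) (use assms metric_sym in auto)

lemma metric_deriv_linear_dir:
  assumes "\<alpha> \<in> labels M" "p \<in> chart_dom M \<alpha>" "u \<in> model M" "v \<in> model M"
  shows "linear_on_sub (model M) (\<lambda>w. metric_deriv \<alpha> p w u v)"
  unfolding metric_deriv_def
  by (rule chart_deriv_linear_dir) (use assms metric_chart_smooth in auto)

text \<open>
  The product rule for \<open>g(v, Z)\<close> with \<open>v\<close> constant. Smoothness of the metric is known only for constant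
  arguments, so \<open>Z\<close> is first expanded in a basis.
\<close>

lemma metric_product_rule:
  assumes \<alpha>: "\<alpha> \<in> labels M" and p: "p \<in> chart_dom M \<alpha>" and u: "u \<in> model M" and v: "v \<in> model M"
    and Z: "chart_smooth M \<alpha> Z" and Z_in: "\<And>q. q \<in> chart_dom M \<alpha> \<Longrightarrow> Z q \<in> model M"
  shows "chart_deriv M \<alpha> (\<lambda>q. metric M \<alpha> q v (Z q)) p u
    = metric_deriv \<alpha> p u v (Z p) + metric M \<alpha> p v (chart_deriv M \<alpha> Z p u)"
proof -
  obtain \<pi> where \<pi>: "linear \<pi>" "\<And>x. \<pi> x \<in> model M" "\<And>v. v \<in> model M \<Longrightarrow> \<pi> v = v"
    using subspace_projection[OF subspace_model] by metis
  let ?c = "\<lambda>t. chart_inv M \<alpha> (chart M \<alpha> p + t *\<^sub>R u)"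
  let ?DZ = "chart_deriv M \<alpha> Z p u"
  have DZ: "?DZ \<in> model M"
    by (rule chart_deriv_in_subspace[OF \<alpha> Z p u subspace_model Z_in])
  have expand: "metric M \<alpha> q v z = (\<Sum>b\<in>Basis. (z \<bullet> b) * metric M \<alpha> q v (\<pi> b))"
    if "q \<in> chart_dom M \<alpha>" "z \<in> model M" for q z
    using linear_on_sub_sum_expand[OF \<pi>(1,2) metric_linear_right[OF \<alpha> that(1) v], of z] \<pi>(3) that by simp
  have m: "((\<lambda>t. metric M \<alpha> (?c t) v z) has_vector_derivative metric_deriv \<alpha> p u v z) (at 0)" if "z \<in> model M" for z
    unfolding metric_deriv_def by (rule chart_has_deriv[OF metric_chart_smooth]) (use \<alpha> p u v that in auto)
  have z: "((\<lambda>t. Z (?c t) \<bullet> b) has_vector_derivative ?DZ \<bullet> b) (at 0)" for b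
    by (rule bounded_linear.has_vector_derivative[OF bounded_linear_inner_left])
       (rule chart_has_deriv[OF Z p u])
  have md: "metric_deriv \<alpha> p u v z = (\<Sum>b\<in>Basis. (z \<bullet> b) * metric_deriv \<alpha> p u v (\<pi> b))" if zM: "z \<in> model M" for z
  proof -
    have "metric_deriv \<alpha> p u v z = chart_deriv M \<alpha> (\<lambda>q. \<Sum>b\<in>Basis. (z \<bullet> b) * metric M \<alpha> q v (\<pi> b)) p u"
      unfolding metric_deriv_def by (rule chart_deriv_cong[OF \<alpha> p u]) (rule expand[OF _ zM])
    also have "\<dots> = (\<Sum>b\<in>Basis. (z \<bullet> b) * metric_deriv \<alpha> p u v (\<pi> b))"
      by (rule chart_deriv_eqI[OF \<alpha> p])
         (intro has_vector_derivative_sum bounded_linear.has_vector_derivative[OF bounded_linear_mult_right] m \<pi>)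
    finally show ?thesis .
  qed
  have "chart_deriv M \<alpha> (\<lambda>q. metric M \<alpha> q v (Z q)) p u
      = chart_deriv M \<alpha> (\<lambda>q. \<Sum>b\<in>Basis. (Z q \<bullet> b) * metric M \<alpha> q v (\<pi> b)) p u"
    by (rule chart_deriv_cong[OF \<alpha> p u]) (rule expand[OF _ Z_in])
  also have "\<dots> = (\<Sum>b\<in>Basis. (Z (?c 0) \<bullet> b) * metric_deriv \<alpha> p u v (\<pi> b) + (?DZ \<bullet> b) * metric M \<alpha> (?c 0) v (\<pi> b))"
    by (rule chart_deriv_eqI[OF \<alpha> p])
       (intro has_vector_derivative_sum has_vector_derivative_mult m z \<pi>)
  also have "\<dots> = (\<Sum>b\<in>Basis. (Z p \<bullet> b) * metric_deriv \<alpha> p u v (\<pi> b)) + (\<Sum>b\<in>Basis. (?DZ \<bullet> b) * metric M \<alpha> p v (\<pi> b))"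
    using \<alpha> p by (simp add: sum.distrib)
  also have "\<dots> = metric_deriv \<alpha> p u v (Z p) + metric M \<alpha> p v ?DZ"
    using md[OF Z_in[OF p]] expand[OF p DZ] by simp
  finally show ?thesis .
qed

lemma metric_deriv_linear_right:
  assumes "\<alpha> \<in> labels M" "p \<in> chart_dom M \<alpha>" "w \<in> model M" "u \<in> model M"
  shows "linear_on_sub (model M) (metric_deriv \<alpha> p w u)"
  unfolding linear_on_sub_def
proof (intro conjI ballI allI)
  have m: "((\<lambda>t. metric M \<alpha> (chart_inv M \<alpha> (chart M \<alpha> p + t *\<^sub>R w)) u z) has_vector_derivative metric_deriv \<alpha> p w u z) (at 0)"
    if "z \<in> model M" for z
    unfolding metric_deriv_def by (rule chart_has_deriv[OF metric_chart_smooth]) (use assms that in auto)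
  note lin = metric_linear_right[OF assms(1) _ assms(4), unfolded linear_on_sub_def]
  fix y z assume yz: "y \<in> model M" "z \<in> model M"
  have "metric_deriv \<alpha> p w u (y + z) = chart_deriv M \<alpha> (\<lambda>q. metric M \<alpha> q u y + metric M \<alpha> q u z) p w"
    unfolding metric_deriv_def by (rule chart_deriv_cong) (use assms lin yz in auto)
  also have "\<dots> = metric_deriv \<alpha> p w u y + metric_deriv \<alpha> p w u z"
    by (rule chart_deriv_eqI[OF assms(1,2)]) (intro has_vector_derivative_add m yz)
  finally show "metric_deriv \<alpha> p w u (y + z) = metric_deriv \<alpha> p w u y + metric_deriv \<alpha> p w u z" .
next
  fix c z assume z: "z \<in> model M"
  have m: "((\<lambda>t. metric M \<alpha> (chart_inv M \<alpha> (chart M \<alpha> p + t *\<^sub>R w)) u z) has_vector_derivative metric_deriv \<alpha> p w u z) (at 0)"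
    unfolding metric_deriv_def by (rule chart_has_deriv[OF metric_chart_smooth]) (use assms z in auto)
  note lin = metric_linear_right[OF assms(1) _ assms(4), unfolded linear_on_sub_def]
  have "metric_deriv \<alpha> p w u (c *\<^sub>R z) = chart_deriv M \<alpha> (\<lambda>q. c *\<^sub>R metric M \<alpha> q u z) p w"
    unfolding metric_deriv_def by (rule chart_deriv_cong) (use assms lin z in auto)
  also have "\<dots> = c *\<^sub>R metric_deriv \<alpha> p w u z"
    by (rule chart_deriv_eqI[OF assms(1,2)])
       (rule bounded_linear.has_vector_derivative[OF bounded_linear_scaleR_right m])
  finally show "metric_deriv \<alpha> p w u (c *\<^sub>R z) = c *\<^sub>R metric_deriv \<alpha> p w u z" .
qed

text \<open>
  The Koszul formula does define a vector: its right-hand side is linear in \<open>z\<close>, so nondegeneracy of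
  the metric supplies exactly one \<open>w\<close>.
\<close>

lemma christoffel_koszul:
  assumes \<alpha>: "\<alpha> \<in> labels M" and p: "p \<in> chart_dom M \<alpha>" and u: "u \<in> model M" and v: "v \<in> model M"
  shows "christoffel M \<alpha> p u v \<in> model M" (is ?in)
    and "z \<in> model M \<Longrightarrow> 2 * metric M \<alpha> p (christoffel M \<alpha> p u v) z =
      metric_deriv \<alpha> p u v z + metric_deriv \<alpha> p v u z - metric_deriv \<alpha> p z u v"
proof -
  let ?T = "\<lambda>z. metric_deriv \<alpha> p u v z + metric_deriv \<alpha> p v u z - metric_deriv \<alpha> p z u v"
  have T: "linear_on_sub (model M) ?T"
    using metric_deriv_linear_right[OF \<alpha> p u v] metric_deriv_linear_right[OF \<alpha> p v u]
      metric_deriv_linear_dir[OF \<alpha> p u v]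
    unfolding linear_on_sub_def by (simp add: algebra_simps)
  have "\<exists>!w. w \<in> model M \<and> (\<forall>z\<in>model M. (\<lambda>u v. 2 * metric M \<alpha> p u v) w z = ?T z)"
  proof (rule nondegenerate_represents[OF subspace_model _ _ _ T])
    show "linear_on_sub (model M) (\<lambda>u. 2 * metric M \<alpha> p u v)" if "v \<in> model M" for v
      using metric_linear_left[OF \<alpha> p that] by (simp add: linear_on_sub_def)
    show "linear_on_sub (model M) (\<lambda>v. 2 * metric M \<alpha> p u v)" if "u \<in> model M" for u
      using metric_linear_right[OF \<alpha> p that] by (simp add: linear_on_sub_def)
    show "u = 0" if "u \<in> model M" "\<And>v. v \<in> model M \<Longrightarrow> 2 * metric M \<alpha> p u v = 0" for u
      using metric_nondegenerate[OF \<alpha> p that(1)] that(2) by simp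
  qed
  from theI'[OF this]
  have "christoffel M \<alpha> p u v \<in> model M \<and> (\<forall>z\<in>model M. 2 * metric M \<alpha> p (christoffel M \<alpha> p u v) z = ?T z)"
    unfolding christoffel_def metric_deriv_def .
  then show ?in "z \<in> model M \<Longrightarrow> 2 * metric M \<alpha> p (christoffel M \<alpha> p u v) z = ?T z" by blast+
qed

text \<open>
  The components of \<open>\<L>\<^sub>X g\<close>. This form of the Killing equation contains no Christoffel symbols and only
  first derivatives of \<open>X\<close>, which makes it easy to restrict to slices and to differentiate.
\<close>

definition lie_killing :: "('l \<Rightarrow> 'a \<Rightarrow> 'e) \<Rightarrow> 'l \<Rightarrow> 'a \<Rightarrow> 'e \<Rightarrow> 'e \<Rightarrow> real" where
  "lie_killing X \<alpha> p u v = metric_deriv \<alpha> p (X \<alpha> p) u v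
     + metric M \<alpha> p (chart_deriv M \<alpha> (X \<alpha>) p u) v + metric M \<alpha> p u (chart_deriv M \<alpha> (X \<alpha>) p v)"

context
  fixes X assumes X: "vector_field M X"
begin

lemma field_in_model: "\<alpha> \<in> labels M \<Longrightarrow> p \<in> chart_dom M \<alpha> \<Longrightarrow> X \<alpha> p \<in> model M"
  using X unfolding vector_field_def by blast

lemma field_smooth: "\<alpha> \<in> labels M \<Longrightarrow> chart_smooth M \<alpha> (X \<alpha>)"
  using X unfolding vector_field_def chart_smooth_def by blast

lemma field_deriv_in_model:
  assumes "\<alpha> \<in> labels M" "p \<in> chart_dom M \<alpha>" "u \<in> model M"
  shows "chart_deriv M \<alpha> (X \<alpha>) p u \<in> model M"
  by (rule chart_deriv_in_subspace[OF assms(1) field_smooth[OF assms(1)] assms(2,3) subspace_model])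
     (rule field_in_model[OF assms(1)])

lemma covariant_deriv_metric:
  assumes \<alpha>: "\<alpha> \<in> labels M" and p: "p \<in> chart_dom M \<alpha>" and u: "u \<in> model M" and v: "v \<in> model M"
  shows "2 * metric M \<alpha> p (covariant_deriv M X \<alpha> p u) v
    = 2 * metric M \<alpha> p (chart_deriv M \<alpha> (X \<alpha>) p u) v
      + metric_deriv \<alpha> p u (X \<alpha> p) v + metric_deriv \<alpha> p (X \<alpha> p) u v - metric_deriv \<alpha> p v u (X \<alpha> p)"
  unfolding covariant_deriv_def
  using metric_add[OF \<alpha> p field_deriv_in_model[OF \<alpha> p u] christoffel_koszul(1)[OF \<alpha> p u field_in_model[OF \<alpha> p]] v]
    christoffel_koszul(2)[OF \<alpha> p u field_in_model[OF \<alpha> p] v]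
  by simp

text \<open>
  In \<open>g(\<nabla>\<^sub>u X, v) + g(u, \<nabla>\<^sub>v X)\<close> the derivatives of \<open>g\<close> along \<open>u\<close> and \<open>v\<close> cancel, and the derivative along
  \<open>X\<close> remains.
\<close>

lemma killing_field_iff:
  "killing_field M X \<longleftrightarrow> (\<forall>\<alpha>\<in>labels M. \<forall>p\<in>chart_dom M \<alpha>. \<forall>u\<in>model M. \<forall>v\<in>model M. lie_killing X \<alpha> p u v = 0)"
proof -
  have "metric M \<alpha> p (covariant_deriv M X \<alpha> p u) v + metric M \<alpha> p u (covariant_deriv M X \<alpha> p v) = lie_killing X \<alpha> p u v"
    if \<alpha>: "\<alpha> \<in> labels M" and p: "p \<in> chart_dom M \<alpha>" and u: "u \<in> model M" and v: "v \<in> model M" for \<alpha> p u v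
  proof -
    note inM = field_in_model[OF \<alpha> p]
    have "covariant_deriv M X \<alpha> p v \<in> model M"
      unfolding covariant_deriv_def
      using subspace_add[OF subspace_model field_deriv_in_model[OF \<alpha> p v] christoffel_koszul(1)[OF \<alpha> p v inM]] .
    then have "metric M \<alpha> p u (covariant_deriv M X \<alpha> p v) = metric M \<alpha> p (covariant_deriv M X \<alpha> p v) u"
      by (rule metric_sym[OF \<alpha> p u])
    moreover have "metric M \<alpha> p u (chart_deriv M \<alpha> (X \<alpha>) p v) = metric M \<alpha> p (chart_deriv M \<alpha> (X \<alpha>) p v) u"
      by (rule metric_sym[OF \<alpha> p u field_deriv_in_model[OF \<alpha> p v]])
    ultimately show ?thesis
      using covariant_deriv_metric[OF \<alpha> p u v] covariant_deriv_metric[OF \<alpha> p v u]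
        metric_deriv_sym[OF \<alpha> p u inM v] metric_deriv_sym[OF \<alpha> p v u inM] metric_deriv_sym[OF \<alpha> p inM u v]
      unfolding lie_killing_def by linarith
  qed
  then show ?thesis unfolding killing_field_def using X by auto
qed

text \<open>
  The heart of the argument. Closedness of the one-form \<open>g(X, _)\<close> makes \<open>\<nabla>X\<close> symmetric with respect to
  \<open>g\<close>, the Killing equation makes it skew, and so it vanishes.
\<close>

lemma killing_gradient_parallel:
  assumes killing: "\<And>\<alpha> p u v. \<alpha> \<in> labels M \<Longrightarrow> p \<in> chart_dom M \<alpha> \<Longrightarrow> u \<in> model M \<Longrightarrow> v \<in> model M \<Longrightarrow>
      lie_killing X \<alpha> p u v = 0"
    and closed: "\<And>\<alpha> p u v. \<alpha> \<in> labels M \<Longrightarrow> p \<in> chart_dom M \<alpha> \<Longrightarrow> u \<in> model M \<Longrightarrow> v \<in> model M \<Longrightarrow>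
      chart_deriv M \<alpha> (\<lambda>q. metric M \<alpha> q v (X \<alpha> q)) p u = chart_deriv M \<alpha> (\<lambda>q. metric M \<alpha> q u (X \<alpha> q)) p v"
  shows "parallel_field M X"
  unfolding parallel_field_def
proof (intro conjI X ballI)
  fix \<alpha> p u assume \<alpha>: "\<alpha> \<in> labels M" and p: "p \<in> chart_dom M \<alpha>" and u: "u \<in> model M"
  note inM = field_in_model[OF \<alpha> p]
  have in2: "covariant_deriv M X \<alpha> p u \<in> model M"
    unfolding covariant_deriv_def
    using subspace_add[OF subspace_model field_deriv_in_model[OF \<alpha> p u] christoffel_koszul(1)[OF \<alpha> p u inM]] .
  have product_rule: "chart_deriv M \<alpha> (\<lambda>q. metric M \<alpha> q z (X \<alpha> q)) p w
      = metric_deriv \<alpha> p w z (X \<alpha> p) + metric M \<alpha> p z (chart_deriv M \<alpha> (X \<alpha>) p w)"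
    if "w \<in> model M" "z \<in> model M" for w z
    by (rule metric_product_rule[OF \<alpha> p that field_smooth[OF \<alpha>]]) (rule field_in_model[OF \<alpha>])
  show "covariant_deriv M X \<alpha> p u = 0"
  proof (rule metric_nondegenerate[OF \<alpha> p in2])
    fix v assume v: "v \<in> model M"
    have "metric_deriv \<alpha> p u v (X \<alpha> p) + metric M \<alpha> p v (chart_deriv M \<alpha> (X \<alpha>) p u)
        = metric_deriv \<alpha> p v u (X \<alpha> p) + metric M \<alpha> p u (chart_deriv M \<alpha> (X \<alpha>) p v)"
      using closed[OF \<alpha> p u v] product_rule[OF u v] product_rule[OF v u] by simp
    then show "metric M \<alpha> p (covariant_deriv M X \<alpha> p u) v = 0"
      using covariant_deriv_metric[OF \<alpha> p u v] killing[OF \<alpha> p u v]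
        metric_sym[OF \<alpha> p v field_deriv_in_model[OF \<alpha> p u]] metric_deriv_sym[OF \<alpha> p u inM v]
      unfolding lie_killing_def by linarith
  qed
qed

end

lemma tangent_map_linear:
  assumes "\<alpha> \<in> labels M" "\<beta> \<in> labels M" "p \<in> chart_dom M \<alpha>" "p \<in> chart_dom M \<beta>"
  shows "linear_on_sub (model M) (tangent_map M M id \<alpha> \<beta> p)"
  unfolding linear_on_sub_def tangent_map_def chart_deriv_def id_def
  using dir_deriv_add_dir[OF smooth_transition[OF assms(1,2)] open_overlap[OF assms(1,2)] subspace_model]
    dir_deriv_scale_dir[OF smooth_transition[OF assms(1,2)]] assms(3,4) by blast

lemma tangent_map_same:
  assumes \<alpha>: "\<alpha> \<in> labels M" and p: "p \<in> chart_dom M \<alpha>" and u: "u \<in> model M"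
  shows "tangent_map M M id \<alpha> \<alpha> p u = u"
proof -
  have "tangent_map M M id \<alpha> \<alpha> p u = dir_deriv (\<lambda>x. x) u (chart M \<alpha> p)"
    unfolding tangent_map_def chart_deriv_def id_def
    by (rule dir_deriv_cong_on[OF open_chart[OF \<alpha>] subspace_model _ u]) (use \<alpha> p in auto)
  also have "\<dots> = u"
    by (rule dir_deriv_eqI) (auto intro!: derivative_eq_intros)
  finally show ?thesis .
qed

lemma vector_field_add:
  assumes X: "vector_field M X" and Y: "vector_field M Y"
  shows "vector_field M (field_add X Y)"
  unfolding vector_field_def field_add_def
proof (intro conjI allI impI ballI)
  fix \<alpha> \<beta> p assume *: "\<alpha> \<in> labels M" "\<beta> \<in> labels M" "p \<in> chart_dom M \<alpha> \<inter> chart_dom M \<beta>"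
  have "X \<beta> p = tangent_map M M id \<alpha> \<beta> p (X \<alpha> p)" "Y \<beta> p = tangent_map M M id \<alpha> \<beta> p (Y \<alpha> p)"
    using X Y * unfolding vector_field_def by blast+
  then show "X \<beta> p + Y \<beta> p = tangent_map M M id \<alpha> \<beta> p (X \<alpha> p + Y \<alpha> p)"
    using tangent_map_linear[of \<alpha> \<beta> p] * field_in_model[OF X, of \<alpha> p] field_in_model[OF Y, of \<alpha> p]
    by (simp add: linear_on_sub_def)
next
  fix \<alpha> assume \<alpha>: "\<alpha> \<in> labels M"
  show "smooth_on (model M) (chart M \<alpha> ` chart_dom M \<alpha>) (\<lambda>x. X \<alpha> (chart_inv M \<alpha> x) + Y \<alpha> (chart_inv M \<alpha> x))"
    by (rule smooth_on_add[OF _ _ open_chart[OF \<alpha>] subspace_model])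
       (use field_smooth[OF X \<alpha>] field_smooth[OF Y \<alpha>] in \<open>simp_all add: chart_smooth_def\<close>)
next
  fix \<alpha> p assume *: "\<not> (\<alpha> \<in> labels M \<and> p \<in> chart_dom M \<alpha>)"
  have "X \<alpha> p = 0" "Y \<alpha> p = 0" using X Y * unfolding vector_field_def by blast+
  then show "X \<alpha> p + Y \<alpha> p = 0" by simp
next
  fix \<alpha> p assume *: "\<alpha> \<in> labels M" "p \<in> chart_dom M \<alpha>"
  then show "X \<alpha> p + Y \<alpha> p \<in> model M"
    by (intro subspace_add[OF subspace_model] field_in_model X Y)
qed

lemma killing_field_add:
  assumes X: "killing_field M X" and Y: "killing_field M Y"
  shows "killing_field M (field_add X Y)"
proof -
  have vf: "vector_field M X" "vector_field M Y" using X Y by (auto simp: killing_field_def)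
  note vfs = vector_field_add[OF vf]
  have "lie_killing (field_add X Y) \<alpha> p u v = lie_killing X \<alpha> p u v + lie_killing Y \<alpha> p u v"
    if *: "\<alpha> \<in> labels M" "p \<in> chart_dom M \<alpha>" "u \<in> model M" "v \<in> model M" for \<alpha> p u v
  proof -
    have d: "chart_deriv M \<alpha> (field_add X Y \<alpha>) p w = chart_deriv M \<alpha> (X \<alpha>) p w + chart_deriv M \<alpha> (Y \<alpha>) p w"
      if "w \<in> model M" for w
      unfolding field_add_def
      by (rule chart_deriv_eqI[OF *(1,2)])
         (intro has_vector_derivative_add chart_has_deriv field_smooth vf * that)
    have fa: "field_add X Y \<alpha> p = X \<alpha> p + Y \<alpha> p" by (simp add: field_add_def)
    note in' = field_in_model[OF vf(1) *(1,2)] field_in_model[OF vf(2) *(1,2)]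
      field_deriv_in_model[OF vf(1) *(1,2)] field_deriv_in_model[OF vf(2) *(1,2)]
    show ?thesis
      using metric_deriv_linear_dir[OF *] metric_linear_left[OF *(1,2,4)] metric_linear_right[OF *(1,2,3)] in' *
      unfolding lie_killing_def by (simp add: d fa linear_on_sub_def)
  qed
  then show ?thesis
    using X Y by (simp add: killing_field_iff[OF vfs] killing_field_iff[OF vf(1)] killing_field_iff[OF vf(2)])
qed

lemma vector_field_zero: "vector_field M (\<lambda>_ _. 0)"
  unfolding vector_field_def
proof (intro conjI allI impI ballI)
  fix \<alpha> \<beta> p assume *: "\<alpha> \<in> labels M" "\<beta> \<in> labels M" "p \<in> chart_dom M \<alpha> \<inter> chart_dom M \<beta>"
  have "tangent_map M M id \<alpha> \<beta> p (0 *\<^sub>R 0) = 0 *\<^sub>R tangent_map M M id \<alpha> \<beta> p 0"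
    using tangent_map_linear[of \<alpha> \<beta> p] * subspace_0[OF subspace_model] unfolding linear_on_sub_def by blast
  then show "0 = tangent_map M M id \<alpha> \<beta> p 0" by simp
qed (simp_all add: subspace_0[OF subspace_model] smooth_on_zero)

lemma killing_field_zero: "killing_field M (\<lambda>_ _. 0)"
proof -
  have "lie_killing (\<lambda>_ _. 0) \<alpha> p u v = 0"
    if *: "\<alpha> \<in> labels M" "p \<in> chart_dom M \<alpha>" "u \<in> model M" "v \<in> model M" for \<alpha> p u v
  proof -
    have [simp]: "chart_deriv M \<alpha> (\<lambda>_. 0::'e) p w = 0" for w
      by (rule chart_deriv_eqI[OF *(1,2)]) simp
    have z: "T 0 = 0" if "linear_on_sub (model M) T" for T :: "'e \<Rightarrow> real"
      using that subspace_0[OF subspace_model] unfolding linear_on_sub_def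
      by (metis scaleR_zero_left)
    show ?thesis
      using z[OF metric_deriv_linear_dir[OF *]] z[OF metric_linear_left[OF *(1,2,4)]] z[OF metric_linear_right[OF *(1,2,3)]]
      by (simp add: lie_killing_def)
  qed
  then show ?thesis by (simp add: killing_field_iff[OF vector_field_zero])
qed

lemma killing_field_sum:
  assumes "finite I" "\<And>i. i \<in> I \<Longrightarrow> killing_field M (X i)"
  shows "killing_field M (\<lambda>\<alpha> p. \<Sum>i\<in>I. X i \<alpha> p)"
  using assms
proof (induction I rule: finite_induct)
  case empty
  then show ?case by (simp add: killing_field_zero)
next
  case (insert i I)
  then have "killing_field M (field_add (X i) (\<lambda>\<alpha> p. \<Sum>i\<in>I. X i \<alpha> p))"
    by (intro killing_field_add) auto
  then show ?case using insert.hyps by (simp add: field_add_def)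
qed

end

section \<open>Factors of a product\<close>

text \<open>
  \<open>N\<close> is a factor of \<open>P\<close>: \<open>lab\<close>, \<open>pt\<close> and \<open>L\<close> project labels, points and vectors to \<open>N\<close>; \<open>put_lab\<close> and
  \<open>put_pt\<close> replace the \<open>N\<close>-coordinate of a label or a point; \<open>J\<close> includes vectors of \<open>N\<close> in those of
  \<open>P\<close>. The vectors tangent to the remaining factors form the kernel of \<open>L\<close>. By \<open>metric_J\<close> this kernel is
  orthogonal to the range of \<open>J\<close>, and by \<open>metric_put\<close> the part of the metric that belongs to the
  remaining factors does not depend on the point of \<open>N\<close>.
\<close>

locale product_factor = P: metric_charts P
  for P :: "('p, 'a, 'v::euclidean_space) metric_atlas" +
  fixes N :: "('q::topological_space, 'n, 'w::euclidean_space) metric_atlas"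
    and lab :: "'a \<Rightarrow> 'n" and pt :: "'p \<Rightarrow> 'q" and L :: "'v \<Rightarrow> 'w" and J :: "'w \<Rightarrow> 'v"
    and put_lab :: "'a \<Rightarrow> 'n \<Rightarrow> 'a" and put_pt :: "'p \<Rightarrow> 'q \<Rightarrow> 'p"
  assumes semi_riemannian_factor: "semi_riemannian N"
    and linear_L: "linear L" and linear_J: "linear J" and L_J: "L (J u) = u"
    and L_model: "v \<in> model P \<Longrightarrow> L v \<in> model N" and J_model: "u \<in> model N \<Longrightarrow> J u \<in> model P"
    and lab_in: "a \<in> labels P \<Longrightarrow> lab a \<in> labels N"
    and put_lab_in: "a \<in> labels P \<Longrightarrow> \<alpha> \<in> labels N \<Longrightarrow> put_lab a \<alpha> \<in> labels P"
    and lab_put: "lab (put_lab a \<alpha>) = \<alpha>"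
    and put_lab_lab: "put_lab a (lab a) = a"
    and put_lab_put_lab: "put_lab (put_lab a \<alpha>) \<beta> = put_lab a \<beta>"
    and pt_in: "a \<in> labels P \<Longrightarrow> x \<in> chart_dom P a \<Longrightarrow> pt x \<in> chart_dom N (lab a)"
    and put_pt_in: "a \<in> labels P \<Longrightarrow> x \<in> chart_dom P a \<Longrightarrow> \<alpha> \<in> labels N \<Longrightarrow> p \<in> chart_dom N \<alpha> \<Longrightarrow>
      put_pt x p \<in> chart_dom P (put_lab a \<alpha>)"
    and pt_put: "pt (put_pt x p) = p"
    and put_pt_pt: "put_pt x (pt x) = x"
    and L_chart: "a \<in> labels P \<Longrightarrow> x \<in> chart_dom P a \<Longrightarrow> L (chart P a x) = chart N (lab a) (pt x)"
    and chart_put: "a \<in> labels P \<Longrightarrow> x \<in> chart_dom P a \<Longrightarrow> \<alpha> \<in> labels N \<Longrightarrow> p \<in> chart_dom N \<alpha> \<Longrightarrow>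
      chart P (put_lab a \<alpha>) (put_pt x p) = chart P a x + J (chart N \<alpha> p - L (chart P a x))"
    and metric_J: "a \<in> labels P \<Longrightarrow> x \<in> chart_dom P a \<Longrightarrow> u \<in> model N \<Longrightarrow> v \<in> model P \<Longrightarrow>
      metric P a x (J u) v = metric N (lab a) (pt x) u (L v)"
    and metric_put: "a \<in> labels P \<Longrightarrow> x \<in> chart_dom P a \<Longrightarrow> \<alpha> \<in> labels N \<Longrightarrow> p \<in> chart_dom N \<alpha> \<Longrightarrow>
      v \<in> model P \<Longrightarrow> w \<in> model P \<Longrightarrow>
      metric P (put_lab a \<alpha>) (put_pt x p) v w - metric N \<alpha> p (L v) (L w)
        = metric P a x v w - metric N (lab a) (pt x) (L v) (L w)"
begin

sublocale N: metric_charts N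
  by (rule semi_riemannian_metric_charts[OF semi_riemannian_factor])

lemma bounded_linear_L: "bounded_linear L" using linear_L by (simp add: linear_conv_bounded_linear)
lemma bounded_linear_J: "bounded_linear J" using linear_J by (simp add: linear_conv_bounded_linear)

text \<open>
  In charts the projection \<open>pt\<close> is the linear map \<open>L\<close>, so differentiating a function of the point of \<open>N\<close>
  on \<open>P\<close> reduces to the affine chain rule.
\<close>

lemma pt_chart_inv:
  assumes "a \<in> labels P" "y \<in> chart P a ` chart_dom P a"
  shows "pt (chart_inv P a y) = chart_inv N (lab a) (L y)"
  using assms by (auto simp: L_chart lab_in pt_in)

lemma L_image:
  assumes "a \<in> labels P" "y \<in> chart P a ` chart_dom P a"
  shows "L y \<in> chart N (lab a) ` chart_dom N (lab a)"
  using assms by (auto simp: L_chart pt_in)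

lemma chart_smooth_pt:
  assumes a: "a \<in> labels P" and k: "chart_smooth N (lab a) k"
  shows "chart_smooth P a (\<lambda>x. k (pt x))"
  unfolding chart_smooth_def
proof (rule smooth_on_cong[OF P.open_chart[OF a] P.subspace_model])
  show "smooth_on (model P) (chart P a ` chart_dom P a) (\<lambda>y. k (chart_inv N (lab a) (0 + L y)))"
    by (rule smooth_on_affine[OF linear_L _ k[unfolded chart_smooth_def]]) (simp_all add: L_model L_image[OF a])
qed (simp add: pt_chart_inv[OF a])

lemma chart_deriv_pt:
  assumes a: "a \<in> labels P" and x: "x \<in> chart_dom P a" and u: "u \<in> model P"
  shows "chart_deriv P a (\<lambda>x. k (pt x)) x u = chart_deriv N (lab a) k (pt x) (L u)"
proof -
  have "chart_deriv P a (\<lambda>x. k (pt x)) x u = dir_deriv (\<lambda>y. k (chart_inv N (lab a) (0 + L y))) u (chart P a x)"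
    unfolding chart_deriv_def
    by (rule dir_deriv_cong_on[OF P.open_chart[OF a] P.subspace_model _ u]) (use x in \<open>auto simp: pt_chart_inv[OF a]\<close>)
  also have "\<dots> = dir_deriv (\<lambda>z. k (chart_inv N (lab a) z)) (L u) (0 + L (chart P a x))"
    using dir_deriv_affine[OF linear_L, of "\<lambda>z. k (chart_inv N (lab a) z)" 0 u] by (rule fun_cong)
  finally show ?thesis by (simp add: chart_deriv_def L_chart[OF a x])
qed

text \<open>
  Dually, \<open>q \<mapsto> put_pt x q\<close> is in charts the affine map \<open>z \<mapsto> c + J z\<close>, where \<open>c\<close> depends on \<open>x\<close> and its
  chart but not on the chart of \<open>N\<close>.
\<close>

lemma chart_inv_put:
  assumes "a \<in> labels P" "x \<in> chart_dom P a" "\<alpha> \<in> labels N" "z \<in> chart N \<alpha> ` chart_dom N \<alpha>"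
  shows "chart_inv P (put_lab a \<alpha>) (chart P a x - J (L (chart P a x)) + J z) = put_pt x (chart_inv N \<alpha> z)"
    and "chart P a x - J (L (chart P a x)) + J z \<in> chart P (put_lab a \<alpha>) ` chart_dom P (put_lab a \<alpha>)"
proof -
  obtain p where p: "p \<in> chart_dom N \<alpha>" "z = chart N \<alpha> p" using assms(4) by auto
  have eq: "chart P a x - J (L (chart P a x)) + J z = chart P (put_lab a \<alpha>) (put_pt x p)"
    using chart_put[OF assms(1-3) p(1)] p(2) by (simp add: linear_diff[OF linear_J])
  show "chart_inv P (put_lab a \<alpha>) (chart P a x - J (L (chart P a x)) + J z) = put_pt x (chart_inv N \<alpha> z)"
    unfolding eq using assms p by (simp add: put_lab_in put_pt_in)
  show "chart P a x - J (L (chart P a x)) + J z \<in> chart P (put_lab a \<alpha>) ` chart_dom P (put_lab a \<alpha>)"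
    unfolding eq using assms p by (simp add: put_pt_in)
qed

lemma chart_smooth_slice:
  assumes a: "a \<in> labels P" and x: "x \<in> chart_dom P a" and \<alpha>: "\<alpha> \<in> labels N"
    and Z: "chart_smooth P (put_lab a \<alpha>) Z"
  shows "chart_smooth N \<alpha> (\<lambda>q. Z (put_pt x q))"
  unfolding chart_smooth_def
proof (rule smooth_on_cong[OF N.open_chart[OF \<alpha>] N.subspace_model])
  show "smooth_on (model N) (chart N \<alpha> ` chart_dom N \<alpha>)
      (\<lambda>z. Z (chart_inv P (put_lab a \<alpha>) (chart P a x - J (L (chart P a x)) + J z)))"
    by (rule smooth_on_affine[OF linear_J _ Z[unfolded chart_smooth_def]])
       (simp_all add: J_model chart_inv_put(2)[OF a x \<alpha>])
qed (simp add: chart_inv_put(1)[OF a x \<alpha>])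

lemma chart_deriv_slice:
  assumes a: "a \<in> labels P" and x: "x \<in> chart_dom P a" and \<alpha>: "\<alpha> \<in> labels N"
    and p: "p \<in> chart_dom N \<alpha>" and u: "u \<in> model N"
  shows "chart_deriv N \<alpha> (\<lambda>q. Z (put_pt x q)) p u = chart_deriv P (put_lab a \<alpha>) Z (put_pt x p) (J u)"
proof -
  let ?c = "chart P a x - J (L (chart P a x))"
  let ?f = "\<lambda>y. Z (chart_inv P (put_lab a \<alpha>) y)"
  have "chart_deriv N \<alpha> (\<lambda>q. Z (put_pt x q)) p u = dir_deriv (\<lambda>z. ?f (?c + J z)) u (chart N \<alpha> p)"
    unfolding chart_deriv_def
    by (rule dir_deriv_cong_on[OF N.open_chart[OF \<alpha>] N.subspace_model _ u])
       (use p in \<open>auto simp: chart_inv_put(1)[OF a x \<alpha>]\<close>)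
  also have "\<dots> = dir_deriv ?f (J u) (?c + J (chart N \<alpha> p))"
    using dir_deriv_affine[OF linear_J, of ?f ?c u] by (rule fun_cong)
  also have "?c + J (chart N \<alpha> p) = chart P (put_lab a \<alpha>) (put_pt x p)"
    using chart_put[OF a x \<alpha> p] by (simp add: linear_diff[OF linear_J])
  finally show ?thesis by (simp add: chart_deriv_def)
qed

lemma chart_deriv_incl:
  assumes a: "a \<in> labels P" and x: "x \<in> chart_dom P a" and u: "u \<in> model N"
  shows "chart_deriv P a Z x (J u) = chart_deriv N (lab a) (\<lambda>q. Z (put_pt x q)) (pt x) u"
  using chart_deriv_slice[OF a x lab_in[OF a] pt_in[OF a x] u, of Z] by (simp add: put_lab_lab put_pt_pt)

lemma L_tangent_map:
  assumes a: "a \<in> labels P" and b: "b \<in> labels P" and x: "x \<in> chart_dom P a" "x \<in> chart_dom P b" and u: "u \<in> model P"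
  shows "L (tangent_map P P id a b x u) = tangent_map N N id (lab a) (lab b) (pt x) (L u)"
proof -
  let ?U = "chart P a ` (chart_dom P a \<inter> chart_dom P b)"
  let ?f = "\<lambda>z. chart N (lab b) (chart_inv N (lab a) z)"
  have xU: "chart P a x \<in> ?U" using x by blast
  have "L (tangent_map P P id a b x u) = dir_deriv (\<lambda>y. L (chart P b (chart_inv P a y))) u (chart P a x)"
    unfolding tangent_map_def chart_deriv_def id_def
    by (rule has_dir_deriv_linear[OF bounded_linear_L P.smooth_transition[OF a b] xU u, symmetric])
  also have "\<dots> = dir_deriv (\<lambda>y. ?f (0 + L y)) u (chart P a x)"
    by (rule dir_deriv_cong_on[OF P.open_overlap[OF a b] P.subspace_model xU u])
       (use a b in \<open>auto simp: L_chart lab_in pt_in\<close>)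
  also have "\<dots> = dir_deriv ?f (L u) (0 + L (chart P a x))"
    using dir_deriv_affine[OF linear_L, of ?f 0 u] by (rule fun_cong)
  finally show ?thesis by (simp add: tangent_map_def chart_deriv_def L_chart[OF a x(1)])
qed

lemma tangent_map_J:
  assumes a: "a \<in> labels P" and b: "b \<in> labels P" and x: "x \<in> chart_dom P a" "x \<in> chart_dom P b" and u: "u \<in> model N"
  shows "tangent_map P P id a b x (J u) = J (tangent_map N N id (lab a) (lab b) (pt x) u)"
proof -
  let ?\<alpha> = "lab a" and ?\<beta> = "lab b"
  let ?U = "chart N ?\<alpha> ` (chart_dom N ?\<alpha> \<inter> chart_dom N ?\<beta>)"
  let ?c = "chart P b x - J (L (chart P b x))"
  have pU: "chart N ?\<alpha> (pt x) \<in> ?U" using x a b pt_in by blast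
  have "tangent_map P P id a b x (J u) = chart_deriv N ?\<alpha> (\<lambda>q. chart P b (put_pt x q)) (pt x) u"
    unfolding tangent_map_def id_def by (rule chart_deriv_incl[OF a x(1) u])
  also have "\<dots> = dir_deriv (\<lambda>z. ?c + J (chart N ?\<beta> (chart_inv N ?\<alpha> z))) u (chart N ?\<alpha> (pt x))"
    unfolding chart_deriv_def
  proof (rule dir_deriv_cong_on[OF N.open_overlap[OF lab_in[OF a] lab_in[OF b]] N.subspace_model pU u])
    fix z assume "z \<in> ?U"
    then obtain q where q: "q \<in> chart_dom N ?\<alpha>" "q \<in> chart_dom N ?\<beta>" "z = chart N ?\<alpha> q" by blast
    then show "chart P b (put_pt x (chart_inv N ?\<alpha> z)) = ?c + J (chart N ?\<beta> (chart_inv N ?\<alpha> z))"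
      using chart_put[OF b x(2) lab_in[OF b] q(2)]
      by (simp add: lab_in[OF a] put_lab_lab linear_diff[OF linear_J])
  qed
  also have "\<dots> = 0 + J (tangent_map N N id ?\<alpha> ?\<beta> (pt x) u)"
    unfolding tangent_map_def chart_deriv_def id_def
    by (intro dir_deriv_eqI has_vector_derivative_add has_vector_derivative_const
        bounded_linear.has_vector_derivative[OF bounded_linear_J]
        smooth_on_has_dir_deriv[OF N.smooth_transition[OF lab_in[OF a] lab_in[OF b]] pU u])
  finally show ?thesis by simp
qed

lemma metric_J_right:
  assumes a: "a \<in> labels P" and x: "x \<in> chart_dom P a" and u: "u \<in> model P" and v: "v \<in> model N"
  shows "metric P a x u (J v) = metric N (lab a) (pt x) (L u) v"
  using P.metric_sym[OF a x u J_model[OF v]] metric_J[OF a x v u]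
    N.metric_sym[OF lab_in[OF a] pt_in[OF a x] v L_model[OF u]] by simp

text \<open>
  Along \<open>N\<close> only the metric of \<open>N\<close> varies; the contribution of the remaining factors is the constant \<open>?C\<close>.
\<close>

lemma metric_deriv_J:
  assumes a: "a \<in> labels P" and x: "x \<in> chart_dom P a" and w: "w \<in> model N" and u: "u \<in> model P" and v: "v \<in> model P"
  shows "P.metric_deriv a x (J w) u v = N.metric_deriv (lab a) (pt x) w (L u) (L v)"
proof -
  let ?C = "metric P a x u v - metric N (lab a) (pt x) (L u) (L v)"
  have "P.metric_deriv a x (J w) u v = chart_deriv N (lab a) (\<lambda>q. metric P a (put_pt x q) u v) (pt x) w"
    unfolding P.metric_deriv_def by (rule chart_deriv_incl[OF a x w])
  also have "\<dots> = chart_deriv N (lab a) (\<lambda>q. metric N (lab a) q (L u) (L v) + ?C) (pt x) w"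
    by (rule N.chart_deriv_cong[OF lab_in[OF a] pt_in[OF a x] w])
       (use metric_put[OF a x lab_in[OF a] _ u v] in \<open>simp add: put_lab_lab algebra_simps\<close>)
  also have "\<dots> = N.metric_deriv (lab a) (pt x) w (L u) (L v) + 0"
    unfolding N.metric_deriv_def
    by (rule N.chart_deriv_eqI[OF lab_in[OF a] pt_in[OF a x]])
       (intro has_vector_derivative_add has_vector_derivative_const
         N.chart_has_deriv[OF N.metric_chart_smooth[OF lab_in[OF a] L_model[OF u] L_model[OF v]] pt_in[OF a x] w])
  finally show ?thesis by simp
qed

text \<open>
  A product with a vector tangent to \<open>N\<close> varies only with the point of \<open>N\<close>. For \<open>L v = 0\<close> the right-hand
  side is zero, which is why the mixed part of the Killing equation has no derivative of the metric.
\<close>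

lemma metric_deriv_of_J:
  assumes a: "a \<in> labels P" and x: "x \<in> chart_dom P a" and w: "w \<in> model P" and u: "u \<in> model N" and v: "v \<in> model P"
  shows "P.metric_deriv a x w (J u) v = N.metric_deriv (lab a) (pt x) (L w) u (L v)"
proof -
  have "P.metric_deriv a x w (J u) v = chart_deriv P a (\<lambda>x. metric N (lab a) (pt x) u (L v)) x w"
    unfolding P.metric_deriv_def
    by (rule P.chart_deriv_cong[OF a x w]) (rule metric_J[OF a _ u v])
  also have "\<dots> = N.metric_deriv (lab a) (pt x) (L w) u (L v)"
    unfolding N.metric_deriv_def by (rule chart_deriv_pt[OF a x w])
  finally show ?thesis .
qed

subsection \<open>Pulling back from a factor\<close>

definition pull_back :: "('q, 'n, 'w) field \<Rightarrow> ('p, 'a, 'v) field" where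
  "pull_back Y = (\<lambda>a x. if a \<in> labels P \<and> x \<in> chart_dom P a then J (Y (lab a) (pt x)) else 0)"

lemma pull_back_vector_field:
  assumes Y: "vector_field N Y"
  shows "vector_field P (pull_back Y)"
  unfolding vector_field_def
proof (intro conjI allI impI ballI)
  fix a x assume "\<not> (a \<in> labels P \<and> x \<in> chart_dom P a)"
  then show "pull_back Y a x = 0" unfolding pull_back_def by (rule if_not_P)
next
  fix a x assume "a \<in> labels P" "x \<in> chart_dom P a"
  then show "pull_back Y a x \<in> model P"
    by (simp add: pull_back_def J_model N.field_in_model[OF Y] lab_in pt_in)
next
  fix a b x assume *: "a \<in> labels P" "b \<in> labels P" "x \<in> chart_dom P a \<inter> chart_dom P b"
  have "Y (lab b) (pt x) = tangent_map N N id (lab a) (lab b) (pt x) (Y (lab a) (pt x))"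
    using Y lab_in pt_in * unfolding vector_field_def by blast
  then show "pull_back Y b x = tangent_map P P id a b x (pull_back Y a x)"
    using * tangent_map_J[OF *(1,2) _ _ N.field_in_model[OF Y lab_in[OF *(1)] pt_in[OF *(1)]]]
    by (simp add: pull_back_def)
next
  fix a assume a: "a \<in> labels P"
  have "chart_smooth P a (\<lambda>x. J (Y (lab a) (pt x)))"
    by (rule chart_smooth_pt[OF a, of "\<lambda>q. J (Y (lab a) q)"])
       (rule N.chart_smooth_linear[OF bounded_linear_J lab_in[OF a] N.field_smooth[OF Y lab_in[OF a]]])
  then have "chart_smooth P a (pull_back Y a)"
    by (rule P.chart_smooth_cong[OF a, rotated]) (simp add: pull_back_def a)
  then show "smooth_on (model P) (chart P a ` chart_dom P a) (\<lambda>x. pull_back Y a (chart_inv P a x))"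
    by (simp add: chart_smooth_def)
qed

lemma chart_deriv_pull_back:
  assumes Y: "vector_field N Y" and a: "a \<in> labels P" and x: "x \<in> chart_dom P a" and u: "u \<in> model P"
  shows "chart_deriv P a (pull_back Y a) x u = J (chart_deriv N (lab a) (Y (lab a)) (pt x) (L u))"
proof -
  have "chart_deriv P a (pull_back Y a) x u = chart_deriv P a (\<lambda>x. J (Y (lab a) (pt x))) x u"
    by (rule P.chart_deriv_cong[OF a x u]) (simp add: pull_back_def a)
  also have "\<dots> = chart_deriv N (lab a) (\<lambda>q. J (Y (lab a) q)) (pt x) (L u)"
    by (rule chart_deriv_pt[OF a x u])
  also have "\<dots> = J (chart_deriv N (lab a) (Y (lab a)) (pt x) (L u))"
    by (rule N.chart_deriv_linear[OF bounded_linear_J lab_in[OF a] N.field_smooth[OF Y lab_in[OF a]]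
          pt_in[OF a x] L_model[OF u]])
  finally show ?thesis .
qed

lemma pull_back_killing:
  assumes Y: "killing_field N Y"
  shows "killing_field P (pull_back Y)"
proof -
  have vf: "vector_field N Y" using Y by (simp add: killing_field_def)
  have "P.lie_killing (pull_back Y) a x u v = N.lie_killing Y (lab a) (pt x) (L u) (L v)"
    if a: "a \<in> labels P" and x: "x \<in> chart_dom P a" and u: "u \<in> model P" and v: "v \<in> model P" for a x u v
  proof -
    note \<alpha> = lab_in[OF a] and p = pt_in[OF a x]
    have "pull_back Y a x = J (Y (lab a) (pt x))" by (simp add: pull_back_def a x)
    then show ?thesis
      unfolding P.lie_killing_def N.lie_killing_def
        chart_deriv_pull_back[OF vf a x u] chart_deriv_pull_back[OF vf a x v]
        metric_J[OF a x N.field_deriv_in_model[OF vf \<alpha> p L_model[OF u]] v]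
        metric_J_right[OF a x u N.field_deriv_in_model[OF vf \<alpha> p L_model[OF v]]]
      by (simp add: metric_deriv_J[OF a x N.field_in_model[OF vf \<alpha> p] u v])
  qed
  then show ?thesis
    using Y unfolding P.killing_field_iff[OF pull_back_vector_field[OF vf]] N.killing_field_iff[OF vf]
    by (simp add: lab_in pt_in L_model)
qed

text \<open>
  The bracket of projectable fields is projectable; stated for a single factor, it gives the bracket
  of sums of pull-backs one component at a time.
\<close>

lemma L_field_bracket:
  assumes Z: "vector_field P Z" "vector_field P Z'"
    and Y: "vector_field N Y" "vector_field N Y'"
    and ZY: "\<And>a x. a \<in> labels P \<Longrightarrow> x \<in> chart_dom P a \<Longrightarrow> L (Z a x) = Y (lab a) (pt x)"
    and ZY': "\<And>a x. a \<in> labels P \<Longrightarrow> x \<in> chart_dom P a \<Longrightarrow> L (Z' a x) = Y' (lab a) (pt x)"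
    and a: "a \<in> labels P" and x: "x \<in> chart_dom P a"
  shows "L (field_bracket P Z Z' a x) = field_bracket N Y Y' (lab a) (pt x)"
proof -
  have d: "L (chart_deriv P a (W a) x u) = chart_deriv N (lab a) (V (lab a)) (pt x) (L u)"
    if W: "vector_field P W" and WV: "\<And>a x. a \<in> labels P \<Longrightarrow> x \<in> chart_dom P a \<Longrightarrow> L (W a x) = V (lab a) (pt x)"
      and u: "u \<in> model P" for W V u
  proof -
    have "L (chart_deriv P a (W a) x u) = chart_deriv P a (\<lambda>x. L (W a x)) x u"
      by (rule P.chart_deriv_linear[OF bounded_linear_L a P.field_smooth[OF W a] x u, symmetric])
    also have "\<dots> = chart_deriv P a (\<lambda>x. V (lab a) (pt x)) x u"
      by (rule P.chart_deriv_cong[OF a x u]) (rule WV[OF a])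
    finally show ?thesis by (simp add: chart_deriv_pt[OF a x u])
  qed
  show ?thesis
    using d[OF Z(2) ZY' P.field_in_model[OF Z(1) a x]] d[OF Z(1) ZY P.field_in_model[OF Z(2) a x]]
      ZY[OF a x] ZY'[OF a x] lab_in[OF a] pt_in[OF a x] a x
    by (simp add: field_bracket_def linear_diff[OF linear_L])
qed

subsection \<open>Slices\<close>

text \<open>
  The component of \<open>X\<close> tangent to \<open>N\<close>, restricted to the copy of \<open>N\<close> through the point \<open>x\<close>. The label \<open>a\<close>
  fixes the charts used on the remaining factors.
\<close>

definition slice :: "('p, 'a, 'v) field \<Rightarrow> 'a \<Rightarrow> 'p \<Rightarrow> ('q, 'n, 'w) field" where
  "slice X a x = (\<lambda>\<alpha> p. if \<alpha> \<in> labels N \<and> p \<in> chart_dom N \<alpha> then L (X (put_lab a \<alpha>) (put_pt x p)) else 0)"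

context
  fixes X a x
  assumes X: "vector_field P X" and a: "a \<in> labels P" and x: "x \<in> chart_dom P a"
begin

lemma slice_smooth:
  assumes \<alpha>: "\<alpha> \<in> labels N"
  shows "chart_smooth N \<alpha> (slice X a x \<alpha>)"
proof -
  have "chart_smooth N \<alpha> (\<lambda>p. L (X (put_lab a \<alpha>) (put_pt x p)))"
    by (rule N.chart_smooth_linear[OF bounded_linear_L \<alpha>])
       (rule chart_smooth_slice[OF a x \<alpha> P.field_smooth[OF X put_lab_in[OF a \<alpha>]]])
  then show ?thesis
    by (rule N.chart_smooth_cong[OF \<alpha>, rotated]) (simp add: slice_def \<alpha>)
qed

lemma slice_deriv:
  assumes \<alpha>: "\<alpha> \<in> labels N" and p: "p \<in> chart_dom N \<alpha>" and u: "u \<in> model N"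
  shows "chart_deriv N \<alpha> (slice X a x \<alpha>) p u
    = L (chart_deriv P (put_lab a \<alpha>) (X (put_lab a \<alpha>)) (put_pt x p) (J u))"
proof -
  have "chart_deriv N \<alpha> (slice X a x \<alpha>) p u = chart_deriv N \<alpha> (\<lambda>p. L (X (put_lab a \<alpha>) (put_pt x p))) p u"
    by (rule N.chart_deriv_cong[OF \<alpha> p u]) (simp add: slice_def \<alpha>)
  also have "\<dots> = L (chart_deriv N \<alpha> (\<lambda>p. X (put_lab a \<alpha>) (put_pt x p)) p u)"
    by (rule N.chart_deriv_linear[OF bounded_linear_L \<alpha> _ p u])
       (rule chart_smooth_slice[OF a x \<alpha> P.field_smooth[OF X put_lab_in[OF a \<alpha>]]])
  finally show ?thesis by (simp add: chart_deriv_slice[OF a x \<alpha> p u])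
qed

lemma slice_transition:
  assumes "\<alpha> \<in> labels N" "\<beta> \<in> labels N" "p \<in> chart_dom N \<alpha>" "p \<in> chart_dom N \<beta>"
  shows "slice X a x \<beta> p = tangent_map N N id \<alpha> \<beta> p (slice X a x \<alpha> p)"
proof -
  let ?a = "put_lab a \<alpha>" and ?b = "put_lab a \<beta>" and ?x = "put_pt x p"
  note in' = put_lab_in[OF a assms(1)] put_lab_in[OF a assms(2)] put_pt_in[OF a x assms(1,3)] put_pt_in[OF a x assms(2,4)]
  have "X ?b ?x = tangent_map P P id ?a ?b ?x (X ?a ?x)"
    using X in' unfolding vector_field_def by blast
  then have "L (X ?b ?x) = tangent_map N N id \<alpha> \<beta> p (L (X ?a ?x))"
    using L_tangent_map[OF in' P.field_in_model[OF X in'(1,3)]] by (simp add: lab_put pt_put)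
  then show ?thesis using assms by (simp add: slice_def)
qed

lemma slice_in_model:
  assumes "\<alpha> \<in> labels N" "p \<in> chart_dom N \<alpha>"
  shows "slice X a x \<alpha> p \<in> model N"
  using L_model[OF P.field_in_model[OF X put_lab_in[OF a assms(1)] put_pt_in[OF a x assms]]] assms
  by (simp add: slice_def)

lemma slice_vector_field: "vector_field N (slice X a x)"
  unfolding vector_field_def
proof (intro conjI allI impI ballI)
  fix \<alpha> p assume "\<not> (\<alpha> \<in> labels N \<and> p \<in> chart_dom N \<alpha>)"
  then show "slice X a x \<alpha> p = 0" unfolding slice_def by (rule if_not_P)
next
  fix \<alpha> assume "\<alpha> \<in> labels N"
  then show "smooth_on (model N) (chart N \<alpha> ` chart_dom N \<alpha>) (\<lambda>y. slice X a x \<alpha> (chart_inv N \<alpha> y))"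
    using slice_smooth by (simp add: chart_smooth_def)
qed (auto intro: slice_in_model slice_transition)

lemma slice_lie_killing:
  assumes \<alpha>: "\<alpha> \<in> labels N" and p: "p \<in> chart_dom N \<alpha>" and u: "u \<in> model N" and v: "v \<in> model N"
  shows "N.lie_killing (slice X a x) \<alpha> p u v = P.lie_killing X (put_lab a \<alpha>) (put_pt x p) (J u) (J v)"
proof -
  note a' = put_lab_in[OF a \<alpha>] and x' = put_pt_in[OF a x \<alpha> p]
  note D = P.field_deriv_in_model[OF X a' x' J_model]
  show ?thesis
    unfolding N.lie_killing_def P.lie_killing_def slice_deriv[OF \<alpha> p u] slice_deriv[OF \<alpha> p v]
      metric_J[OF a' x' u D[OF v]] metric_J_right[OF a' x' D[OF u] v]
      metric_deriv_of_J[OF a' x' P.field_in_model[OF X a' x'] u J_model[OF v]]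
    by (simp add: lab_put pt_put L_J slice_def \<alpha> p)
qed

end

lemma slice_killing:
  assumes X: "killing_field P X" and a: "a \<in> labels P" and x: "x \<in> chart_dom P a"
  shows "killing_field N (slice X a x)"
proof -
  have vf: "vector_field P X" using X by (simp add: killing_field_def)
  show ?thesis
    unfolding N.killing_field_iff[OF slice_vector_field[OF vf a x]]
    using X[unfolded P.killing_field_iff[OF vf]] slice_lie_killing[OF vf a x]
    by (simp add: put_lab_in[OF a] put_pt_in[OF a x] J_model)
qed

end

context product_factor
begin

subsection \<open>Derivatives transverse to a factor\<close>

text \<open>
  The field \<open>K = \<partial>\<^sub>w A\<close> on the slice through \<open>x\<close>, for \<open>L w = 0\<close>.
\<close>

definition transverse :: "('p, 'a, 'v) field \<Rightarrow> 'a \<Rightarrow> 'p \<Rightarrow> 'v \<Rightarrow> ('q, 'n, 'w) field" where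
  "transverse X a x w = (\<lambda>\<alpha> p. if \<alpha> \<in> labels N \<and> p \<in> chart_dom N \<alpha>
     then L (chart_deriv P (put_lab a \<alpha>) (X (put_lab a \<alpha>)) (put_pt x p) w) else 0)"

context
  fixes X a x w
  assumes X: "vector_field P X" and a: "a \<in> labels P" and x: "x \<in> chart_dom P a"
    and w: "w \<in> model P" and Lw: "L w = 0"
begin

text \<open>
  The base point moved by \<open>t w\<close> in the chart \<open>a\<close>. Since \<open>L w = 0\<close>, this moves the whole slice parallel to
  itself, so \<open>K\<close> is the derivative at \<open>0\<close> of the slices of \<open>X\<close> through \<open>slide t\<close>. Identities that are linear
  in a slice are inherited by \<open>K\<close>.
\<close>

definition slide :: "real \<Rightarrow> 'p" where "slide t = chart_inv P a (chart P a x + t *\<^sub>R w)"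

lemma slide_dom:
  assumes "chart P a x + t *\<^sub>R w \<in> chart P a ` chart_dom P a"
  shows "slide t \<in> chart_dom P a" and "chart P a (slide t) = chart P a x + t *\<^sub>R w"
proof -
  obtain y where y: "y \<in> chart_dom P a" "chart P a x + t *\<^sub>R w = chart P a y" using assms by auto
  have "slide t = y" unfolding slide_def y(2) by (rule P.chart_inv_chart[OF a y(1)])
  then show "slide t \<in> chart_dom P a" "chart P a (slide t) = chart P a x + t *\<^sub>R w" using y by simp_all
qed

lemma eventually_slide_dom: "eventually (\<lambda>t. slide t \<in> chart_dom P a) (nhds 0)"
  using P.chart_line[OF a x w] by eventually_elim (rule slide_dom)

lemma eventually_slide_put:
  assumes \<alpha>: "\<alpha> \<in> labels N" and p: "p \<in> chart_dom N \<alpha>"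
  shows "eventually (\<lambda>t. chart_inv P (put_lab a \<alpha>) (chart P (put_lab a \<alpha>) (put_pt x p) + t *\<^sub>R w)
    = put_pt (slide t) p) (nhds 0)"
  using P.chart_line[OF a x w]
proof eventually_elim
  fix t assume "chart P a x + t *\<^sub>R w \<in> chart P a ` chart_dom P a"
  note s = slide_dom[OF this]
  have "L (chart P a x + t *\<^sub>R w) = L (chart P a x)"
    by (simp add: linear_add[OF linear_L] linear_scale[OF linear_L] Lw)
  then have "chart P (put_lab a \<alpha>) (put_pt x p) + t *\<^sub>R w = chart P (put_lab a \<alpha>) (put_pt (slide t) p)"
    by (simp add: chart_put[OF a x \<alpha> p] chart_put[OF a s(1) \<alpha> p] s(2))
  then show "chart_inv P (put_lab a \<alpha>) (chart P (put_lab a \<alpha>) (put_pt x p) + t *\<^sub>R w) = put_pt (slide t) p"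
    using put_lab_in[OF a \<alpha>] put_pt_in[OF a s(1) \<alpha> p] by simp
qed

lemma has_derivative_along_slide:
  assumes \<alpha>: "\<alpha> \<in> labels N" and p: "p \<in> chart_dom N \<alpha>" and Z: "chart_smooth P (put_lab a \<alpha>) Z"
  shows "((\<lambda>t. Z (put_pt (slide t) p)) has_vector_derivative chart_deriv P (put_lab a \<alpha>) Z (put_pt x p) w) (at 0)"
proof -
  let ?c = "\<lambda>t. chart_inv P (put_lab a \<alpha>) (chart P (put_lab a \<alpha>) (put_pt x p) + t *\<^sub>R w)"
  note ev = eventually_slide_put[OF \<alpha> p]
  have "((\<lambda>t. Z (?c t)) has_vector_derivative chart_deriv P (put_lab a \<alpha>) Z (put_pt x p) w) (at 0)"
    by (rule P.chart_has_deriv[OF Z put_pt_in[OF a x \<alpha> p] w])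
  then show ?thesis
    by (rule has_vector_derivative_eventually_eq) (rule eventually_mono[OF ev], simp)
qed

lemma transverse_eq:
  assumes "\<alpha> \<in> labels N" "p \<in> chart_dom N \<alpha>"
  shows "transverse X a x w \<alpha> p = L (chart_deriv P (put_lab a \<alpha>) (X (put_lab a \<alpha>)) (put_pt x p) w)"
  using assms by (simp add: transverse_def)

lemma transverse_in_model:
  assumes "\<alpha> \<in> labels N" "p \<in> chart_dom N \<alpha>"
  shows "transverse X a x w \<alpha> p \<in> model N"
  unfolding transverse_eq[OF assms]
  by (rule L_model[OF P.field_deriv_in_model[OF X put_lab_in[OF a assms(1)] put_pt_in[OF a x assms] w]])

lemma slice_has_derivative_along_slide:
  assumes \<alpha>: "\<alpha> \<in> labels N" and p: "p \<in> chart_dom N \<alpha>"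
  shows "((\<lambda>t. slice X a (slide t) \<alpha> p) has_vector_derivative transverse X a x w \<alpha> p) (at 0)"
proof -
  have "((\<lambda>t. L (X (put_lab a \<alpha>) (put_pt (slide t) p))) has_vector_derivative transverse X a x w \<alpha> p) (at 0)"
    unfolding transverse_eq[OF \<alpha> p]
    by (rule bounded_linear.has_vector_derivative[OF bounded_linear_L
          has_derivative_along_slide[OF \<alpha> p P.field_smooth[OF X put_lab_in[OF a \<alpha>]]]])
  then show ?thesis by (simp add: slice_def \<alpha> p)
qed

lemma transverse_smooth:
  assumes \<alpha>: "\<alpha> \<in> labels N"
  shows "chart_smooth N \<alpha> (transverse X a x w \<alpha>)"
proof -
  note a' = put_lab_in[OF a \<alpha>]
  have "chart_smooth N \<alpha> (\<lambda>p. L (chart_deriv P (put_lab a \<alpha>) (X (put_lab a \<alpha>)) (put_pt x p) w))"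
    by (rule N.chart_smooth_linear[OF bounded_linear_L \<alpha>])
       (rule chart_smooth_slice[OF a x \<alpha> P.chart_smooth_deriv[OF a' P.field_smooth[OF X a'] w]])
  then show ?thesis
    by (rule N.chart_smooth_cong[OF \<alpha>, rotated]) (simp add: transverse_eq[OF \<alpha>])
qed

text \<open>
  The change of coordinates on \<open>N\<close> is the same linear map for all the slices, so it commutes with the
  derivative in \<open>t\<close>.
\<close>

lemma transverse_vector_field: "vector_field N (transverse X a x w)"
  unfolding vector_field_def
proof (intro conjI allI impI ballI)
  fix \<alpha> p assume "\<not> (\<alpha> \<in> labels N \<and> p \<in> chart_dom N \<alpha>)"
  then show "transverse X a x w \<alpha> p = 0" unfolding transverse_def by (rule if_not_P)
next
  fix \<alpha> assume "\<alpha> \<in> labels N"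
  then show "smooth_on (model N) (chart N \<alpha> ` chart_dom N \<alpha>) (\<lambda>y. transverse X a x w \<alpha> (chart_inv N \<alpha> y))"
    using transverse_smooth by (simp add: chart_smooth_def)
next
  fix \<alpha> p assume "\<alpha> \<in> labels N" "p \<in> chart_dom N \<alpha>"
  then show "transverse X a x w \<alpha> p \<in> model N" by (rule transverse_in_model)
next
  fix \<alpha> \<beta> p assume *: "\<alpha> \<in> labels N" "\<beta> \<in> labels N" "p \<in> chart_dom N \<alpha> \<inter> chart_dom N \<beta>"
  then have p: "p \<in> chart_dom N \<alpha>" "p \<in> chart_dom N \<beta>" by auto
  let ?T = "tangent_map N N id \<alpha> \<beta> p"
  have "((\<lambda>t. ?T (slice X a (slide t) \<alpha> p)) has_vector_derivative ?T (transverse X a x w \<alpha> p)) (at 0)"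
    by (rule linear_on_sub_has_vector_derivative[OF N.subspace_model N.tangent_map_linear[OF *(1,2) p]
          slice_has_derivative_along_slide[OF *(1) p(1)] transverse_in_model[OF *(1) p(1)]])
       (use eventually_slide_dom in eventually_elim, rule slice_in_model[OF X a _ *(1) p(1)])
  moreover have "((\<lambda>t. ?T (slice X a (slide t) \<alpha> p)) has_vector_derivative transverse X a x w \<beta> p) (at 0)"
  proof -
    have ev: "eventually (\<lambda>t. slice X a (slide t) \<beta> p = ?T (slice X a (slide t) \<alpha> p)) (nhds 0)"
      using eventually_slide_dom by eventually_elim (rule slice_transition[OF X a _ *(1,2) p])
    show ?thesis
      using slice_has_derivative_along_slide[OF *(2) p(2)]
      by (rule has_vector_derivative_eventually_eq) (rule ev)
  qed
  ultimately show "transverse X a x w \<beta> p = ?T (transverse X a x w \<alpha> p)"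
    by (rule vector_derivative_unique_at[symmetric])
qed

text \<open>
  Derivatives along \<open>N\<close> and along \<open>w\<close> commute.
\<close>

lemma transverse_deriv:
  assumes \<alpha>: "\<alpha> \<in> labels N" and p: "p \<in> chart_dom N \<alpha>" and u: "u \<in> model N"
  shows "((\<lambda>t. chart_deriv N \<alpha> (slice X a (slide t) \<alpha>) p u) has_vector_derivative
    chart_deriv N \<alpha> (transverse X a x w \<alpha>) p u) (at 0)"
proof -
  let ?a = "put_lab a \<alpha>"
  note a' = put_lab_in[OF a \<alpha>] and x' = put_pt_in[OF a x \<alpha> p]
  note sm = P.field_smooth[OF X a']
  have "chart_deriv N \<alpha> (transverse X a x w \<alpha>) p u
      = chart_deriv N \<alpha> (\<lambda>p. L (chart_deriv P ?a (X ?a) (put_pt x p) w)) p u"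
    by (rule N.chart_deriv_cong[OF \<alpha> p u]) (rule transverse_eq[OF \<alpha>])
  also have "\<dots> = chart_deriv P ?a (\<lambda>y. L (chart_deriv P ?a (X ?a) y w)) (put_pt x p) (J u)"
    by (rule chart_deriv_slice[OF a x \<alpha> p u])
  also have "\<dots> = L (chart_deriv P ?a (\<lambda>y. chart_deriv P ?a (X ?a) y w) (put_pt x p) (J u))"
    by (rule P.chart_deriv_linear[OF bounded_linear_L a' P.chart_smooth_deriv[OF a' sm w] x' J_model[OF u]])
  also have "\<dots> = L (chart_deriv P ?a (\<lambda>y. chart_deriv P ?a (X ?a) y (J u)) (put_pt x p) w)"
    by (simp only: P.chart_deriv_commute[OF a' sm x' w J_model[OF u]])
  finally have eq: "chart_deriv N \<alpha> (transverse X a x w \<alpha>) p u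
      = L (chart_deriv P ?a (\<lambda>y. chart_deriv P ?a (X ?a) y (J u)) (put_pt x p) w)" .
  have der: "((\<lambda>t. L (chart_deriv P ?a (X ?a) (put_pt (slide t) p) (J u))) has_vector_derivative
      chart_deriv N \<alpha> (transverse X a x w \<alpha>) p u) (at 0)"
    unfolding eq
    by (rule bounded_linear.has_vector_derivative[OF bounded_linear_L
          has_derivative_along_slide[OF \<alpha> p P.chart_smooth_deriv[OF a' sm J_model[OF u]]]])
  have ev: "eventually (\<lambda>t. L (chart_deriv P ?a (X ?a) (put_pt (slide t) p) (J u))
      = chart_deriv N \<alpha> (slice X a (slide t) \<alpha>) p u) (nhds 0)"
    using eventually_slide_dom by eventually_elim (rule slice_deriv[OF X a _ \<alpha> p u, symmetric])
  from der show ?thesis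
    by (rule has_vector_derivative_eventually_eq) (rule ev)
qed

text \<open>
  The Killing equations of the slices, differentiated at \<open>t = 0\<close>.
\<close>

lemma transverse_lie_killing:
  assumes K: "killing_field P X" and \<alpha>: "\<alpha> \<in> labels N" and p: "p \<in> chart_dom N \<alpha>"
    and u: "u \<in> model N" and v: "v \<in> model N"
  shows "N.lie_killing (transverse X a x w) \<alpha> p u v = 0"
proof -
  let ?s = "\<lambda>t. slice X a (slide t)"
  note vf = transverse_vector_field
  have in1: "eventually (\<lambda>t. ?s t \<alpha> p \<in> model N) (nhds 0)"
    using eventually_slide_dom by eventually_elim (rule slice_in_model[OF X a _ \<alpha> p])
  have in2: "eventually (\<lambda>t. chart_deriv N \<alpha> (?s t \<alpha>) p z \<in> model N) (nhds 0)" if "z \<in> model N" for z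
    using eventually_slide_dom
    by eventually_elim (rule N.field_deriv_in_model[OF slice_vector_field[OF X a _] \<alpha> p that])
  have "((\<lambda>t. N.lie_killing (?s t) \<alpha> p u v) has_vector_derivative N.lie_killing (transverse X a x w) \<alpha> p u v) (at 0)"
    unfolding N.lie_killing_def
    by (intro has_vector_derivative_add
        linear_on_sub_has_vector_derivative[OF N.subspace_model N.metric_deriv_linear_dir[OF \<alpha> p u v]
          slice_has_derivative_along_slide[OF \<alpha> p] transverse_in_model[OF \<alpha> p] in1]
        linear_on_sub_has_vector_derivative[OF N.subspace_model N.metric_linear_left[OF \<alpha> p v]
          transverse_deriv[OF \<alpha> p u] N.field_deriv_in_model[OF vf \<alpha> p u] in2[OF u]]
        linear_on_sub_has_vector_derivative[OF N.subspace_model N.metric_linear_right[OF \<alpha> p u]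
          transverse_deriv[OF \<alpha> p v] N.field_deriv_in_model[OF vf \<alpha> p v] in2[OF v]])
  moreover have "((\<lambda>t. N.lie_killing (?s t) \<alpha> p u v) has_vector_derivative 0) (at 0)"
  proof -
    have ev: "eventually (\<lambda>t. 0 = N.lie_killing (?s t) \<alpha> p u v) (nhds 0)"
      using eventually_slide_dom
    proof eventually_elim
      fix t assume t: "slide t \<in> chart_dom P a"
      show "0 = N.lie_killing (?s t) \<alpha> p u v"
        using slice_killing[OF K a t] \<alpha> p u v
        unfolding N.killing_field_iff[OF slice_vector_field[OF X a t]] by simp
    qed
    have "((\<lambda>t. 0::real) has_vector_derivative 0) (at (0::real))" by simp
    then show ?thesis
      by (rule has_vector_derivative_eventually_eq) (rule ev)
  qed
  ultimately show ?thesis by (rule vector_derivative_unique_at)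
qed

text \<open>
  By the mixed part of the Killing equation, \<open>g\<^sub>N(z, K)\<close> is the derivative along \<open>z\<close> of the function
  \<open>- g(X, w)\<close>, and second derivatives commute.
\<close>

lemma transverse_closed:
  assumes K: "killing_field P X" and \<alpha>: "\<alpha> \<in> labels N" and p: "p \<in> chart_dom N \<alpha>"
    and u: "u \<in> model N" and v: "v \<in> model N"
  shows "chart_deriv N \<alpha> (\<lambda>q. metric N \<alpha> q v (transverse X a x w \<alpha> q)) p u
    = chart_deriv N \<alpha> (\<lambda>q. metric N \<alpha> q u (transverse X a x w \<alpha> q)) p v"
proof -
  let ?a = "put_lab a \<alpha>"
  note a' = put_lab_in[OF a \<alpha>]
  \<comment> \<open>\<open>G = g(_, w)\<close> is evaluated at the fixed point \<open>x\<close>; along the slice it is the same functional.\<close>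
  obtain G where G: "bounded_linear G" "\<And>z. z \<in> model P \<Longrightarrow> G z = metric P a x z w"
    using linear_on_sub_extends[OF P.subspace_model P.metric_linear_left[OF a x w]] by metis
  define \<phi> where "\<phi> q = G (X ?a (put_pt x q))" for q
  have \<phi>: "chart_smooth N \<alpha> \<phi>"
    unfolding \<phi>_def
    by (rule N.chart_smooth_linear[OF G(1) \<alpha> chart_smooth_slice[OF a x \<alpha> P.field_smooth[OF X a']]])
  have grad: "metric N \<alpha> q z (transverse X a x w \<alpha> q) = - chart_deriv N \<alpha> \<phi> q z"
    if q: "q \<in> chart_dom N \<alpha>" and z: "z \<in> model N" for q z
  proof -
    let ?y = "put_pt x q"
    note y = put_pt_in[OF a x \<alpha> q]
    note Dz = P.field_deriv_in_model[OF X a' y J_model[OF z]] and Dw = P.field_deriv_in_model[OF X a' y w]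
    have zero: "N.metric_deriv \<alpha> q z' z (0::'w) = 0" if "z' \<in> model N" for z'
      by (rule N.zero_of_linear[OF N.metric_deriv_linear_right[OF \<alpha> q that z]])
    have "0 = P.lie_killing X ?a ?y (J z) w"
      using K a' y J_model[OF z] w unfolding P.killing_field_iff[OF X] by simp
    also have "\<dots> = metric P ?a ?y (chart_deriv P ?a (X ?a) ?y (J z)) w + metric N \<alpha> q z (transverse X a x w \<alpha> q)"
      unfolding P.lie_killing_def metric_deriv_of_J[OF a' y P.field_in_model[OF X a' y] z w]
        metric_J[OF a' y z Dw] Lw transverse_eq[OF \<alpha> q]
      by (simp add: lab_put pt_put zero[OF L_model[OF P.field_in_model[OF X a' y]]])
    also have "metric P ?a ?y (chart_deriv P ?a (X ?a) ?y (J z)) w = metric P a x (chart_deriv P ?a (X ?a) ?y (J z)) w"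
      using metric_put[OF a x \<alpha> q Dz w]
        N.zero_of_linear[OF N.metric_linear_right[OF \<alpha> q L_model[OF Dz]]]
        N.zero_of_linear[OF N.metric_linear_right[OF lab_in[OF a] pt_in[OF a x] L_model[OF Dz]]]
      by (simp add: Lw)
    also have "\<dots> = G (chart_deriv P ?a (X ?a) ?y (J z))"
      by (rule G(2)[OF Dz, symmetric])
    also have "\<dots> = G (chart_deriv N \<alpha> (\<lambda>q. X ?a (put_pt x q)) q z)"
      by (simp only: chart_deriv_slice[OF a x \<alpha> q z])
    also have "\<dots> = chart_deriv N \<alpha> \<phi> q z"
      unfolding \<phi>_def
      by (rule N.chart_deriv_linear[OF G(1) \<alpha> chart_smooth_slice[OF a x \<alpha> P.field_smooth[OF X a']] q z, symmetric])
    finally show ?thesis by simp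
  qed
  have d: "chart_deriv N \<alpha> (\<lambda>q. metric N \<alpha> q z (transverse X a x w \<alpha> q)) p y
      = - chart_deriv N \<alpha> (\<lambda>q. chart_deriv N \<alpha> \<phi> q z) p y" if "y \<in> model N" "z \<in> model N" for y z
  proof -
    have "chart_deriv N \<alpha> (\<lambda>q. metric N \<alpha> q z (transverse X a x w \<alpha> q)) p y
        = chart_deriv N \<alpha> (\<lambda>q. - chart_deriv N \<alpha> \<phi> q z) p y"
      by (rule N.chart_deriv_cong[OF \<alpha> p that(1)]) (rule grad[OF _ that(2)])
    also have "\<dots> = - chart_deriv N \<alpha> (\<lambda>q. chart_deriv N \<alpha> \<phi> q z) p y"
      by (rule N.chart_deriv_linear[OF bounded_linear_minus[OF bounded_linear_ident] \<alpha>
            N.chart_smooth_deriv[OF \<alpha> \<phi> that(2)] p that(1)])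
    finally show ?thesis .
  qed
  show ?thesis using d[OF u v] d[OF v u] N.chart_deriv_commute[OF \<alpha> \<phi> p u v] by simp
qed

lemma transverse_parallel:
  assumes K: "killing_field P X"
  shows "parallel_field N (transverse X a x w)"
proof (rule N.killing_gradient_parallel[OF transverse_vector_field])
  fix \<alpha> p u v assume *: "\<alpha> \<in> labels N" "p \<in> chart_dom N \<alpha>" "u \<in> model N" "v \<in> model N"
  show "N.lie_killing (transverse X a x w) \<alpha> p u v = 0" by (rule transverse_lie_killing[OF K *])
  show "chart_deriv N \<alpha> (\<lambda>q. metric N \<alpha> q v (transverse X a x w \<alpha> q)) p u
    = chart_deriv N \<alpha> (\<lambda>q. metric N \<alpha> q u (transverse X a x w \<alpha> q)) p v"
    by (rule transverse_closed[OF K *])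
qed

end

lemma transverse_deriv_zero:
  assumes noparallel: "\<not> admits_nonzero_parallel_field N"
    and K: "killing_field P X" and a: "a \<in> labels P" and x: "x \<in> chart_dom P a"
    and w: "w \<in> model P" and Lw: "L w = 0"
  shows "L (chart_deriv P a (X a) x w) = 0"
proof -
  have X: "vector_field P X" using K by (simp add: killing_field_def)
  have "transverse X a x w = (\<lambda>_ _. 0)"
    using noparallel transverse_parallel[OF X a x w Lw K] unfolding admits_nonzero_parallel_field_def by blast
  then have "transverse X a x w (lab a) (pt x) = 0" by simp
  then show ?thesis
    using a x by (simp add: transverse_def lab_in pt_in put_lab_lab put_pt_pt)
qed

text \<open>
  With \<open>\<partial>\<^sub>w A = 0\<close> only the other term of the mixed equation is left.
\<close>

lemma rest_deriv_zero:
  assumes noparallel: "\<not> admits_nonzero_parallel_field N"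
    and K: "killing_field P X" and a: "a \<in> labels P" and x: "x \<in> chart_dom P a"
    and w: "w \<in> model P" and Lw: "L w = 0" and u: "u \<in> model N"
  shows "metric P a x (chart_deriv P a (X a) x (J u)) w = 0"
proof -
  have X: "vector_field P X" using K by (simp add: killing_field_def)
  note \<alpha> = lab_in[OF a] and p = pt_in[OF a x]
  have "0 = P.lie_killing X a x (J u) w"
    using K a x J_model[OF u] w unfolding P.killing_field_iff[OF X] by simp
  also have "\<dots> = metric P a x (chart_deriv P a (X a) x (J u)) w"
    unfolding P.lie_killing_def metric_deriv_of_J[OF a x P.field_in_model[OF X a x] u w]
      metric_J[OF a x u P.field_deriv_in_model[OF X a x w]] Lw transverse_deriv_zero[OF noparallel K a x w Lw]
    using N.zero_of_linear[OF N.metric_deriv_linear_right[OF \<alpha> p L_model[OF P.field_in_model[OF X a x]] u]]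
      N.zero_of_linear[OF N.metric_linear_right[OF \<alpha> p u]] by simp
  finally show ?thesis by simp
qed

end

text \<open>
  Absence of nonzero parallel fields on one of two factors decouples both components: the first claim is the
  vanishing of \<open>K\<close> on \<open>N\<close>, the second follows from it by nondegeneracy of the metric of \<open>N'\<close>.
\<close>

lemma cross_derivatives_zero:
  assumes F: "product_factor P N lab pt L J put_lab put_pt"
    and F': "product_factor P N' lab' pt' L' J' put_lab' put_pt'"
    and LJ: "\<And>u. L (J' u) = 0"
    and noparallel: "\<not> admits_nonzero_parallel_field N"
    and K: "killing_field P X" and a: "a \<in> labels P" and x: "x \<in> chart_dom P a"
  shows "v \<in> model N' \<Longrightarrow> L (chart_deriv P a (X a) x (J' v)) = 0"
    and "u \<in> model N \<Longrightarrow> L' (chart_deriv P a (X a) x (J u)) = 0"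
proof -
  interpret F: product_factor P N lab pt L J put_lab put_pt by fact
  interpret F': product_factor P N' lab' pt' L' J' put_lab' put_pt' by fact
  have X: "vector_field P X" using K by (simp add: killing_field_def)
  show "L (chart_deriv P a (X a) x (J' v)) = 0" if v: "v \<in> model N'"
    by (rule F.transverse_deriv_zero[OF noparallel K a x F'.J_model[OF v] LJ])
  assume u: "u \<in> model N"
  note D = F.P.field_deriv_in_model[OF X a x F.J_model[OF u]]
  show "L' (chart_deriv P a (X a) x (J u)) = 0"
  proof (rule F'.N.metric_nondegenerate[OF F'.lab_in[OF a] F'.pt_in[OF a x] F'.L_model[OF D]])
    fix v assume v: "v \<in> model N'"
    show "metric N' (lab' a) (pt' x) (L' (chart_deriv P a (X a) x (J u))) v = 0"
      using F.rest_deriv_zero[OF noparallel K a x F'.J_model[OF v] LJ u] F'.metric_J_right[OF a x D v] by simp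
  qed
qed

context product_factor
begin

subsection \<open>Constancy along a factor\<close>

text \<open>
  A function with zero derivative along \<open>N\<close> is locally constant in every chart of \<open>N\<close>, and \<open>N\<close> is
  connected. The function may depend on the label as well; it is only required that the part of the
  label that belongs to \<open>N\<close> does not matter.
\<close>

lemma constant_along_factor:
  assumes smooth: "\<And>a. a \<in> labels P \<Longrightarrow> chart_smooth P a (F a)"
    and label: "\<And>a b x. a \<in> labels P \<Longrightarrow> b \<in> labels P \<Longrightarrow> x \<in> chart_dom P a \<Longrightarrow> x \<in> chart_dom P b \<Longrightarrow>
      (\<exists>\<beta>. b = put_lab a \<beta>) \<Longrightarrow> F a x = F b x"
    and deriv: "\<And>a x u. a \<in> labels P \<Longrightarrow> x \<in> chart_dom P a \<Longrightarrow> u \<in> model N \<Longrightarrow> chart_deriv P a (F a) x (J u) = 0"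
    and a: "a \<in> labels P" and x: "x \<in> chart_dom P a" and \<beta>: "\<beta> \<in> labels N" and q: "q \<in> chart_dom N \<beta>"
  shows "F (put_lab a \<beta>) (put_pt x q) = F a x"
proof -
  note S = semi_riemannian_factor[unfolded semi_riemannian_def smooth_manifold_def]
  have conn: "connected (points N)" using S by (elim conjE)
  have cover: "(\<Union>\<alpha>\<in>labels N. chart_dom N \<alpha>) = points N" using S by (elim conjE)
  have charts: "\<forall>\<alpha>\<in>labels N. openin (top_of_set (points N)) (chart_dom N \<alpha>) \<and>
        openin (top_of_set (model N)) (chart N \<alpha> ` chart_dom N \<alpha>) \<and>
        homeomorphism (chart_dom N \<alpha>) (chart N \<alpha> ` chart_dom N \<alpha>) (chart N \<alpha>) (chart_inv N \<alpha>)"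
    using S by (elim conjE)
  \<comment> \<open>An arbitrary chart at every point of \<open>N\<close> makes \<open>F\<close> a function of the point alone.\<close>
  define lb where "lb p = (SOME \<alpha>. \<alpha> \<in> labels N \<and> p \<in> chart_dom N \<alpha>)" for p
  have lb: "lb p \<in> labels N" "p \<in> chart_dom N (lb p)" if "p \<in> points N" for p
  proof -
    have "\<exists>\<alpha>. \<alpha> \<in> labels N \<and> p \<in> chart_dom N \<alpha>" using that cover by auto
    from someI_ex[OF this] show "lb p \<in> labels N" "p \<in> chart_dom N (lb p)" unfolding lb_def by auto
  qed
  define \<phi> where "\<phi> p = F (put_lab a (lb p)) (put_pt x p)" for p
  have \<phi>: "\<phi> p = F (put_lab a \<alpha>) (put_pt x p)" if "\<alpha> \<in> labels N" "p \<in> chart_dom N \<alpha>" for \<alpha> p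
  proof -
    have "p \<in> points N" using that cover by blast
    note l = lb[OF this]
    have "\<exists>\<beta>. put_lab a \<alpha> = put_lab (put_lab a (lb p)) \<beta>"
      by (rule exI[of _ \<alpha>]) (simp only: put_lab_put_lab)
    then show ?thesis
      unfolding \<phi>_def
      by (rule label[OF put_lab_in[OF a l(1)] put_lab_in[OF a that(1)] put_pt_in[OF a x l] put_pt_in[OF a x that]])
  qed
  have "\<phi> constant_on points N"
  proof (rule locally_constant_imp_constant[OF conn])
    fix p assume p: "p \<in> points N"
    define \<alpha> where "\<alpha> = lb p"
    have \<alpha>: "\<alpha> \<in> labels N" and p\<alpha>: "p \<in> chart_dom N \<alpha>" using lb[OF p] by (simp_all add: \<alpha>_def)
    let ?U = "chart N \<alpha> ` chart_dom N \<alpha>" and ?y = "chart N \<alpha> p"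
    let ?f = "\<lambda>z. F (put_lab a \<alpha>) (put_pt x (chart_inv N \<alpha> z))"
    have hom: "homeomorphism (chart_dom N \<alpha>) ?U (chart N \<alpha>) (chart_inv N \<alpha>)"
      and dom: "openin (top_of_set (points N)) (chart_dom N \<alpha>)" using charts \<alpha> by auto
    obtain d where d: "d > 0" "\<And>z. z \<in> model N \<Longrightarrow> dist z ?y < d \<Longrightarrow> z \<in> ?U"
      using openin_subspace_nhd[OF N.open_chart[OF \<alpha>] imageI[OF p\<alpha>] continuous_on_id zero_less_one] by metis
    define T where "T = chart_dom N \<alpha> \<inter> chart N \<alpha> -` ball ?y d"
    have f: "smooth_on (model N) ?U ?f"
      using chart_smooth_slice[OF a x \<alpha> smooth[OF put_lab_in[OF a \<alpha>]]] by (simp add: chart_smooth_def)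
    have zero: "dir_deriv ?f v z = 0" if z: "z \<in> ?U" and v: "v \<in> model N" for z v
    proof -
      obtain r where r: "r \<in> chart_dom N \<alpha>" "z = chart N \<alpha> r" using z by auto
      have "dir_deriv ?f v z = chart_deriv N \<alpha> (\<lambda>q. F (put_lab a \<alpha>) (put_pt x q)) r v"
        by (simp only: chart_deriv_def r(2))
      also have "\<dots> = 0"
        unfolding chart_deriv_slice[OF a x \<alpha> r(1) v]
        by (rule deriv[OF put_lab_in[OF a \<alpha>] put_pt_in[OF a x \<alpha> r(1)] v])
      finally show ?thesis .
    qed
    have "\<phi> r = \<phi> p" if "r \<in> T" for r
    proof -
      let ?v = "chart N \<alpha> r - ?y"
      have r: "r \<in> chart_dom N \<alpha>" "dist (chart N \<alpha> r) ?y < d" using that by (auto simp: T_def dist_commute)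
      have v: "?v \<in> model N"
        by (intro subspace_diff[OF N.subspace_model] N.chart_in_model \<alpha> r p\<alpha>)
      have "norm (?f (?y + 1 *\<^sub>R ?v) - ?f ?y - 1 *\<^sub>R 0) \<le> 0 * \<bar>1\<bar>"
        by (rule increment_bound[OF f N.subspace_model v, where d = d and x = ?y])
           (use d zero[OF _ v] r N.chart_in_model[OF \<alpha> p\<alpha>] in simp_all)
      then have "?f (chart N \<alpha> r) = ?f ?y" by simp
      then show ?thesis unfolding \<phi>[OF \<alpha> r(1)] \<phi>[OF \<alpha> p\<alpha>] by (simp add: \<alpha> r(1) p\<alpha>)
    qed
    moreover have "openin (top_of_set (chart_dom N \<alpha>)) T"
      unfolding T_def
      by (rule continuous_openin_preimage_gen[OF _ open_ball]) (rule homeomorphism_cont1[OF hom])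
    then have "openin (top_of_set (points N)) T" using dom by (rule openin_trans)
    moreover have "p \<in> T" using p\<alpha> d(1) by (simp add: T_def)
    ultimately show "\<exists>T. openin (top_of_set (points N)) T \<and> p \<in> T \<and> (\<forall>r\<in>T. \<phi> r = \<phi> p)" by blast
  qed
  moreover have "q \<in> points N" "pt x \<in> points N" using \<beta> q lab_in[OF a] pt_in[OF a x] cover by blast+
  ultimately have "\<phi> q = \<phi> (pt x)" unfolding constant_on_def by metis
  then show ?thesis
    unfolding \<phi>[OF \<beta> q] \<phi>[OF lab_in[OF a] pt_in[OF a x]] put_lab_lab put_pt_pt .
qed

end

text \<open>
  The component in \<open>N'\<close> transforms by the changes of coordinates of \<open>N'\<close>, hence it is insensitive to a
  change of the chart of \<open>N\<close>.
\<close>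

lemma component_constant_along_factor:
  assumes F: "product_factor P N lab pt L J put_lab put_pt"
    and F': "product_factor P N' lab' pt' L' J' put_lab' put_pt'"
    and lab: "\<And>a \<beta>. lab' (put_lab a \<beta>) = lab' a"
    and X: "vector_field P X"
    and deriv: "\<And>a x u. a \<in> labels P \<Longrightarrow> x \<in> chart_dom P a \<Longrightarrow> u \<in> model N \<Longrightarrow>
      L' (chart_deriv P a (X a) x (J u)) = 0"
    and a: "a \<in> labels P" and x: "x \<in> chart_dom P a" and \<beta>: "\<beta> \<in> labels N" and q: "q \<in> chart_dom N \<beta>"
  shows "L' (X (put_lab a \<beta>) (put_pt x q)) = L' (X a x)"
proof -
  interpret F: product_factor P N lab pt L J put_lab put_pt by fact
  interpret F': product_factor P N' lab' pt' L' J' put_lab' put_pt' by fact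
  show ?thesis
  proof (rule F.constant_along_factor[where F = "\<lambda>a x. L' (X a x)", OF _ _ _ a x \<beta> q])
    show "chart_smooth P a (\<lambda>x. L' (X a x))" if "a \<in> labels P" for a
      by (rule F.P.chart_smooth_linear[OF F'.bounded_linear_L that F.P.field_smooth[OF X that]])
    show "chart_deriv P a (\<lambda>x. L' (X a x)) x (J u) = 0"
      if "a \<in> labels P" "x \<in> chart_dom P a" "u \<in> model N" for a x u
      using deriv[OF that] F.P.chart_deriv_linear[OF F'.bounded_linear_L that(1) F.P.field_smooth[OF X that(1)]
          that(2) F.J_model[OF that(3)]] by simp
    show "L' (X a x) = L' (X b x)"
      if "a \<in> labels P" "b \<in> labels P" "x \<in> chart_dom P a" "x \<in> chart_dom P b" "\<exists>\<beta>. b = put_lab a \<beta>" for a b x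
    proof -
      have lab_eq: "lab' b = lab' a" using that(5) lab by auto
      have "X b x = tangent_map P P id a b x (X a x)"
        using X that(1-4) unfolding vector_field_def by blast
      then show ?thesis
        using F'.L_tangent_map[OF that(1-4) F.P.field_in_model[OF X that(1,3)]]
          F'.N.tangent_map_same[OF F'.lab_in[OF that(1)] F'.pt_in[OF that(1,3)]
            F'.L_model[OF F.P.field_in_model[OF X that(1,3)]]]
        by (simp add: lab_eq)
    qed
  qed
qed

section \<open>Products of two manifolds\<close>

lemma riem_prod_simps [simp]:
  "points (riem_prod M N) = points M \<times> points N"
  "model (riem_prod M N) = model M \<times> model N"
  "labels (riem_prod M N) = labels M \<times> labels N"
  "chart_dom (riem_prod M N) c = chart_dom M (fst c) \<times> chart_dom N (snd c)"
  "chart (riem_prod M N) c x = (chart M (fst c) (fst x), chart N (snd c) (snd x))"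
  "metric (riem_prod M N) c x u v = metric M (fst c) (fst x) (fst u) (fst v) + metric N (snd c) (snd x) (snd u) (snd v)"
  by (simp_all add: riem_prod_def split: prod.splits)

lemma chart_image_riem_prod:
  "chart (riem_prod M N) c ` (A \<times> B) = (chart M (fst c) ` A) \<times> (chart N (snd c) ` B)"
  by force

lemma riem_prod_metric_charts:
  assumes "metric_charts M" "metric_charts N"
  shows "metric_charts (riem_prod M N)"
proof -
  interpret M: metric_charts M by fact
  interpret N: metric_charts N by fact
  let ?P = "riem_prod M N"
  have inj: "inj_on (chart ?P c) (chart_dom ?P c)" if "c \<in> labels ?P" for c
    using M.inj_chart[of "fst c"] N.inj_chart[of "snd c"] that by (auto simp: inj_on_def)
  have chart_inv: "chart_inv ?P c y = (chart_inv M (fst c) (fst y), chart_inv N (snd c) (snd y))"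
    if c: "c \<in> labels ?P" and y: "y \<in> chart ?P c ` chart_dom ?P c" for c y
  proof -
    obtain x where x: "x \<in> chart_dom ?P c" "y = chart ?P c x" using y by blast
    have "chart_inv ?P c y = x"
      unfolding x(2) chart_inv_def by (rule inv_into_f_f[OF inj[OF c] x(1)])
    then show ?thesis using x c by (auto simp: mem_Times_iff)
  qed
  have sub: "subspace (model ?P)"
    using M.subspace_model N.subspace_model by (simp add: subspace_Times)
  \<comment> \<open>Functions of one factor are smooth on the product.\<close>
  have smooth_fst: "smooth_on (model ?P) (A \<times> B) (\<lambda>y. f (fst y))" if "smooth_on (model M) A f" for A B and f :: "_ \<Rightarrow> 'z::real_normed_vector"
    using smooth_on_affine[OF linear_fst _ that, of "model ?P" "A \<times> B" 0] by auto
  have smooth_snd: "smooth_on (model ?P) (A \<times> B) (\<lambda>y. f (snd y))" if "smooth_on (model N) B f" for A B and f :: "_ \<Rightarrow> 'z::real_normed_vector"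
    using smooth_on_affine[OF linear_snd _ that, of "model ?P" "A \<times> B" 0] by auto
  show ?thesis
  proof
    show "subspace (model ?P)" by (fact sub)
    fix c assume c: "c \<in> labels ?P"
    then have \<alpha>: "fst c \<in> labels M" and \<beta>: "snd c \<in> labels N" by auto
    show "inj_on (chart ?P c) (chart_dom ?P c)" by (rule inj[OF c])
    show op: "openin (top_of_set (model ?P)) (chart ?P c ` chart_dom ?P c)"
      unfolding riem_prod_simps(4) chart_image_riem_prod
      using openin_Times[OF M.open_chart[OF \<alpha>] N.open_chart[OF \<beta>]] by simp
    show "metric ?P c x u v = metric ?P c x v u"
      if "x \<in> chart_dom ?P c" "u \<in> model ?P" "v \<in> model ?P" for x u v
      using that M.metric_sym[OF \<alpha>, of "fst x" "fst u" "fst v"] N.metric_sym[OF \<beta>, of "snd x" "snd u" "snd v"]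
      by (auto simp: mem_Times_iff)
    show "metric ?P c x (u + v) w = metric ?P c x u w + metric ?P c x v w"
      if "x \<in> chart_dom ?P c" "u \<in> model ?P" "v \<in> model ?P" "w \<in> model ?P" for x u v w
      using that M.metric_add[OF \<alpha>, of "fst x" "fst u" "fst v" "fst w"] N.metric_add[OF \<beta>, of "snd x" "snd u" "snd v" "snd w"]
      by (auto simp: mem_Times_iff)
    show "metric ?P c x (r *\<^sub>R u) w = r * metric ?P c x u w"
      if "x \<in> chart_dom ?P c" "u \<in> model ?P" "w \<in> model ?P" for x u w r
      using that M.metric_scale[OF \<alpha>, of "fst x" "fst u" "fst w" r] N.metric_scale[OF \<beta>, of "snd x" "snd u" "snd w" r]
      by (auto simp: mem_Times_iff distrib_left)
    show "u = 0" if x: "x \<in> chart_dom ?P c" and u: "u \<in> model ?P" and z: "\<And>v. v \<in> model ?P \<Longrightarrow> metric ?P c x u v = 0" for x u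
    proof -
      have x': "fst x \<in> chart_dom M (fst c)" "snd x \<in> chart_dom N (snd c)"
        and u': "fst u \<in> model M" "snd u \<in> model N" using x u by auto
      have "metric M (fst c) (fst x) (fst u) v = 0" if "v \<in> model M" for v
        using z[of "(v, 0)"] that subspace_0[OF N.subspace_model]
          N.zero_of_linear[OF N.metric_linear_right[OF \<beta> x'(2) u'(2)]] by simp
      then have "fst u = 0" by (rule M.metric_nondegenerate[OF \<alpha> x'(1) u'(1)])
      have "metric N (snd c) (snd x) (snd u) v = 0" if "v \<in> model N" for v
        using z[of "(0, v)"] that subspace_0[OF M.subspace_model]
          M.zero_of_linear[OF M.metric_linear_right[OF \<alpha> x'(1) u'(1)]] by simp
      then have "snd u = 0" by (rule N.metric_nondegenerate[OF \<beta> x'(2) u'(2)])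
      with \<open>fst u = 0\<close> show ?thesis by (simp add: prod_eq_iff)
    qed
    show "smooth_on (model ?P) (chart ?P c ` chart_dom ?P c) (\<lambda>y. metric ?P c (chart_inv ?P c y) u v)"
      if "u \<in> model ?P" "v \<in> model ?P" for u v
    proof (rule smooth_on_cong[OF op sub])
      have u: "fst u \<in> model M" "fst v \<in> model M" "snd u \<in> model N" "snd v \<in> model N" using that by auto
      show "smooth_on (model ?P) (chart ?P c ` chart_dom ?P c)
         (\<lambda>y. metric M (fst c) (chart_inv M (fst c) (fst y)) (fst u) (fst v)
            + metric N (snd c) (chart_inv N (snd c) (snd y)) (snd u) (snd v))"
        by (rule smooth_on_add[OF _ _ op sub])
           (simp_all only: riem_prod_simps(4) chart_image_riem_prod
             smooth_fst[OF M.metric_smooth[OF \<alpha> u(1,2)]] smooth_snd[OF N.metric_smooth[OF \<beta> u(3,4)]])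
    qed (simp add: chart_inv[OF c])
    fix d assume d: "d \<in> labels ?P"
    then have \<alpha>': "fst d \<in> labels M" and \<beta>': "snd d \<in> labels N" by auto
    have dom: "chart_dom ?P c \<inter> chart_dom ?P d
        = (chart_dom M (fst c) \<inter> chart_dom M (fst d)) \<times> (chart_dom N (snd c) \<inter> chart_dom N (snd d))"
      by auto
    show op': "openin (top_of_set (model ?P)) (chart ?P c ` (chart_dom ?P c \<inter> chart_dom ?P d))"
      unfolding dom chart_image_riem_prod
      using openin_Times[OF M.open_overlap[OF \<alpha> \<alpha>'] N.open_overlap[OF \<beta> \<beta>']] by simp
    show "smooth_on (model ?P) (chart ?P c ` (chart_dom ?P c \<inter> chart_dom ?P d)) (\<lambda>x. chart ?P d (chart_inv ?P c x))"
    proof (rule smooth_on_cong[OF op' sub])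
      have l: "bounded_linear (\<lambda>v. (v, 0))" "bounded_linear (\<lambda>v. (0, v))"
        by (intro bounded_linear_Pair bounded_linear_ident bounded_linear_zero)+
      show "smooth_on (model ?P) (chart ?P c ` (chart_dom ?P c \<inter> chart_dom ?P d))
         (\<lambda>y. (chart M (fst d) (chart_inv M (fst c) (fst y)), 0) + (0, chart N (snd d) (chart_inv N (snd c) (snd y))))"
        by (rule smooth_on_add[OF smooth_on_linear[OF l(1) _ op' sub] smooth_on_linear[OF l(2) _ op' sub] op' sub])
           (simp_all only: dom chart_image_riem_prod
             smooth_fst[OF M.smooth_transition[OF \<alpha> \<alpha>']] smooth_snd[OF N.smooth_transition[OF \<beta> \<beta>']])
    next
      fix y assume "y \<in> chart ?P c ` (chart_dom ?P c \<inter> chart_dom ?P d)"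
      then have "y \<in> chart ?P c ` chart_dom ?P c" by blast
      then show "(chart M (fst d) (chart_inv M (fst c) (fst y)), 0) + (0, chart N (snd d) (chart_inv N (snd c) (snd y)))
          = chart ?P d (chart_inv ?P c y)"
        by (simp add: chart_inv[OF c])
    qed
  qed
qed

lemma fst_factor:
  fixes M :: "('a::topological_space, 'l, 'e::euclidean_space) metric_atlas"
    and N :: "('b::topological_space, 'm, 'f::euclidean_space) metric_atlas"
  assumes "semi_riemannian M" "semi_riemannian N"
  shows "product_factor (riem_prod M N) M fst fst fst (\<lambda>u. (u, 0)) (\<lambda>c \<alpha>. (\<alpha>, snd c)) (\<lambda>x p. (p, snd x))"
proof -
  interpret M: metric_charts M by (rule semi_riemannian_metric_charts[OF assms(1)])
  interpret N: metric_charts N by (rule semi_riemannian_metric_charts[OF assms(2)])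
  interpret P: metric_charts "riem_prod M N" by (rule riem_prod_metric_charts) unfold_locales
  show ?thesis
  proof
    fix a x u v assume "a \<in> labels (riem_prod M N)" "x \<in> chart_dom (riem_prod M N) a" "u \<in> model M"
      "v \<in> model (riem_prod M N)"
    then show "metric (riem_prod M N) a x (u, 0) v = metric M (fst a) (fst x) u (fst v)"
      using N.zero_of_linear[OF N.metric_linear_left[of "snd a" "snd x" "snd v"]] by auto
  qed (use assms subspace_0[OF N.subspace_model] in \<open>auto simp: linear_fst linear_iff\<close>)
qed

lemma snd_factor:
  fixes M :: "('a::topological_space, 'l, 'e::euclidean_space) metric_atlas"
    and N :: "('b::topological_space, 'm, 'f::euclidean_space) metric_atlas"
  assumes "semi_riemannian M" "semi_riemannian N"
  shows "product_factor (riem_prod M N) N snd snd snd (\<lambda>u. (0, u)) (\<lambda>c \<beta>. (fst c, \<beta>)) (\<lambda>x q. (fst x, q))"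
proof -
  interpret M: metric_charts M by (rule semi_riemannian_metric_charts[OF assms(1)])
  interpret N: metric_charts N by (rule semi_riemannian_metric_charts[OF assms(2)])
  interpret P: metric_charts "riem_prod M N" by (rule riem_prod_metric_charts) unfold_locales
  show ?thesis
  proof
    fix a x u v assume "a \<in> labels (riem_prod M N)" "x \<in> chart_dom (riem_prod M N) a" "u \<in> model N"
      "v \<in> model (riem_prod M N)"
    then show "metric (riem_prod M N) a x (0, u) v = metric N (snd a) (snd x) u (snd v)"
      using M.zero_of_linear[OF M.metric_linear_left[of "fst a" "fst x" "fst v"]] by auto
  qed (use assms subspace_0[OF M.subspace_model] in \<open>auto simp: linear_snd linear_iff\<close>)
qed

lemma semi_riemannian_chart_exists:
  fixes M :: "('a::topological_space, 'l, 'e::euclidean_space) metric_atlas"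
  assumes "semi_riemannian M"
  obtains \<alpha> p where "\<alpha> \<in> labels M" "p \<in> chart_dom M \<alpha>"
proof -
  have "points M \<noteq> {}" "(\<Union>\<alpha>\<in>labels M. chart_dom M \<alpha>) = points M"
    using assms by (auto simp: semi_riemannian_def smooth_manifold_def)
  then show ?thesis using that by blast
qed

lemma vector_field_outside: "vector_field M X \<Longrightarrow> \<not> (\<alpha> \<in> labels M \<and> p \<in> chart_dom M \<alpha>) \<Longrightarrow> X \<alpha> p = 0"
  unfolding vector_field_def by blast

text \<open>
  The map is injective because the slices of a sum of pull-backs return the summands, and onto by the
  decoupling of the two components of a Killing field.
\<close>

theorem killing_algebra_riem_prod:
  fixes M :: "('a::topological_space, 'l, 'e::euclidean_space) metric_atlas"
    and N :: "('b::topological_space, 'm, 'f::euclidean_space) metric_atlas"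
  assumes M: "semi_riemannian M" and N: "semi_riemannian N" and noparallel: "\<not> admits_nonzero_parallel_field M"
  shows "lie_isomorphism (lie_direct_sum (killing_algebra M) (killing_algebra N))
    (killing_algebra (riem_prod M N)) (sum_of_pull_backs M N)"
proof -
  let ?P = "riem_prod M N" and ?S = "sum_of_pull_backs M N"
  note fst = fst_factor[OF M N] and snd = snd_factor[OF M N]
  interpret F: product_factor ?P M fst fst fst "\<lambda>u. (u, 0)" "\<lambda>c \<alpha>. (\<alpha>, snd c)" "\<lambda>x p. (p, snd x)" by (rule fst)
  interpret G: product_factor ?P N snd snd snd "\<lambda>u. (0, u)" "\<lambda>c \<beta>. (fst c, \<beta>)" "\<lambda>x q. (fst x, q)" by (rule snd)
  have S: "?S (Y, Z) c x = (if c \<in> labels ?P \<and> x \<in> chart_dom ?P c then (Y (fst c) (fst x), Z (snd c) (snd x)) else 0)"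
    for Y Z c x
    by (cases c; cases x) (auto simp: sum_of_pull_backs_def field_add_def pull_back_fst_def pull_back_snd_def zero_prod_def)
  have S_add: "?S (Y, Z) = field_add (F.pull_back Y) (G.pull_back Z)" for Y Z
    by (intro ext) (auto simp: S field_add_def F.pull_back_def G.pull_back_def)
  have killing: "killing_field ?P (?S (Y, Z))" if "killing_field M Y" "killing_field N Z" for Y Z
    unfolding S_add by (intro F.P.killing_field_add F.pull_back_killing G.pull_back_killing that)
  obtain c0 x0 where c0: "c0 \<in> labels ?P" and x0: "x0 \<in> chart_dom ?P c0"
  proof -
    obtain \<alpha> p where "\<alpha> \<in> labels M" "p \<in> chart_dom M \<alpha>" by (rule semi_riemannian_chart_exists[OF M])
    moreover obtain \<beta> q where "\<beta> \<in> labels N" "q \<in> chart_dom N \<beta>" by (rule semi_riemannian_chart_exists[OF N])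
    ultimately show thesis using that[of "(\<alpha>, \<beta>)" "(p, q)"] by simp
  qed
  have inj: "Y = Y' \<and> Z = Z'"
    if "killing_field M Y" "killing_field M Y'" "killing_field N Z" "killing_field N Z'"
      and eq: "?S (Y, Z) = ?S (Y', Z')" for Y Y' Z Z'
  proof (intro conjI ext)
    have vf: "vector_field M Y" "vector_field M Y'" "vector_field N Z" "vector_field N Z'"
      using that by (auto simp: killing_field_def)
    note eq' = fun_cong[OF fun_cong[OF eq], unfolded S]
    show "Y \<alpha> p = Y' \<alpha> p" for \<alpha> p
      using eq'[of "(\<alpha>, snd c0)" "(p, snd x0)"] c0 x0 vector_field_outside[OF vf(1), of \<alpha> p]
        vector_field_outside[OF vf(2), of \<alpha> p]
      by (cases "\<alpha> \<in> labels M \<and> p \<in> chart_dom M \<alpha>") auto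
    show "Z \<beta> q = Z' \<beta> q" for \<beta> q
      using eq'[of "(fst c0, \<beta>)" "(fst x0, q)"] c0 x0 vector_field_outside[OF vf(3), of \<beta> q]
        vector_field_outside[OF vf(4), of \<beta> q]
      by (cases "\<beta> \<in> labels N \<and> q \<in> chart_dom N \<beta>") auto
  qed
  have surj: "\<exists>Y Z. killing_field M Y \<and> killing_field N Z \<and> ?S (Y, Z) = X" if K: "killing_field ?P X" for X
  proof (intro exI conjI)
    have X: "vector_field ?P X" using K by (simp add: killing_field_def)
    \<comment> \<open>Neither component varies along the other factor, so \<open>X\<close> is determined by its two slices.\<close>
    note cross = cross_derivatives_zero[OF fst snd _ noparallel K]
    show "killing_field M (F.slice X c0 x0)" by (rule F.slice_killing[OF K c0 x0])
    show "killing_field N (G.slice X c0 x0)" by (rule G.slice_killing[OF K c0 x0])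
    show "?S (F.slice X c0 x0, G.slice X c0 x0) = X"
    proof (intro ext)
      fix c x
      show "?S (F.slice X c0 x0, G.slice X c0 x0) c x = X c x"
      proof (cases "c \<in> labels ?P \<and> x \<in> chart_dom ?P c")
        case False
        then show ?thesis using vector_field_outside[OF X False] unfolding S by (simp only: if_False)
      next
        case True
        then have c: "c \<in> labels ?P" and x: "x \<in> chart_dom ?P c" by auto
        have in1: "(fst c, snd c0) \<in> labels ?P" "(fst x, snd x0) \<in> chart_dom ?P (fst c, snd c0)"
          and in2: "(fst c0, snd c) \<in> labels ?P" "(fst x0, snd x) \<in> chart_dom ?P (fst c0, snd c)"
          using c x c0 x0 by auto
        have "fst (X (fst (fst c, snd c0), snd c) (fst (fst x, snd x0), snd x)) = fst (X (fst c, snd c0) (fst x, snd x0))"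
          by (rule component_constant_along_factor[OF snd fst _ X cross(1) in1]) (use c x in auto)
        moreover have "snd (X (fst c, snd (fst c0, snd c)) (fst x, snd (fst x0, snd x))) = snd (X (fst c0, snd c) (fst x0, snd x))"
          by (rule component_constant_along_factor[OF fst snd _ X cross(2) in2]) (use c x in auto)
        ultimately show ?thesis
          using c x by (auto simp: S F.slice_def G.slice_def mem_Times_iff prod_eq_iff)
      qed
    qed
  qed
  have bracket: "?S (field_bracket M Y Y', field_bracket N Z Z') = field_bracket ?P (?S (Y, Z)) (?S (Y', Z'))"
    if K: "killing_field M Y" "killing_field M Y'" "killing_field N Z" "killing_field N Z'" for Y Y' Z Z'
  proof (intro ext)
    fix c x
    have vf: "vector_field M Y" "vector_field M Y'" "vector_field N Z" "vector_field N Z'"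
      using K by (auto simp: killing_field_def)
    have vS: "vector_field ?P (?S (Y, Z))" "vector_field ?P (?S (Y', Z'))"
      using killing[OF K(1,3)] killing[OF K(2,4)] by (auto simp: killing_field_def)
    show "?S (field_bracket M Y Y', field_bracket N Z Z') c x = field_bracket ?P (?S (Y, Z)) (?S (Y', Z')) c x"
    proof (cases "c \<in> labels ?P \<and> x \<in> chart_dom ?P c")
      case False
      then show ?thesis unfolding S field_bracket_def by (simp only: if_False)
    next
      case True
      then have c: "c \<in> labels ?P" and x: "x \<in> chart_dom ?P c" by auto
      have "fst (field_bracket ?P (?S (Y, Z)) (?S (Y', Z')) c x) = field_bracket M Y Y' (fst c) (fst x)"
        by (rule F.L_field_bracket[OF vS vf(1,2) _ _ c x]) (simp_all only: S, simp_all)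
      moreover have "snd (field_bracket ?P (?S (Y, Z)) (?S (Y', Z')) c x) = field_bracket N Z Z' (snd c) (snd x)"
        by (rule G.L_field_bracket[OF vS vf(3,4) _ _ c x]) (simp_all only: S, simp_all)
      ultimately show ?thesis
        unfolding S[of "field_bracket M Y Y'" "field_bracket N Z Z'" c x] if_P[OF True] by (simp only: prod_eq_iff fst_conv snd_conv)
    qed
  qed
  have add: "?S (field_add Y Y', field_add Z Z') = field_add (?S (Y, Z)) (?S (Y', Z'))" for Y Y' Z Z'
    by (intro ext) (simp add: S field_add_def)
  have scale: "?S (field_scale r Y, field_scale r Z) = field_scale r (?S (Y, Z))" for r Y Z
    by (intro ext) (simp add: S field_scale_def)
  have "bij_betw ?S ({Y. killing_field M Y} \<times> {Z. killing_field N Z}) {X. killing_field ?P X}"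
    unfolding bij_betw_def
  proof
    show "inj_on ?S ({Y. killing_field M Y} \<times> {Z. killing_field N Z})"
      by (intro inj_onI) (use inj in auto)
    show "?S ` ({Y. killing_field M Y} \<times> {Z. killing_field N Z}) = {X. killing_field ?P X}"
      using killing surj by (auto simp: image_iff) metis
  qed
  then show ?thesis
    unfolding lie_isomorphism_def lie_direct_sum_def killing_algebra_def
    using add scale bracket by auto
qed

section \<open>Products of finite families\<close>

lemma riem_prod_family_simps [simp]:
  "points (riem_prod_family M) = {x. \<forall>i. x $ i \<in> points (M i)}"
  "model (riem_prod_family M) = {v. \<forall>i. v $ i \<in> model (M i)}"
  "labels (riem_prod_family M) = {a. \<forall>i. a i \<in> labels (M i)}"
  "chart_dom (riem_prod_family M) a = {x. \<forall>i. x $ i \<in> chart_dom (M i) (a i)}"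
  "chart (riem_prod_family M) a x = (\<chi> i. chart (M i) (a i) (x $ i))"
  "metric (riem_prod_family M) a x u v = (\<Sum>i\<in>UNIV. metric (M i) (a i) (x $ i) (u $ i) (v $ i))"
  by (simp_all add: riem_prod_family_def)

lemma family_factor:
  fixes M :: "'k::finite \<Rightarrow> ('c::topological_space, 'n, 'g::euclidean_space) metric_atlas"
  assumes P: "semi_riemannian (riem_prod_family M)" and M: "\<And>i. semi_riemannian (M i)"
  shows "product_factor (riem_prod_family M) (M i) (\<lambda>a. a i) (\<lambda>x. x $ i) (\<lambda>v. v $ i)
    (\<lambda>u. \<chi> j. if j = i then u else 0) (\<lambda>a \<alpha>. a(i := \<alpha>)) (\<lambda>x p. \<chi> j. if j = i then p else x $ j)"
proof -
  interpret P: metric_charts "riem_prod_family M" by (rule semi_riemannian_metric_charts[OF P])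
  interpret M: metric_charts "M j" for j by (rule semi_riemannian_metric_charts[OF M])
  show ?thesis
  proof
    fix a x u v assume *: "a \<in> labels (riem_prod_family M)" "x \<in> chart_dom (riem_prod_family M) a" "u \<in> model (M i)"
      "v \<in> model (riem_prod_family M)"
    have "metric (riem_prod_family M) a x (\<chi> j. if j = i then u else 0) v
        = (\<Sum>j\<in>UNIV. if j = i then metric (M i) (a i) (x $ i) u (v $ i) else 0)"
      unfolding riem_prod_family_simps
      by (rule sum.cong) (use * M.zero_of_linear[OF M.metric_linear_left] in auto)
    then show "metric (riem_prod_family M) a x (\<chi> j. if j = i then u else 0) v = metric (M i) (a i) (x $ i) u (v $ i)"
      by simp
  next
    fix a x \<alpha> p v w assume *: "a \<in> labels (riem_prod_family M)" "x \<in> chart_dom (riem_prod_family M) a"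
    show "metric (riem_prod_family M) (a(i := \<alpha>)) (\<chi> j. if j = i then p else x $ j) v w
        - metric (M i) \<alpha> p (v $ i) (w $ i)
        = metric (riem_prod_family M) a x v w - metric (M i) (a i) (x $ i) (v $ i) (w $ i)"
      by (simp add: sum.remove[of UNIV i])
  qed (use M subspace_0[OF M.subspace_model] in \<open>auto simp: linear_iff vec_eq_iff\<close>)
qed

lemma sum_of_pull_backs_family_component:
  fixes M :: "'k::finite \<Rightarrow> ('c, 'n, 'g::real_vector) metric_atlas"
  assumes "a \<in> labels (riem_prod_family M)" "x \<in> chart_dom (riem_prod_family M) a"
  shows "sum_of_pull_backs_family M Y a x $ i = Y i (a i) (x $ i)"
  using assms unfolding sum_of_pull_backs_family_def pull_back_factor_def by simp

lemma sum_of_pull_backs_family_outside: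
  fixes M :: "'k::finite \<Rightarrow> ('c, 'n, 'g::real_vector) metric_atlas"
  assumes "\<not> (a \<in> labels (riem_prod_family M) \<and> x \<in> chart_dom (riem_prod_family M) a)"
  shows "sum_of_pull_backs_family M Y a x = 0"
  unfolding sum_of_pull_backs_family_def pull_back_factor_def if_not_P[OF assms] by simp

text \<open>
  For a family the decoupling is applied to every pair of distinct factors.
\<close>

theorem killing_algebra_riem_prod_family:
  fixes M :: "'k::finite \<Rightarrow> ('c::topological_space, 'n, 'g::euclidean_space) metric_atlas"
  assumes P: "semi_riemannian (riem_prod_family M)" and M: "\<And>i. semi_riemannian (M i)"
    and unique: "\<And>i j. admits_nonzero_parallel_field (M i) \<Longrightarrow> admits_nonzero_parallel_field (M j) \<Longrightarrow> i = j"
  shows "lie_isomorphism (lie_direct_sum_family (\<lambda>i. killing_algebra (M i)))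
    (killing_algebra (riem_prod_family M)) (sum_of_pull_backs_family M)"
proof -
  let ?P = "riem_prod_family M" and ?S = "sum_of_pull_backs_family M"
  let ?L = "lie_direct_sum_family (\<lambda>i. killing_algebra (M i))"
  note factor = family_factor[OF P M]
  interpret P: metric_charts ?P by (rule semi_riemannian_metric_charts[OF P])
  interpret F: product_factor ?P "M i" "\<lambda>a. a i" "\<lambda>x. x $ i" "\<lambda>v. v $ i"
    "\<lambda>u. \<chi> j. if j = i then u else 0" "\<lambda>a \<alpha>. a(i := \<alpha>)" "\<lambda>x p. \<chi> j. if j = i then p else x $ j" for i
    by (rule factor)
  note S = sum_of_pull_backs_family_component and S0 = sum_of_pull_backs_family_outside
  have killing: "killing_field ?P (?S Y)" if "\<And>i. killing_field (M i) (Y i)" for Y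
  proof -
    have "?S Y = (\<lambda>a x. \<Sum>i\<in>UNIV. F.pull_back i (Y i) a x)"
      by (intro ext) (auto simp: sum_of_pull_backs_family_def pull_back_factor_def F.pull_back_def intro!: sum.cong)
    then show ?thesis
      using P.killing_field_sum[of UNIV "\<lambda>i. F.pull_back i (Y i)"] F.pull_back_killing[OF that] by simp
  qed
  obtain a0 x0 where a0: "a0 \<in> labels ?P" and x0: "x0 \<in> chart_dom ?P a0"
    by (rule semi_riemannian_chart_exists[OF P])
  have inj: "Y = Y'" if K: "\<And>i. killing_field (M i) (Y i)" "\<And>i. killing_field (M i) (Y' i)" and eq: "?S Y = ?S Y'" for Y Y'
  proof (intro ext)
    fix i \<alpha> p
    have vf: "vector_field (M i) (Y i)" "vector_field (M i) (Y' i)" using K by (auto simp: killing_field_def)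
    show "Y i \<alpha> p = Y' i \<alpha> p"
    proof (cases "\<alpha> \<in> labels (M i) \<and> p \<in> chart_dom (M i) \<alpha>")
      case False
      then show ?thesis using vector_field_outside[OF vf(1) False] vector_field_outside[OF vf(2) False] by simp
    next
      case True
      note in' = F.put_lab_in[OF a0 conjunct1[OF True]] F.put_pt_in[OF a0 x0 conjunct1[OF True] conjunct2[OF True]]
      show ?thesis
        using S[OF in', of Y i] S[OF in', of Y' i] eq by simp
    qed
  qed
  have surj: "\<exists>Y. (\<forall>i. killing_field (M i) (Y i)) \<and> ?S Y = X" if K: "killing_field ?P X" for X
  proof (intro exI conjI allI)
    have X: "vector_field ?P X" using K by (simp add: killing_field_def)
    \<comment> \<open>One of the factors \<open>i\<close> and \<open>k\<close> has no nonzero parallel field; either of them will do.\<close>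
    have cross: "chart_deriv ?P a (X a) x (\<chi> j. if j = k then u else 0) $ i = 0"
      if ax: "a \<in> labels ?P" "x \<in> chart_dom ?P a" and u: "u \<in> model (M k)" and ik: "i \<noteq> k" for a x u i k
    proof (cases "admits_nonzero_parallel_field (M i)")
      case False
      show ?thesis
        by (rule cross_derivatives_zero(1)[OF factor[of i] factor[of k] _ False K ax u]) (use ik in simp)
    next
      case True
      then have "\<not> admits_nonzero_parallel_field (M k)" using unique ik by blast
      then show ?thesis
        by (rule cross_derivatives_zero(2)[OF factor[of k] factor[of i] _ _ K ax u, rotated]) (use ik in simp)
    qed
    \<comment> \<open>The other coordinates are replaced one at a time.\<close>
    have indep: "X (\<lambda>j. if j \<in> A then b j else a j) (\<chi> j. if j \<in> A then y $ j else x $ j) $ i = X a x $ i"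
      if ab: "a \<in> labels ?P" "x \<in> chart_dom ?P a" "b \<in> labels ?P" "y \<in> chart_dom ?P b" and A: "finite A" "i \<notin> A"
      for a b x y i A
      using A
    proof (induction A rule: finite_induct)
      case empty
      then show ?case by simp
    next
      case (insert k A)
      let ?a = "\<lambda>j. if j \<in> A then b j else a j" and ?x = "\<chi> j. if j \<in> A then y $ j else x $ j"
      have in': "?a \<in> labels ?P" "?x \<in> chart_dom ?P ?a" using ab by auto
      have "X (?a(k := b k)) (\<chi> j. if j = k then y $ k else ?x $ j) $ i = X ?a ?x $ i"
        by (rule component_constant_along_factor[OF factor[of k] factor[of i] _ X cross in'])
           (use insert.prems ab in auto)
      moreover have "?a(k := b k) = (\<lambda>j. if j \<in> insert k A then b j else a j)"
        "(\<chi> j. if j = k then y $ k else ?x $ j) = (\<chi> j. if j \<in> insert k A then y $ j else x $ j)"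
        by (auto simp: vec_eq_iff)
      ultimately show ?case using insert by simp
    qed
    have comp: "X b y $ i = X a x $ i"
      if ab: "a \<in> labels ?P" "x \<in> chart_dom ?P a" "b \<in> labels ?P" "y \<in> chart_dom ?P b" "a i = b i" "x $ i = y $ i"
      for a b x y i
    proof -
      have "(\<lambda>j. if j \<in> - {i} then b j else a j) = b" "(\<chi> j. if j \<in> - {i} then y $ j else x $ j) = y"
        using ab(5,6) by (auto simp: vec_eq_iff)
      then show ?thesis using indep[OF ab(1-4), of "- {i}" i] by simp
    qed
    show "killing_field (M i) (F.slice i X a0 x0)" for i by (rule F.slice_killing[OF K a0 x0])
    show "?S (\<lambda>i. F.slice i X a0 x0) = X"
    proof (intro ext)
      fix a x
      show "?S (\<lambda>i. F.slice i X a0 x0) a x = X a x"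
      proof (cases "a \<in> labels ?P \<and> x \<in> chart_dom ?P a")
        case False
        then show ?thesis using vector_field_outside[OF X False] S0[OF False] by simp
      next
        case True
        then have a: "a \<in> labels ?P" and x: "x \<in> chart_dom ?P a" by auto
        show ?thesis
          unfolding vec_eq_iff
        proof
          fix i
          let ?b = "a0(i := a i)" and ?y = "\<chi> j. if j = i then x $ i else x0 $ j"
          have ai: "a i \<in> labels (M i)" "x $ i \<in> chart_dom (M i) (a i)" using a x by auto
          have "?S (\<lambda>i. F.slice i X a0 x0) a x $ i = X ?b ?y $ i"
            using S[OF a x, of "\<lambda>i. F.slice i X a0 x0" i] ai by (simp add: F.slice_def)
          also have "\<dots> = X a x $ i"
            by (rule comp[OF a x F.put_lab_in[OF a0 ai(1)] F.put_pt_in[OF a0 x0 ai]]) simp_all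
          finally show "?S (\<lambda>i. F.slice i X a0 x0) a x $ i = X a x $ i" .
        qed
      qed
    qed
  qed
  have bracket: "?S (\<lambda>i. field_bracket (M i) (Y i) (Y' i)) = field_bracket ?P (?S Y) (?S Y')"
    if K: "\<And>i. killing_field (M i) (Y i)" "\<And>i. killing_field (M i) (Y' i)" for Y Y'
  proof (intro ext)
    fix a x
    have vf: "vector_field (M i) (Y i)" "vector_field (M i) (Y' i)" for i using K by (auto simp: killing_field_def)
    have vS: "vector_field ?P (?S Y)" "vector_field ?P (?S Y')"
      using killing[OF K(1)] killing[OF K(2)] by (auto simp: killing_field_def)
    show "?S (\<lambda>i. field_bracket (M i) (Y i) (Y' i)) a x = field_bracket ?P (?S Y) (?S Y') a x"
    proof (cases "a \<in> labels ?P \<and> x \<in> chart_dom ?P a")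
      case False
      then show ?thesis unfolding S0[OF False] field_bracket_def if_not_P[OF False] by simp
    next
      case True
      then have a: "a \<in> labels ?P" and x: "x \<in> chart_dom ?P a" by auto
      show ?thesis
        unfolding vec_eq_iff
      proof
        fix i
        have "field_bracket ?P (?S Y) (?S Y') a x $ i = field_bracket (M i) (Y i) (Y' i) (a i) (x $ i)"
          by (rule F.L_field_bracket[OF vS vf _ _ a x]) (rule S; assumption)+
        then show "?S (\<lambda>i. field_bracket (M i) (Y i) (Y' i)) a x $ i = field_bracket ?P (?S Y) (?S Y') a x $ i"
          using S[OF a x, of "\<lambda>i. field_bracket (M i) (Y i) (Y' i)" i] by simp
      qed
    qed
  qed
  have add: "?S (\<lambda>i. field_add (Y i) (Y' i)) = field_add (?S Y) (?S Y')" for Y Y'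
  proof (intro ext)
    fix a x
    show "?S (\<lambda>i. field_add (Y i) (Y' i)) a x = field_add (?S Y) (?S Y') a x"
    proof (cases "a \<in> labels ?P \<and> x \<in> chart_dom ?P a")
      case True
      then show ?thesis using S[OF conjunct1[OF True] conjunct2[OF True]] by (simp only: vec_eq_iff field_add_def vector_add_component) simp
    next
      case False
      show ?thesis by (simp only: S0[OF False] field_add_def add_0)
    qed
  qed
  have scale: "?S (\<lambda>i. field_scale r (Y i)) = field_scale r (?S Y)" for r Y
  proof (intro ext)
    fix a x
    show "?S (\<lambda>i. field_scale r (Y i)) a x = field_scale r (?S Y) a x"
    proof (cases "a \<in> labels ?P \<and> x \<in> chart_dom ?P a")
      case True
      then show ?thesis using S[OF conjunct1[OF True] conjunct2[OF True]] by (simp only: vec_eq_iff field_scale_def vector_scaleR_component) simp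
    next
      case False
      show ?thesis by (simp only: S0[OF False] field_scale_def scaleR_zero_right)
    qed
  qed
  have "bij_betw ?S {Y. \<forall>i. killing_field (M i) (Y i)} {X. killing_field ?P X}"
    unfolding bij_betw_def
  proof
    show "inj_on ?S {Y. \<forall>i. killing_field (M i) (Y i)}" by (intro inj_onI) (use inj in blast)
    show "?S ` {Y. \<forall>i. killing_field (M i) (Y i)} = {X. killing_field ?P X}"
    proof (intro equalityI subsetI)
      fix X assume "X \<in> {X. killing_field ?P X}"
      then obtain Y where "\<forall>i. killing_field (M i) (Y i)" "?S Y = X" using surj by blast
      then show "X \<in> ?S ` {Y. \<forall>i. killing_field (M i) (Y i)}" by blast
    qed (use killing in blast)
  qed
  then have bij: "bij_betw ?S (lie_carrier ?L) (lie_carrier (killing_algebra ?P))"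
    by (simp only: lie_direct_sum_family_def killing_algebra_def lie_structure.select_convs mem_Collect_eq)
  show ?thesis
    unfolding lie_isomorphism_def
  proof (intro conjI ballI allI bij)
    fix Y Y' assume "Y \<in> lie_carrier ?L" "Y' \<in> lie_carrier ?L"
    then have K: "killing_field (M i) (Y i)" "killing_field (M i) (Y' i)" for i
      by (simp_all add: lie_direct_sum_family_def killing_algebra_def)
    show "?S (lie_add ?L Y Y') = lie_add (killing_algebra ?P) (?S Y) (?S Y')"
      using add[of Y Y'] by (simp only: lie_direct_sum_family_def killing_algebra_def lie_structure.select_convs)
    show "?S (lie_bracket ?L Y Y') = lie_bracket (killing_algebra ?P) (?S Y) (?S Y')"
      using bracket[OF K] by (simp only: lie_direct_sum_family_def killing_algebra_def lie_structure.select_convs)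
  next
    fix r Y
    show "?S (lie_scale ?L r Y) = lie_scale (killing_algebra ?P) r (?S Y)"
      using scale[of r Y] by (simp only: lie_direct_sum_family_def killing_algebra_def lie_structure.select_convs)
  qed
qed

theorem theorem1:
  fixes Mplus :: "('a::topological_space, 'l, 'e::euclidean_space) metric_atlas"
    and Mminus :: "('b::topological_space, 'm, 'f::euclidean_space) metric_atlas"
    and M :: "'k::finite \<Rightarrow> ('c::topological_space, 'n, 'g::euclidean_space) metric_atlas"
  shows "(semi_riemannian Mplus \<and> semi_riemannian Mminus \<and>
          real_analytic Mplus \<and> simply_connected (points Mplus) \<and>
          \<not> admits_nonzero_parallel_field Mplus
          \<longrightarrow> lie_isomorphism
                (lie_direct_sum (killing_algebra Mplus) (killing_algebra Mminus))
                (killing_algebra (riem_prod Mplus Mminus))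
                (sum_of_pull_backs Mplus Mminus))
       \<and> (semi_riemannian (riem_prod_family M) \<and>
          simply_connected (points (riem_prod_family M)) \<and>
          geodesically_complete (riem_prod_family M) \<and>
          de_rham_wu_decomposition (riem_prod_family M) M \<and>
          (\<forall>i. real_analytic (M i)) \<and>
          (\<forall>i j. admits_nonzero_parallel_field (M i) \<longrightarrow> admits_nonzero_parallel_field (M j) \<longrightarrow> i = j)
          \<longrightarrow> lie_isomorphism
                (lie_direct_sum_family (\<lambda>i. killing_algebra (M i)))
                (killing_algebra (riem_prod_family M))
                (sum_of_pull_backs_family M))"
proof (intro conjI impI; elim conjE)
  assume "semi_riemannian Mplus" "semi_riemannian Mminus" "\<not> admits_nonzero_parallel_field Mplus"
  then show "lie_isomorphism (lie_direct_sum (killing_algebra Mplus) (killing_algebra Mminus))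
      (killing_algebra (riem_prod Mplus Mminus)) (sum_of_pull_backs Mplus Mminus)"
    by (rule killing_algebra_riem_prod)
next
  assume P: "semi_riemannian (riem_prod_family M)"
    and deRham: "de_rham_wu_decomposition (riem_prod_family M) M"
    and unique: "\<forall>i j. admits_nonzero_parallel_field (M i) \<longrightarrow> admits_nonzero_parallel_field (M j) \<longrightarrow> i = j"
  have factors: "semi_riemannian (M i)" for i
    using deRham unfolding de_rham_wu_decomposition_def by (elim conjE) simp
  show "lie_isomorphism (lie_direct_sum_family (\<lambda>i. killing_algebra (M i)))
      (killing_algebra (riem_prod_family M)) (sum_of_pull_backs_family M)"
    by (rule killing_algebra_riem_prod_family[OF P factors unique[rule_format]])
qed

end
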